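(* Let $(M,L)$ be a pseudo-Finsler manifold on $A$ with fundamental tensor $g$. Let $\mathcal Q$ be a symmetric $A$-anisotropic tensor of type $(0,3)$ with $\mathcal Q_v(v,u,w)=0$ for all $v\in A$, $u,w\in T_{\pi(v)}M$, and let $\hat\nabla$ be the torsion-free $A$-anisotropic connection satisfying $\hat\nabla g=\mathcal Q$, with curvature tensor $\hat R$ and covariant derivative $\hat D_\gamma$ along a piecewise smooth curve $\gamma:[a,b]\to M$. Let $\Lambda$ be an $A$-admissible piecewise smooth variation of $\gamma$ with variational vector field $W$ and longitudinal curves $\gamma_s$. Then $$\begin{aligned}E'(0):=\left.\frac{d(E(\gamma_s))}{ds}\right|_{s=0}={}&-\int_a^bg_{\dot\gamma}(W,\hat D^{\dot\gamma}_\gamma\dot\gamma)\,dt+g_{\dot\gamma}(W,\dot\gamma)\big|_a^b\\&+\sum_{i=1}^h\big(\mathcal L_L(\dot\gamma(t_i^-))(W(t_i))-\mathcal L_L(\dot\gamma(t_i^+))(W(t_i))\big),\end{aligned}$$ where $\dot\gamma(t_i^+)$ (resp. $\dot\gamma(t_i^-)$), $i=1,\ldots,h$, denotes the right (resp. left) velocity at the breaks $a<t_1<\cdots<t_h<b$, and $\mathcal L_L(v)(w)=g_v(v,w)$. Moreover, suppose that $\gamma$ is a geodesic which is orthogonal at its endpoints to two submanifolds $\mathcal P$ and $\tilde{\mathcal P}$ of $M$ (with $\gamma(a)\in\mathcal P$, $\gamma(b)\in\tilde{\mathcal P}$), such that the restrictions of $g_{\dot\gamma(a)}$ to $T_{\gamma(a)}\mathcal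 P$ and of $g_{\dot\gamma(b)}$ to $T_{\gamma(b)}\tilde{\mathcal P}$ are non-degenerate, and consider a smooth $A$-admissible $(\mathcal P,\tilde{\mathcal P})$-variation of $\gamma$ with variational vector field $W$. Then $E''(0)=\left.\frac{d^2(E(\gamma_s))}{ds^2}\right|_{s=0}$ is given by $$\begin{aligned}E''(0)={}&\int_a^b\Big(-g_{\dot\gamma}(\hat R_{\dot\gamma}(\dot\gamma,W)W,\dot\gamma)+g_{\dot\gamma}(\hat D^{\dot\gamma}_\gamma W,\hat D^{\dot\gamma}_\gamma W)\Big)dt\\&+g_{\dot\gamma(b)}\big(\hat S^{\tilde{\mathcal P}}_{\dot\gamma(b)}(W,W),\dot\gamma(b)\big)-g_{\dot\gamma(a)}\big(\hat S^{\mathcal P}_{\dot\gamma(a)}(W,W),\dot\gamma(a)\big).\end{aligned}$$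
   Context: $M$ is a smooth manifold, $\pi:TM\to M$, and $A\subset TM\setminus\mathbf 0$ is an open conic subset ($\lambda v\in A$ for $v\in A$, $\lambda>0$) with $\pi(A)=M$. A pseudo-Finsler metric on $A$ is a smooth function $L:A\to\mathbb R$ with $L(\lambda v)=\lambda^2L(v)$ for $\lambda>0$, whose fundamental tensor $g_v(u,w)=\frac12\frac{\partial^2}{\partial t\partial s}L(v+tu+sw)|_{t=s=0}$ is non-degenerate for each $v\in A$. $\mathcal F(\cdot)$ denotes smooth functions, $\mathfrak X(\cdot)$ smooth vector fields. $\mathfrak T^1_0(M,A)$ is the set of smooth maps $v\in A\mapsto\mathcal X_v\in T_{\pi(v)}M$; vector fields $X$ on $M$ are regarded as such maps via $v\mapsto X_{\pi(v)}$. An $A$-anisotropic tensor of type $(0,s)$ (resp. $(1,s)$) amounts to multilinear maps $T_v:(T_{\pi(v)}M)^s\to\mathbb R$ (resp. $\to T_{\pi(v)}M$) depending smoothly on $v\in A$; vertical derivative $(\partial^\nu T)_v(x_1,\ldots,x_s,z)=\frac{d}{dt}T_{v+tz}(x_1,\ldots,x_s)|_{t=0}$. A vector field $V$ on an open $\Omega\subset M$ is $A$-admissible if $V_p\in A$ for all $p\in\Omega$; it extends $v$ if $V_{\pi(v)}=v$; $(T_V)_p=T_{V_p}$. An $A$-anisotropic connection is a map $\nabla:A\times\mathfrak X(M)\times\mathfrak X(M)\to TM$, $(v,X,Y)\mapsto\nabla^v_XY\in T_{\pi(v)}M$, additive in $Y$, with $\nabla^v_X(fY)=X_{\pi(v)}(f)Y_{\pi(v)}+f(\pi(v))\nabla^v_XY$,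 $\nabla^v_{fX+hY}Z=f(\pi(v))\nabla^v_XZ+h(\pi(v))\nabla^v_YZ$ for $f,h\in\mathcal F(M)$, and with $\nabla_XY\in\mathfrak T^1_0(M,A)$. It is torsion-free if $\nabla^v_XY-\nabla^v_YX=[X,Y]_{\pi(v)}$. For any local $A$-admissible extension $V$ of $v$ (independently of $V$): $(\nabla_Xh)(v)=X_{\pi(v)}(h(V))-(\partial^\nu h)_v(\nabla^v_XV)$ for $h\in\mathcal F(A)$, $\nabla^v_X\mathcal Y=\nabla^v_X(\mathcal Y_V)-(\partial^\nu\mathcal Y)_v(\nabla^v_XV)$ for $\mathcal Y\in\mathfrak T^1_0(M,A)$, and $(\nabla_XT)(X_1,\ldots,X_s)=\nabla_X(T(X_1,\ldots,X_s))-\sum_jT(\ldots,\nabla_XX_j,\ldots)$; $(\nabla_XT)_v$ depends only on $X_{\pi(v)}$. $\hat\nabla g=\mathcal Q$ means $(\hat\nabla_ug)_v(w,z)=\mathcal Q_v(u,w,z)$. Curvature tensor: $R_v(X,Y)Z=\nabla^v_X(\nabla_YZ)-\nabla^v_Y(\nabla_XZ)-\nabla^v_{[X,Y]}Z$. The covariant derivative along a curve $\gamma$ induced by $\hat\nabla$ is $\hat D^v_\gamma X=\big(\dot X^k(t_0)+\dot\gamma^i(t_0)X^j(t_0)\hat\Gamma^k_{ij}(v)\big)\partial_k$ for $v\in A$, $\pi(v)=\gamma(t_0)$, $X$ a vector field along $\gamma$, with $\hat\nabla^v_{\partial_i}\partial_j=\hat\Gamma^k_{ij}(v)\partial_k$;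 $(\hat D^V_\gamma X)(t)=\hat D^{V(t)}_\gamma X$. A geodesic is a smooth curve with $\dot\gamma\in A$ and $\hat D^{\dot\gamma}_\gamma\dot\gamma=0$ (the same curves for every symmetric $A$-anisotropic tensor $\mathcal Q$ of type $(0,3)$ with $\mathcal Q_v(v,u,w)=0$ for all $v\in A$, $u,w\in T_{\pi(v)}M$, where $\hat\nabla$ is the torsion-free $A$-anisotropic connection with $\hat\nabla g=\mathcal Q$; in particular for $\mathcal Q=0$, the Levi-Civita–Chern connection). A piecewise smooth curve is $A$-admissible if its (one-sided) velocities lie in $A$. The energy of such a curve is $E(\gamma)=\frac12\int_a^bL(\dot\gamma)\,dt$. An $A$-admissible piecewise smooth variation of $\gamma$ is a continuous map $\Lambda:[a,b]\times(-\varepsilon,\varepsilon)\to M$ with $\Lambda(\cdot,0)=\gamma$, smooth on each strip between consecutive breaks $t_i$, whose longitudinal curves $\gamma_s=\Lambda(\cdot,s)$ are $A$-admissible; its variational vector field is $W(t)=\partial_s\Lambda(t,0)$. A $(\mathcal P,\tilde{\mathcal P})$-variation is one with $\gamma_s(a)\in\mathcal P$ and $\gamma_s(b)\in\tilde{\mathcal P}$ for all $s$. A vector $v\in A$ with $\pi(v)\in\mathcal P$ is orthogonal to $\mathcal P$ if $g_v(v,w)=0$ for all $w\in T_{\pi(v)}\mathcal P$; $\gamma$ orthogonal to $\mathcal P,\tilde{\mathcal P}$ means $\dot\gamma(a)$, $\dot\gamma(b)$ are orthogonal to $\mathcal P$, $\tilde{\mathcal P}$. For an orthogonal vector $N$ at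 $p\in\mathcal P$ with $g_N|_{T_p\mathcal P}$ non-degenerate, the second fundamental form in the direction $N$ is $\hat S^{\mathcal P}_N(U,W)=\mathrm{nor}_N\hat\nabla^N_UW$, for $U,W$ tangent to $\mathcal P$, where $\mathrm{nor}_N$ is the $g_N$-orthogonal projection onto the $g_N$-orthogonal complement of $T_p\mathcal P$. *)

theory Defs
  imports "HOL-Analysis.Analysis"
begin

section \<open>Smooth maps between Euclidean spaces\<close>

primrec Ck_on :: "nat \<Rightarrow> 'a::euclidean_space set \<Rightarrow> ('a \<Rightarrow> 'b::real_normed_vector) \<Rightarrow> bool" where
  "Ck_on 0 S f \<longleftrightarrow> continuous_on S f"
| "Ck_on (Suc k) S f \<longleftrightarrow>
     (\<forall>x\<in>S. f differentiable (at x)) \<and> (\<forall>v. Ck_on k S (\<lambda>x. frechet_derivative f (at x) v))"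

text \<open>\<open>S\<close> need not be open: a map is smooth if it extends smoothly around each point of \<open>S\<close>.\<close>

definition smooth_on :: "'a::euclidean_space set \<Rightarrow> ('a \<Rightarrow> 'b::real_normed_vector) \<Rightarrow> bool" where
  "smooth_on S f \<longleftrightarrow>
     (\<forall>x\<in>S. \<exists>U F. open U \<and> x \<in> U \<and> (\<forall>k. Ck_on k U F) \<and> (\<forall>y\<in>U \<inter> S. F y = f y))"


section \<open>Smooth manifolds\<close>

type_synonym ('m, 'e) chart = "'m set \<times> ('m \<Rightarrow> 'e)"

abbreviation cdom :: "('m, 'e) chart \<Rightarrow> 'm set" where "cdom c \<equiv> fst c"
abbreviation cmap :: "('m, 'e) chart \<Rightarrow> 'm \<Rightarrow> 'e" where "cmap c \<equiv> snd c"
abbreviation cinv :: "('m, 'e) chart \<Rightarrow> 'e \<Rightarrow> 'm" where "cinv c \<equiv> inv_into (cdom c) (cmap c)"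

definition is_chart :: "('m::topological_space, 'e::euclidean_space) chart \<Rightarrow> bool" where
  "is_chart c \<longleftrightarrow> open (cdom c) \<and> open (cmap c ` cdom c) \<and>
     homeomorphism (cdom c) (cmap c ` cdom c) (cmap c) (cinv c)"

definition compatible :: "('m, 'e::euclidean_space) chart \<Rightarrow> ('m, 'e) chart \<Rightarrow> bool" where
  "compatible c d \<longleftrightarrow>
     smooth_on (cmap c ` (cdom c \<inter> cdom d)) (cmap d \<circ> cinv c) \<and>
     smooth_on (cmap d ` (cdom c \<inter> cdom d)) (cmap c \<circ> cinv d)"

text \<open>A smooth manifold is a type \<open>'m\<close> with a smooth atlas \<open>M\<close>, not required to be maximal; the
  theorem is about types \<open>'m\<close> that are Hausdorff and second countable.\<close>

definition smooth_manifold :: "('m::topological_space, 'e::euclidean_space) chart set \<Rightarrow> bool" where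
  "smooth_manifold M \<longleftrightarrow>
     (\<forall>c\<in>M. is_chart c) \<and> (\<Union>c\<in>M. cdom c) = UNIV \<and> (\<forall>c\<in>M. \<forall>d\<in>M. compatible c d)"

text \<open>Tangent vectors at \<open>p\<close> are represented by their coordinates in a preferred chart around \<open>p\<close>.
  Thus every tangent space is \<open>'e\<close>, the tangent bundle is \<open>'m \<times> 'e\<close> as a set, and \<open>fst\<close> is its
  projection. Its topology is not the product topology, because the preferred chart varies with the
  point; it comes from the charts \<open>bundle_map\<close> below.\<close>

definition chart_at :: "('m, 'e) chart set \<Rightarrow> 'm \<Rightarrow> ('m, 'e) chart" where
  "chart_at M p = (SOME c. c \<in> M \<and> p \<in> cdom c)"

text \<open>The coordinates in \<open>c\<close> of \<open>v\<close> in the tangent space at \<open>p\<close>, and conversely the tangent vector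
  at \<open>p\<close> whose coordinates in \<open>c\<close> are \<open>x\<close>.\<close>

definition tcoord :: "('m, 'e::euclidean_space) chart set \<Rightarrow> ('m, 'e) chart \<Rightarrow> 'm \<Rightarrow> 'e \<Rightarrow> 'e" where
  "tcoord M c p v =
     frechet_derivative (cmap c \<circ> cinv (chart_at M p)) (at (cmap (chart_at M p) p)) v"

definition tvec :: "('m, 'e::euclidean_space) chart set \<Rightarrow> ('m, 'e) chart \<Rightarrow> 'm \<Rightarrow> 'e \<Rightarrow> 'e" where
  "tvec M c p x = frechet_derivative (cmap (chart_at M p) \<circ> cinv c) (at (cmap c p)) x"

definition bundle_map ::
  "('m, 'e::euclidean_space) chart set \<Rightarrow> ('m, 'e) chart \<Rightarrow> 'm \<times> 'e \<Rightarrow> 'e \<times> 'e" where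
  "bundle_map M c v = (cmap c (fst v), tcoord M c (fst v) (snd v))"

definition bundle_inv ::
  "('m, 'e::euclidean_space) chart set \<Rightarrow> ('m, 'e) chart \<Rightarrow> 'e \<times> 'e \<Rightarrow> 'm \<times> 'e" where
  "bundle_inv M c z = (cinv c (fst z), tvec M c (cinv c (fst z)) (snd z))"

definition bundle_image ::
  "('m, 'e::euclidean_space) chart set \<Rightarrow> ('m, 'e) chart \<Rightarrow> ('m \<times> 'e) set \<Rightarrow> ('e \<times> 'e) set" where
  "bundle_image M c A = bundle_map M c ` {v \<in> A. fst v \<in> cdom c}"

text \<open>\<open>f\<close> maps the subset \<open>S\<close> of a Euclidean space smoothly into \<open>M\<close>.\<close>

definition smooth_into ::
  "('m::topological_space, 'e::euclidean_space) chart set \<Rightarrow> 'd::euclidean_space set \<Rightarrow> ('d \<Rightarrow> 'm) \<Rightarrow> bool"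
where
  "smooth_into M S f \<longleftrightarrow>
     continuous_on S f \<and> (\<forall>c\<in>M. smooth_on {x \<in> S. f x \<in> cdom c} (cmap c \<circ> f))"

definition smooth_fun :: "('m, 'e::euclidean_space) chart set \<Rightarrow> ('m \<Rightarrow> real) \<Rightarrow> bool" where
  "smooth_fun M f \<longleftrightarrow> (\<forall>c\<in>M. smooth_on (cmap c ` cdom c) (f \<circ> cinv c))"

definition smooth_vf_on ::
  "('m, 'e::euclidean_space) chart set \<Rightarrow> 'm set \<Rightarrow> ('m \<Rightarrow> 'e) \<Rightarrow> bool" where
  "smooth_vf_on M \<Omega> X \<longleftrightarrow>
     (\<forall>c\<in>M. smooth_on (cmap c ` (cdom c \<inter> \<Omega>)) (\<lambda>x. tcoord M c (cinv c x) (X (cinv c x))))"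

definition vector_fields :: "('m, 'e::euclidean_space) chart set \<Rightarrow> ('m \<Rightarrow> 'e) set" where
  "vector_fields M = {X. smooth_vf_on M UNIV X}"

definition dir_deriv ::
  "('m, 'e::euclidean_space) chart set \<Rightarrow> 'm \<Rightarrow> 'e \<Rightarrow> ('m \<Rightarrow> real) \<Rightarrow> real" where
  "dir_deriv M p x f = frechet_derivative (f \<circ> cinv (chart_at M p)) (at (cmap (chart_at M p) p)) x"

text \<open>\<open>[X,Y]\<^sup>k = X\<^sup>i \<partial>\<^sub>i Y\<^sup>k - Y\<^sup>i \<partial>\<^sub>i X\<^sup>k\<close> in the preferred chart at \<open>p\<close>.\<close>

definition lie_bracket ::
  "('m, 'e::euclidean_space) chart set \<Rightarrow> ('m \<Rightarrow> 'e) \<Rightarrow> ('m \<Rightarrow> 'e) \<Rightarrow> 'm \<Rightarrow> 'e" where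
  "lie_bracket M X Y p =
     (let c = chart_at M p;
          rep = (\<lambda>Z x. tcoord M c (cinv c x) (Z (cinv c x)))
      in frechet_derivative (rep Y) (at (cmap c p)) (X p)
         - frechet_derivative (rep X) (at (cmap c p)) (Y p))"

text \<open>A global vector field with the germ of \<open>X\<close> at \<open>p\<close>. It exists, by a bump function, when \<open>X\<close> is
  smooth near \<open>p\<close>. It is used to apply an anisotropic connection, which acts on global fields, to
  local ones; as the connection is local, the result does not depend on the choice.\<close>

definition germ_ext ::
  "('m::topological_space, 'e::euclidean_space) chart set \<Rightarrow> 'm \<Rightarrow> ('m \<Rightarrow> 'e) \<Rightarrow> 'm \<Rightarrow> 'e" where
  "germ_ext M p X = (SOME Y. Y \<in> vector_fields M \<and> (\<forall>\<^sub>F q in nhds p. Y q = X q))"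

definition vec_ext ::
  "('m, 'e::euclidean_space) chart set \<Rightarrow> 'm \<Rightarrow> 'e \<Rightarrow> 'm \<Rightarrow> 'e" where
  "vec_ext M p x = (SOME X. X \<in> vector_fields M \<and> X p = x)"


section \<open>Pseudo-Finsler metrics\<close>

definition conic_domain ::
  "('m, 'e::euclidean_space) chart set \<Rightarrow> ('m \<times> 'e) set \<Rightarrow> bool" where
  "conic_domain M A \<longleftrightarrow>
     (\<forall>c\<in>M. open (bundle_image M c A)) \<and> (\<forall>v\<in>A. snd v \<noteq> 0) \<and>
     (\<forall>p v. \<forall>r>0. (p, v) \<in> A \<longrightarrow> (p, r *\<^sub>R v) \<in> A) \<and> fst ` A = UNIV"

definition smooth_fun_on_bundle ::
  "('m, 'e::euclidean_space) chart set \<Rightarrow> ('m \<times> 'e) set \<Rightarrow> ('m \<times> 'e \<Rightarrow> real) \<Rightarrow> bool" where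
  "smooth_fun_on_bundle M A h \<longleftrightarrow> (\<forall>c\<in>M. smooth_on (bundle_image M c A) (h \<circ> bundle_inv M c))"

definition fundamental_tensor ::
  "('m \<times> 'e::euclidean_space \<Rightarrow> real) \<Rightarrow> 'm \<times> 'e \<Rightarrow> 'e \<Rightarrow> 'e \<Rightarrow> real" where
  "fundamental_tensor L v u w =
     1 / 2 * deriv (\<lambda>t. deriv (\<lambda>s. L (fst v, snd v + t *\<^sub>R u + s *\<^sub>R w)) 0) 0"

definition pseudo_finsler ::
  "('m, 'e::euclidean_space) chart set \<Rightarrow> ('m \<times> 'e) set \<Rightarrow> ('m \<times> 'e \<Rightarrow> real) \<Rightarrow> bool" where
  "pseudo_finsler M A L \<longleftrightarrow>
     smooth_fun_on_bundle M A L \<and>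
     (\<forall>p v. \<forall>r>0. (p, v) \<in> A \<longrightarrow> L (p, r *\<^sub>R v) = r\<^sup>2 * L (p, v)) \<and>
     (\<forall>v\<in>A. \<forall>u. (\<forall>w. fundamental_tensor L v u w = 0) \<longrightarrow> u = 0)"

definition legendre ::
  "('m \<times> 'e::euclidean_space \<Rightarrow> real) \<Rightarrow> 'm \<times> 'e \<Rightarrow> 'e \<Rightarrow> real" where
  "legendre L v w = fundamental_tensor L v (snd v) w"


section \<open>Anisotropic tensors and connections\<close>

text \<open>The smooth sections \<open>v \<in> A \<mapsto> \<Y>\<^sub>v \<in> T\<^bsub>\<pi>(v)\<^esub>M\<close>.\<close>

definition aniso_fields ::
  "('m, 'e::euclidean_space) chart set \<Rightarrow> ('m \<times> 'e) set \<Rightarrow> ('m \<times> 'e \<Rightarrow> 'e) set" where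
  "aniso_fields M A =
     {\<Y>. \<forall>c\<in>M. smooth_on (bundle_image M c A)
        (\<lambda>z. tcoord M c (cinv c (fst z)) (\<Y> (bundle_inv M c z)))}"

text \<open>Type \<open>(0,3)\<close>: smoothness is that of the components in every chart.\<close>

definition aniso_tensor3 ::
  "('m, 'e::euclidean_space) chart set \<Rightarrow> ('m \<times> 'e) set
    \<Rightarrow> ('m \<times> 'e \<Rightarrow> 'e \<Rightarrow> 'e \<Rightarrow> 'e \<Rightarrow> real) \<Rightarrow> bool" where
  "aniso_tensor3 M A T \<longleftrightarrow>
     (\<forall>v\<in>A. \<forall>x y. linear (\<lambda>z. T v z x y) \<and> linear (\<lambda>z. T v x z y) \<and> linear (\<lambda>z. T v x y z)) \<and>
     (\<forall>c\<in>M. \<forall>x y w. smooth_on (bundle_image M c A)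
        (\<lambda>z. let e = tvec M c (cinv c (fst z)) in T (bundle_inv M c z) (e x) (e y) (e w)))"

definition symmetric3 ::
  "('m \<times> 'e) set \<Rightarrow> ('m \<times> 'e \<Rightarrow> 'e \<Rightarrow> 'e \<Rightarrow> 'e \<Rightarrow> real) \<Rightarrow> bool" where
  "symmetric3 A T \<longleftrightarrow> (\<forall>v\<in>A. \<forall>x y z. T v x y z = T v y x z \<and> T v x y z = T v x z y)"

text \<open>Conditions are imposed only for base vectors in \<open>A\<close> and for smooth vector fields on all of the
  manifold, which are the arguments of an anisotropic connection.\<close>

type_synonym ('m, 'e) aniso_map = "'m \<times> 'e \<Rightarrow> ('m \<Rightarrow> 'e) \<Rightarrow> ('m \<Rightarrow> 'e) \<Rightarrow> 'e"

definition aniso_connection ::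
  "('m, 'e::euclidean_space) chart set \<Rightarrow> ('m \<times> 'e) set \<Rightarrow> ('m, 'e) aniso_map \<Rightarrow> bool" where
  "aniso_connection M A nabla \<longleftrightarrow>
     (\<forall>v\<in>A. \<forall>X\<in>vector_fields M. \<forall>Y\<in>vector_fields M. \<forall>Z\<in>vector_fields M.
        nabla v X (\<lambda>q. Y q + Z q) = nabla v X Y + nabla v X Z) \<and>
     (\<forall>v\<in>A. \<forall>X\<in>vector_fields M. \<forall>Y\<in>vector_fields M. \<forall>f. smooth_fun M f \<longrightarrow>
        nabla v X (\<lambda>q. f q *\<^sub>R Y q) =
          dir_deriv M (fst v) (X (fst v)) f *\<^sub>R Y (fst v) + f (fst v) *\<^sub>R nabla v X Y) \<and>
     (\<forall>v\<in>A. \<forall>X\<in>vector_fields M. \<forall>Y\<in>vector_fields M. \<forall>Z\<in>vector_fields M.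
        \<forall>f h. smooth_fun M f \<longrightarrow> smooth_fun M h \<longrightarrow>
        nabla v (\<lambda>q. f q *\<^sub>R X q + h q *\<^sub>R Y q) Z =
          f (fst v) *\<^sub>R nabla v X Z + h (fst v) *\<^sub>R nabla v Y Z) \<and>
     (\<forall>X\<in>vector_fields M. \<forall>Y\<in>vector_fields M. (\<lambda>v. nabla v X Y) \<in> aniso_fields M A)"

definition torsion_free ::
  "('m, 'e::euclidean_space) chart set \<Rightarrow> ('m \<times> 'e) set \<Rightarrow> ('m, 'e) aniso_map \<Rightarrow> bool" where
  "torsion_free M A nabla \<longleftrightarrow>
     (\<forall>v\<in>A. \<forall>X\<in>vector_fields M. \<forall>Y\<in>vector_fields M.
        nabla v X Y - nabla v Y X = lie_bracket M X Y (fst v))"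

text \<open>A local \<open>A\<close>-admissible extension \<open>V\<close> of \<open>v\<close>; the derivatives below do not depend on the choice.\<close>

definition adm_ext ::
  "('m::topological_space, 'e::euclidean_space) chart set \<Rightarrow> ('m \<times> 'e) set \<Rightarrow> 'm \<times> 'e \<Rightarrow> 'm \<Rightarrow> 'e" where
  "adm_ext M A v = (SOME V. \<exists>\<Omega>. open \<Omega> \<and> fst v \<in> \<Omega> \<and> smooth_vf_on M \<Omega> V \<and>
     (\<forall>q\<in>\<Omega>. (q, V q) \<in> A) \<and> V (fst v) = snd v)"

definition nabla_local ::
  "('m::topological_space, 'e::euclidean_space) chart set \<Rightarrow> ('m, 'e) aniso_map \<Rightarrow> ('m, 'e) aniso_map"
where
  "nabla_local M nabla v X Y = nabla v (germ_ext M (fst v) X) (germ_ext M (fst v) Y)"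

definition vert_deriv ::
  "('m \<times> 'e::euclidean_space \<Rightarrow> 'b::real_normed_vector) \<Rightarrow> 'm \<times> 'e \<Rightarrow> 'e \<Rightarrow> 'b" where
  "vert_deriv h v z = vector_derivative (\<lambda>t. h (fst v, snd v + t *\<^sub>R z)) (at 0)"

definition nabla_fun ::
  "('m::topological_space, 'e::euclidean_space) chart set \<Rightarrow> ('m \<times> 'e) set \<Rightarrow> ('m, 'e) aniso_map
    \<Rightarrow> ('m \<Rightarrow> 'e) \<Rightarrow> ('m \<times> 'e \<Rightarrow> real) \<Rightarrow> 'm \<times> 'e \<Rightarrow> real" where
  "nabla_fun M A nabla X h v =
     (let V = adm_ext M A v
      in dir_deriv M (fst v) (X (fst v)) (\<lambda>q. h (q, V q))
         - vert_deriv h v (nabla_local M nabla v X V))"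

definition nabla_field ::
  "('m::topological_space, 'e::euclidean_space) chart set \<Rightarrow> ('m \<times> 'e) set \<Rightarrow> ('m, 'e) aniso_map
    \<Rightarrow> ('m \<Rightarrow> 'e) \<Rightarrow> ('m \<times> 'e \<Rightarrow> 'e) \<Rightarrow> 'm \<times> 'e \<Rightarrow> 'e" where
  "nabla_field M A nabla X \<Y> v =
     (let V = adm_ext M A v
      in nabla_local M nabla v X (\<lambda>q. \<Y> (q, V q))
         - vert_deriv \<Y> v (nabla_local M nabla v X V))"

text \<open>\<open>(\<nabla>\<^sub>X T)\<^sub>v(Y, Z)\<close> for \<open>T\<close> of type \<open>(0,2)\<close>.\<close>

definition nabla_tensor2 ::
  "('m::topological_space, 'e::euclidean_space) chart set \<Rightarrow> ('m \<times> 'e) set \<Rightarrow> ('m, 'e) aniso_map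
    \<Rightarrow> ('m \<Rightarrow> 'e) \<Rightarrow> ('m \<times> 'e \<Rightarrow> 'e \<Rightarrow> 'e \<Rightarrow> real) \<Rightarrow> 'm \<times> 'e \<Rightarrow> ('m \<Rightarrow> 'e) \<Rightarrow> ('m \<Rightarrow> 'e) \<Rightarrow> real" where
  "nabla_tensor2 M A nabla X T v Y Z =
     nabla_fun M A nabla X (\<lambda>u. T u (Y (fst u)) (Z (fst u))) v
     - T v (nabla v X Y) (Z (fst v)) - T v (Y (fst v)) (nabla v X Z)"

definition nabla_metric_eq ::
  "('m::topological_space, 'e::euclidean_space) chart set \<Rightarrow> ('m \<times> 'e) set \<Rightarrow> ('m, 'e) aniso_map
    \<Rightarrow> ('m \<times> 'e \<Rightarrow> 'e \<Rightarrow> 'e \<Rightarrow> real) \<Rightarrow> ('m \<times> 'e \<Rightarrow> 'e \<Rightarrow> 'e \<Rightarrow> 'e \<Rightarrow> real) \<Rightarrow> bool" where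
  "nabla_metric_eq M A nabla g Q \<longleftrightarrow>
     (\<forall>v\<in>A. \<forall>X\<in>vector_fields M. \<forall>Y\<in>vector_fields M. \<forall>Z\<in>vector_fields M.
        nabla_tensor2 M A nabla X g v Y Z = Q v (X (fst v)) (Y (fst v)) (Z (fst v)))"

text \<open>The curvature tensor, evaluated on tangent vectors through arbitrary extensions of them.\<close>

definition curvature_fields ::
  "('m::topological_space, 'e::euclidean_space) chart set \<Rightarrow> ('m \<times> 'e) set \<Rightarrow> ('m, 'e) aniso_map
    \<Rightarrow> 'm \<times> 'e \<Rightarrow> ('m \<Rightarrow> 'e) \<Rightarrow> ('m \<Rightarrow> 'e) \<Rightarrow> ('m \<Rightarrow> 'e) \<Rightarrow> 'e" where
  "curvature_fields M A nabla v X Y Z =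
     nabla_field M A nabla X (\<lambda>u. nabla u Y Z) v - nabla_field M A nabla Y (\<lambda>u. nabla u X Z) v
     - nabla v (lie_bracket M X Y) Z"

definition curvature ::
  "('m::topological_space, 'e::euclidean_space) chart set \<Rightarrow> ('m \<times> 'e) set \<Rightarrow> ('m, 'e) aniso_map
    \<Rightarrow> 'm \<times> 'e \<Rightarrow> 'e \<Rightarrow> 'e \<Rightarrow> 'e \<Rightarrow> 'e" where
  "curvature M A nabla v x y z =
     curvature_fields M A nabla v (vec_ext M (fst v) x) (vec_ext M (fst v) y) (vec_ext M (fst v) z)"


section \<open>Curves and covariant derivatives along them\<close>

text \<open>The velocity at \<open>t\<close> relative to \<open>S\<close>: for \<open>S = {t..}\<close> and \<open>S = {..t}\<close> the right and left
  velocities, and for \<open>S = {a..b}\<close> the velocity of a curve on \<open>{a..b}\<close>. At a break in the interior of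
  \<open>S\<close> it has no meaning, which does not affect integrals.\<close>

definition velocity ::
  "('m, 'e::euclidean_space) chart set \<Rightarrow> real set \<Rightarrow> (real \<Rightarrow> 'm) \<Rightarrow> real \<Rightarrow> 'e" where
  "velocity M S \<gamma> t = vector_derivative (cmap (chart_at M (\<gamma> t)) \<circ> \<gamma>) (at t within S)"

text \<open>The same velocity, as an element of the tangent bundle.\<close>

definition velocity_lift ::
  "('m, 'e::euclidean_space) chart set \<Rightarrow> real set \<Rightarrow> (real \<Rightarrow> 'm) \<Rightarrow> real \<Rightarrow> 'm \<times> 'e" where
  "velocity_lift M S \<gamma> t = (\<gamma> t, velocity M S \<gamma> t)"

text \<open>\<open>\<Gamma>\<^sup>k\<^sub>i\<^sub>j(v) \<partial>\<^sub>k = \<nabla>\<^sup>v (\<partial>\<^sub>i, \<partial>\<^sub>j)\<close> for the coordinate fields of \<open>c\<close> given by basis vectors \<open>i\<close>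
  and \<open>j\<close>.\<close>

definition christoffel ::
  "('m::topological_space, 'e::euclidean_space) chart set \<Rightarrow> ('m, 'e) aniso_map
    \<Rightarrow> ('m, 'e) chart \<Rightarrow> 'm \<times> 'e \<Rightarrow> 'e \<Rightarrow> 'e \<Rightarrow> 'e" where
  "christoffel M nabla c v i j = nabla_local M nabla v (\<lambda>q. tvec M c q i) (\<lambda>q. tvec M c q j)"

text \<open>The coordinate formula is used in the preferred chart at \<open>\<gamma> t\<close>, in which tangent vectors at
  \<open>\<gamma> t\<close> are equal to their coordinates.\<close>

definition cov_deriv_along ::
  "('m::topological_space, 'e::euclidean_space) chart set \<Rightarrow> ('m, 'e) aniso_map \<Rightarrow> real set
    \<Rightarrow> (real \<Rightarrow> 'm) \<Rightarrow> 'm \<times> 'e \<Rightarrow> (real \<Rightarrow> 'e) \<Rightarrow> real \<Rightarrow> 'e" where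
  "cov_deriv_along M nabla S \<gamma> v X t =
     (let c = chart_at M (\<gamma> t)
      in vector_derivative (\<lambda>\<tau>. tcoord M c (\<gamma> \<tau>) (X \<tau>)) (at t within S)
         + (\<Sum>i\<in>Basis. \<Sum>j\<in>Basis.
              ((velocity M S \<gamma> t \<bullet> i) * (X t \<bullet> j)) *\<^sub>R christoffel M nabla c v i j))"

definition geodesic ::
  "('m::topological_space, 'e::euclidean_space) chart set \<Rightarrow> ('m \<times> 'e) set \<Rightarrow> ('m, 'e) aniso_map
    \<Rightarrow> real \<Rightarrow> real \<Rightarrow> (real \<Rightarrow> 'm) \<Rightarrow> bool" where
  "geodesic M A nabla a b \<gamma> \<longleftrightarrow>
     smooth_into M {a..b} \<gamma> \<and>
     (\<forall>t\<in>{a..b}. velocity_lift M {a..b} \<gamma> t \<in> A \<and>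
        cov_deriv_along M nabla {a..b} \<gamma> (velocity_lift M {a..b} \<gamma> t) (velocity M {a..b} \<gamma>) t = 0)"

text \<open>The breaks form a finite set \<open>B\<close>; an interval between consecutive breaks is an interval whose
  interior contains none of them.\<close>

definition break_set :: "real \<Rightarrow> real \<Rightarrow> real set \<Rightarrow> bool" where
  "break_set a b B \<longleftrightarrow> a < b \<and> finite B \<and> B \<subseteq> {a<..<b}"

definition admissible_curve ::
  "('m::topological_space, 'e::euclidean_space) chart set \<Rightarrow> ('m \<times> 'e) set
    \<Rightarrow> real \<Rightarrow> real \<Rightarrow> real set \<Rightarrow> (real \<Rightarrow> 'm) \<Rightarrow> bool" where
  "admissible_curve M A a b B \<gamma> \<longleftrightarrow>
     continuous_on {a..b} \<gamma> \<and>
     (\<forall>c d. a \<le> c \<and> c < d \<and> d \<le> b \<and> {c<..<d} \<inter> B = {} \<longrightarrow> smooth_into M {c..d} \<gamma>) \<and>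
     (\<forall>t. a \<le> t \<and> t < b \<longrightarrow> velocity_lift M {t..} \<gamma> t \<in> A) \<and>
     (\<forall>t. a < t \<and> t \<le> b \<longrightarrow> velocity_lift M {..t} \<gamma> t \<in> A)"

definition energy ::
  "('m, 'e::euclidean_space) chart set \<Rightarrow> ('m \<times> 'e \<Rightarrow> real) \<Rightarrow> real \<Rightarrow> real \<Rightarrow> (real \<Rightarrow> 'm) \<Rightarrow> real" where
  "energy M L a b \<gamma> = 1 / 2 * integral {a..b} (\<lambda>t. L (velocity_lift M {a..b} \<gamma> t))"

text \<open>For \<open>B = {}\<close> this is a smooth variation.\<close>

definition admissible_variation ::
  "('m::topological_space, 'e::euclidean_space) chart set \<Rightarrow> ('m \<times> 'e) set
    \<Rightarrow> real \<Rightarrow> real \<Rightarrow> real set \<Rightarrow> real \<Rightarrow> (real \<Rightarrow> 'm) \<Rightarrow> (real \<times> real \<Rightarrow> 'm) \<Rightarrow> bool" where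
  "admissible_variation M A a b B \<epsilon> \<gamma> \<Lambda> \<longleftrightarrow>
     0 < \<epsilon> \<and> continuous_on ({a..b} \<times> {-\<epsilon><..<\<epsilon>}) \<Lambda> \<and> (\<forall>t\<in>{a..b}. \<Lambda> (t, 0) = \<gamma> t) \<and>
     (\<forall>c d. a \<le> c \<and> c < d \<and> d \<le> b \<and> {c<..<d} \<inter> B = {} \<longrightarrow>
        smooth_into M ({c..d} \<times> {-\<epsilon><..<\<epsilon>}) \<Lambda>) \<and>
     (\<forall>s\<in>{-\<epsilon><..<\<epsilon>}. admissible_curve M A a b B (\<lambda>t. \<Lambda> (t, s)))"

definition variation_field ::
  "('m, 'e::euclidean_space) chart set \<Rightarrow> (real \<times> real \<Rightarrow> 'm) \<Rightarrow> real \<Rightarrow> 'e" where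
  "variation_field M \<Lambda> t = velocity M UNIV (\<lambda>s. \<Lambda> (t, s)) 0"


section \<open>Submanifolds\<close>

text \<open>Embedded submanifolds, by slice charts of the smooth structure generated by \<open>M\<close>.\<close>

definition submanifold ::
  "('m::topological_space, 'e::euclidean_space) chart set \<Rightarrow> 'm set \<Rightarrow> bool" where
  "submanifold M P \<longleftrightarrow>
     (\<exists>k. \<forall>p\<in>P. \<exists>d S. is_chart d \<and> (\<forall>c\<in>M. compatible c d) \<and> p \<in> cdom d \<and>
        subspace S \<and> dim S = k \<and> cmap d ` (P \<inter> cdom d) = cmap d ` cdom d \<inter> S)"

definition tangent_space ::
  "('m::topological_space, 'e::euclidean_space) chart set \<Rightarrow> 'm set \<Rightarrow> 'm \<Rightarrow> 'e set" where
  "tangent_space M P p =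
     {velocity M UNIV \<alpha> 0 | \<alpha>. \<exists>\<delta>>0. smooth_into M {-\<delta><..<\<delta>} \<alpha> \<and> \<alpha> ` {-\<delta><..<\<delta>} \<subseteq> P \<and> \<alpha> 0 = p}"

definition orthogonal_to ::
  "('m::topological_space, 'e::euclidean_space) chart set \<Rightarrow> ('m \<times> 'e \<Rightarrow> 'e \<Rightarrow> 'e \<Rightarrow> real)
    \<Rightarrow> 'm set \<Rightarrow> 'm \<times> 'e \<Rightarrow> bool" where
  "orthogonal_to M g P v \<longleftrightarrow> (\<forall>w\<in>tangent_space M P (fst v). g v (snd v) w = 0)"

definition nondegenerate_on ::
  "('e::real_vector \<Rightarrow> 'e \<Rightarrow> real) \<Rightarrow> 'e set \<Rightarrow> bool" where
  "nondegenerate_on \<beta> S \<longleftrightarrow> (\<forall>u\<in>S. (\<forall>w\<in>S. \<beta> u w = 0) \<longrightarrow> u = 0)"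

text \<open>The \<open>\<beta>\<close>-orthogonal projection onto the \<open>\<beta>\<close>-orthogonal complement of \<open>S\<close>.\<close>

definition normal_part ::
  "('e::real_vector \<Rightarrow> 'e \<Rightarrow> real) \<Rightarrow> 'e set \<Rightarrow> 'e \<Rightarrow> 'e" where
  "normal_part \<beta> S z = (THE n. (\<forall>w\<in>S. \<beta> n w = 0) \<and> z - n \<in> S)"

text \<open>An extension, tangent to \<open>P\<close>, of a vector tangent to \<open>P\<close> at \<open>p\<close>.\<close>

definition tangent_ext ::
  "('m::topological_space, 'e::euclidean_space) chart set \<Rightarrow> 'm set \<Rightarrow> 'm \<Rightarrow> 'e \<Rightarrow> 'm \<Rightarrow> 'e" where
  "tangent_ext M P p x =
     (SOME X. X \<in> vector_fields M \<and> X p = x \<and> (\<forall>q\<in>P. X q \<in> tangent_space M P q))"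

text \<open>In the direction \<open>N\<close>, on tangent vectors; independent of the extensions.\<close>

definition second_fundamental_form ::
  "('m::topological_space, 'e::euclidean_space) chart set \<Rightarrow> ('m, 'e) aniso_map
    \<Rightarrow> ('m \<times> 'e \<Rightarrow> 'e \<Rightarrow> 'e \<Rightarrow> real) \<Rightarrow> 'm set \<Rightarrow> 'm \<times> 'e \<Rightarrow> 'e \<Rightarrow> 'e \<Rightarrow> 'e" where
  "second_fundamental_form M nabla g P N u w =
     normal_part (g N) (tangent_space M P (fst N))
       (nabla N (tangent_ext M P (fst N) u) (tangent_ext M P (fst N) w))"

end

theory Submission
  imports Defs
begin

text \<open>Everything is computed in a chart of the tangent bundle, where \<open>g\<^sub>v(v,w) = \<ell>(v)(w)\<close> is half the fibre
  derivative of \<open>L\<close> and \<open>\<nabla>\<close> becomes a symmetric symbol \<open>\<Gamma>\<close>. As \<open>Q\<^sub>v(v,\<cdot>,\<cdot>) = 0\<close>, the equation \<open>\<nabla>g = Q\<close>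
  gives, with homogeneity, \<open>\<partial>\<^sub>x\<ell>(w)\<cdot>u = g\<^sub>v(\<Gamma>(u,v),w) + \<ell>(\<Gamma>(u,w))\<close>, that is, the product rule
  \<open>\<ell>(Y)' = g\<^sub>v(D v,Y) + \<ell>(D Y)\<close> along curves; by symmetry of \<open>\<Gamma>\<close> also \<open>\<partial>\<^sub>sL/2 = \<ell>(D\<^sub>t W)\<close>. The first variation
  formula is this rule integrated over each smooth strip. Applying it once more in the direction of \<open>s\<close>, and
  comparing \<open>D\<^sub>s D\<^sub>t W\<close> with \<open>D\<^sub>t D\<^sub>s W\<close>, produces the curvature, a term with \<open>D\<^sub>t v = 0\<close>, and the vertical
  derivative of \<open>\<Gamma>\<close> in the slot \<open>v\<close>, which \<open>\<ell>\<close> annihilates. What remains is the total derivative of \<open>\<ell>(D\<^sub>s W)\<close>,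
  whose boundary values only depend on \<open>D\<^sub>s W\<close> modulo the tangent space of the submanifold.\<close>

section \<open>Calculus of smooth maps\<close>

text \<open>Tangent vectors are stored in a preferred chart that jumps from point to point, so a
  vector field along a curve is not a differentiable function into \<open>'e\<close>. Hence every
  derivative is taken in one chart fixed around one parameter value, while the functions to be
  integrated, such as \<open>g (T t) (vel t 0) (W t)\<close>, are real valued and chart free. Their
  derivatives are found pointwise, and the fundamental theorem of calculus then applies on a whole
  strip without cutting it into chart-sized pieces. Several definitions pick extensions of vectors
  or of local fields by \<open>SOME\<close>. Bump functions supply the existence of such extensions,
  and coordinate formulas in which the extension no longer occurs make the choice immaterial. That
  \<open>\<ell>\<close> annihilates the vertical derivative of \<open>\<Gamma>\<close> comes from
  the equality of the mixed derivatives of \<open>L\<close>, once along the base and once along the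
  fibre.\<close>

abbreviation FD :: "('a::real_normed_vector \<Rightarrow> 'b::real_normed_vector) \<Rightarrow> 'a \<Rightarrow> 'a \<Rightarrow> 'b" where
  "FD f x \<equiv> frechet_derivative f (at x)"

lemma FD_eqI: "(f has_derivative f') (at x) \<Longrightarrow> FD f x = f'"
  using frechet_derivative_at by metis

lemma FD_has_derivative: "f differentiable at x \<Longrightarrow> (f has_derivative FD f x) (at x)"
  by (simp add: frechet_derivative_works[symmetric])

lemma FD_cong:
  assumes "f differentiable at x" "open S" "x \<in> S" "\<And>y. y \<in> S \<Longrightarrow> f y = g y"
  shows "FD f x = FD g x"
  using frechet_derivative_transform_within_open[OF assms] .

lemma differentiable_cong:
  assumes "f differentiable at x" "open S" "x \<in> S" "\<And>y. y \<in> S \<Longrightarrow> f y = g y"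
  shows "g differentiable at x"
  using assms has_derivative_transform_within_open unfolding differentiable_def by metis

lemma Ck_on_continuous: "Ck_on k S f \<Longrightarrow> continuous_on S f"
  by (cases k) (auto simp: continuous_on_eq_continuous_at differentiable_imp_continuous_within
      continuous_at_imp_continuous_on)

lemma Ck_on_SucD: "Ck_on (Suc k) S f \<Longrightarrow> Ck_on k S f"
proof (induction k arbitrary: f)
  case 0
  then show ?case by (metis Ck_on.simps(1) Ck_on_continuous)
qed auto

lemma Ck_on_subset: "Ck_on k S f \<Longrightarrow> T \<subseteq> S \<Longrightarrow> Ck_on k T f"
  by (induction k arbitrary: f) (auto intro: continuous_on_subset)

text \<open>Openness of \<open>S\<close> matters: \<open>Ck_on\<close> uses full derivatives at the
  points of \<open>S\<close>, and values on \<open>S\<close> fix these only when each point has a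
  neighbourhood inside \<open>S\<close>.\<close>

lemma Ck_on_cong:
  assumes "open S" "\<And>x. x \<in> S \<Longrightarrow> f x = g x" "Ck_on k S f"
  shows "Ck_on k S g"
  using assms(2,3)
proof (induction k arbitrary: f g)
  case 0
  then show ?case by (simp cong: continuous_on_cong)
next
  case (Suc k)
  have "Ck_on k S (\<lambda>x. FD g x v)" for v
  proof (rule Suc.IH)
    show "Ck_on k S (\<lambda>x. FD f x v)" using Suc.prems by simp
    show "FD f x v = FD g x v" if "x \<in> S" for x
      using FD_cong[OF _ assms(1) that, of f g] Suc.prems that by auto
  qed
  moreover have "g differentiable at x" if "x \<in> S" for x
    using differentiable_cong[OF _ assms(1) that] Suc.prems that by auto
  ultimately show ?case by simp
qed

lemma Ck_on_local:
  assumes "\<And>x. x \<in> S \<Longrightarrow> \<exists>U. open U \<and> x \<in> U \<and> Ck_on k U f"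
  shows "Ck_on k S f"
  using assms
proof (induction k arbitrary: f)
  case 0
  have "isCont f x" if "x \<in> S" for x
    using 0[OF that] continuous_on_eq_continuous_at by auto
  then show ?case by (simp add: continuous_at_imp_continuous_on)
next
  case (Suc k)
  have "f differentiable at x" if "x \<in> S" for x
    using Suc.prems[OF that] by auto
  moreover have "Ck_on k S (\<lambda>x. FD f x v)" for v
    by (rule Suc.IH) (use Suc.prems in fastforce)
  ultimately show ?case by simp
qed

text \<open>Openness is built in, so that the property depends only on the values on
  \<open>S\<close>. On open sets it then agrees with the extension sense of smoothness in
  \<open>smooth_on\<close>.\<close>

definition Cinf :: "'a::euclidean_space set \<Rightarrow> ('a \<Rightarrow> 'b::real_normed_vector) \<Rightarrow> bool" where
  "Cinf S f \<longleftrightarrow> open S \<and> (\<forall>k. Ck_on k S f)"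

lemma Cinf_open: "Cinf S f \<Longrightarrow> open S"
  by (simp add: Cinf_def)

lemma Cinf_differentiable: "Cinf S f \<Longrightarrow> x \<in> S \<Longrightarrow> f differentiable at x"
  by (auto simp: Cinf_def dest!: spec[where x="Suc 0"])

lemma Cinf_has_derivative: "Cinf S f \<Longrightarrow> x \<in> S \<Longrightarrow> (f has_derivative FD f x) (at x)"
  by (rule FD_has_derivative[OF Cinf_differentiable])

lemma Cinf_linear_FD: "Cinf S f \<Longrightarrow> x \<in> S \<Longrightarrow> linear (FD f x)"
  using Cinf_has_derivative has_derivative_linear by blast

lemma Cinf_FD: "Cinf S f \<Longrightarrow> Cinf S (\<lambda>x. FD f x v)"
  unfolding Cinf_def by (metis Ck_on.simps(2))

lemma Cinf_continuous_on: "Cinf S f \<Longrightarrow> continuous_on S f"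
  using Cinf_def Ck_on_continuous by blast

lemma Cinf_subset: "Cinf S f \<Longrightarrow> open T \<Longrightarrow> T \<subseteq> S \<Longrightarrow> Cinf T f"
  by (auto simp: Cinf_def intro: Ck_on_subset)

lemma Cinf_cong: "Cinf S f \<Longrightarrow> (\<And>x. x \<in> S \<Longrightarrow> f x = g x) \<Longrightarrow> Cinf S g"
  by (auto simp: Cinf_def intro: Ck_on_cong)

lemma Cinf_local:
  assumes "\<And>x. x \<in> S \<Longrightarrow> \<exists>U. x \<in> U \<and> U \<subseteq> S \<and> Cinf U f"
  shows "Cinf S f"
  unfolding Cinf_def
proof (intro conjI allI)
  show "open S" by (subst open_subopen) (meson Cinf_open assms)
  show "Ck_on k S f" for k by (rule Ck_on_local) (meson Cinf_def assms)
qed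

lemma smooth_on_Cinf: "open S \<Longrightarrow> smooth_on S f \<Longrightarrow> Cinf S f"
proof (rule Cinf_local)
  fix x assume "open S" "smooth_on S f" "x \<in> S"
  then obtain U F where U: "open U" "x \<in> U" "\<forall>k. Ck_on k U F" "\<forall>y\<in>U\<inter>S. F y = f y"
    unfolding smooth_on_def by blast
  then have "Cinf (U \<inter> S) F" using \<open>open S\<close> by (auto simp: Cinf_def intro: Ck_on_subset)
  then have "Cinf (U \<inter> S) f" by (rule Cinf_cong) (use U in auto)
  then show "\<exists>U. x \<in> U \<and> U \<subseteq> S \<and> Cinf U f" using U \<open>x \<in> S\<close> by blast
qed

lemma smooth_onE:
  assumes "smooth_on S f" "x \<in> S"
  obtains U F where "x \<in> U" "Cinf U F" "\<And>y. y \<in> U \<inter> S \<Longrightarrow> F y = f y"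
  using assms unfolding smooth_on_def Cinf_def by metis

lemma smooth_onI:
  assumes "\<And>x. x \<in> S \<Longrightarrow> \<exists>U F. x \<in> U \<and> Cinf U F \<and> (\<forall>y\<in>U \<inter> S. F y = f y)"
  shows "smooth_on S f"
  using assms unfolding smooth_on_def Cinf_def by metis

lemma Cinf_smooth_on: "Cinf S f \<Longrightarrow> smooth_on S f"
  by (rule smooth_onI) auto

lemma smooth_on_continuous: "smooth_on S f \<Longrightarrow> continuous_on S f"
  unfolding continuous_on_eq_continuous_within
proof
  fix x assume "smooth_on S f" "x \<in> S"
  then obtain U F where U: "x \<in> U" "Cinf U F" "\<And>y. y \<in> U \<inter> S \<Longrightarrow> F y = f y" by (meson smooth_onE)
  have "continuous (at x within S) F"
    using U Cinf_differentiable differentiable_imp_continuous_within continuous_at_imp_continuous_at_within by blast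
  moreover obtain e where "e > 0" "ball x e \<subseteq> U" using U Cinf_open openE by metis
  ultimately show "continuous (at x within S) f"
    using U \<open>x \<in> S\<close> by (intro continuous_transform_within[of x S F e f]) (auto simp: dist_commute subset_iff)
qed

section \<open>Closure properties of smooth maps\<close>

lemma Ck_on_const: "Ck_on k S (\<lambda>x. c)"
  by (induction k arbitrary: c) auto

lemma Cinf_const: "open S \<Longrightarrow> Cinf S (\<lambda>x. c)"
  by (simp add: Cinf_def Ck_on_const)

lemma Ck_on_bounded_linear:
  assumes "bounded_linear h" "open S" "Ck_on k S f"
  shows "Ck_on k S (\<lambda>x. h (f x))"
  using assms(3)
proof (induction k arbitrary: f)
  case 0
  then show ?case using assms(1) by (auto intro: bounded_linear.continuous_on)
next
  case (Suc k)
  have d: "((\<lambda>x. h (f x)) has_derivative (\<lambda>v. h (FD f x v))) (at x)" if "x \<in> S" for x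
    using Suc.prems that by (intro bounded_linear.has_derivative[OF assms(1)] FD_has_derivative) auto
  have "Ck_on k S (\<lambda>x. FD (\<lambda>x. h (f x)) x v)" for v
    by (rule Ck_on_cong[OF assms(2) _ Suc.IH[of "\<lambda>x. FD f x v"]]) (use Suc.prems FD_eqI[OF d] in auto)
  then show ?case using d by (auto simp: differentiable_def)
qed

lemma Cinf_bounded_linear: "bounded_linear h \<Longrightarrow> Cinf S f \<Longrightarrow> Cinf S (\<lambda>x. h (f x))"
  by (auto simp: Cinf_def intro: Ck_on_bounded_linear)

lemma Cinf_ident: "open S \<Longrightarrow> Cinf S (\<lambda>x. x)"
proof -
  assume "open S"
  moreover have "Ck_on k S (\<lambda>x. x)" for k by (cases k) (auto simp: Ck_on_const)
  ultimately show ?thesis by (simp add: Cinf_def)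
qed

lemma Ck_on_add:
  assumes "open S" "Ck_on k S f" "Ck_on k S g"
  shows "Ck_on k S (\<lambda>x. f x + g x)"
  using assms(2,3)
proof (induction k arbitrary: f g)
  case 0
  then show ?case by (auto intro: continuous_intros)
next
  case (Suc k)
  have d: "((\<lambda>x. f x + g x) has_derivative (\<lambda>v. FD f x v + FD g x v)) (at x)" if "x \<in> S" for x
    using Suc.prems that by (intro derivative_intros FD_has_derivative) auto
  have "Ck_on k S (\<lambda>x. FD (\<lambda>x. f x + g x) x v)" for v
    by (rule Ck_on_cong[OF assms(1) _ Suc.IH[of "\<lambda>x. FD f x v" "\<lambda>x. FD g x v"]])
      (use Suc.prems FD_eqI[OF d] in auto)
  then show ?case using d by (auto simp: differentiable_def)
qed

lemma Cinf_add: "Cinf S f \<Longrightarrow> Cinf S g \<Longrightarrow> Cinf S (\<lambda>x. f x + g x)"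
  by (simp add: Cinf_def Ck_on_add)

lemma Cinf_uminus: "Cinf S f \<Longrightarrow> Cinf S (\<lambda>x. - f x)"
  by (rule Cinf_bounded_linear[OF bounded_linear_minus[OF bounded_linear_ident]])

lemma Cinf_diff: "Cinf S f \<Longrightarrow> Cinf S g \<Longrightarrow> Cinf S (\<lambda>x. f x - g x)"
  using Cinf_add[OF _ Cinf_uminus, of S f g] by simp

lemma Cinf_sum: "open S \<Longrightarrow> (\<And>i. i \<in> I \<Longrightarrow> Cinf S (f i)) \<Longrightarrow> Cinf S (\<lambda>x. \<Sum>i\<in>I. f i x)"
  by (induction I rule: infinite_finite_induct) (auto intro: Cinf_add Cinf_const)

lemma Ck_on_bilinear:
  assumes b: "bounded_bilinear p" and "open S" "Ck_on k S f" "Ck_on k S g"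
  shows "Ck_on k S (\<lambda>x. p (f x) (g x))"
  using assms(3,4)
proof (induction k arbitrary: f g)
  case 0
  then show ?case using bounded_bilinear.continuous_on[OF b] by auto
next
  case (Suc k)
  have d: "((\<lambda>x. p (f x) (g x)) has_derivative (\<lambda>v. p (f x) (FD g x v) + p (FD f x v) (g x))) (at x)"
    if "x \<in> S" for x
    using Suc.prems that by (intro bounded_bilinear.FDERIV[OF b] FD_has_derivative) auto
  have "Ck_on k S (\<lambda>x. FD (\<lambda>x. p (f x) (g x)) x v)" for v
    by (rule Ck_on_cong[OF assms(2) _ Ck_on_add[OF assms(2)
            Suc.IH[of f "\<lambda>x. FD g x v"] Suc.IH[of "\<lambda>x. FD f x v" g]]])
      (use Suc.prems Ck_on_SucD FD_eqI[OF d] in auto)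
  then show ?case using d by (auto simp: differentiable_def)
qed

lemma Cinf_bilinear: "bounded_bilinear p \<Longrightarrow> Cinf S f \<Longrightarrow> Cinf S g \<Longrightarrow> Cinf S (\<lambda>x. p (f x) (g x))"
  by (simp add: Cinf_def Ck_on_bilinear)

lemmas Cinf_scaleR = Cinf_bilinear[OF bounded_bilinear_scaleR]
lemmas Cinf_mult = Cinf_bilinear[OF bounded_bilinear_mult]
lemmas Cinf_inner = Cinf_bilinear[OF bounded_bilinear_inner]

lemma Cinf_Pair:
  assumes "Cinf S f" "Cinf S g"
  shows "Cinf S (\<lambda>x. (f x, g x))"
proof -
  have "bounded_linear (\<lambda>x::'b. (x, 0::'c))" "bounded_linear (\<lambda>x::'c. (0::'b, x))"
    by (intro bounded_linear_Pair bounded_linear_ident bounded_linear_zero)+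
  from Cinf_add[OF Cinf_bounded_linear[OF this(1) assms(1)] Cinf_bounded_linear[OF this(2) assms(2)]]
  show ?thesis by simp
qed

text \<open>\<open>Ck_on\<close> controls derivatives in a fixed direction only; a varying direction
  is reduced to the basis directions by this expansion.\<close>

lemma linear_euclidean_sum:
  fixes h :: "'a::euclidean_space \<Rightarrow> 'b::real_vector"
  shows "linear h \<Longrightarrow> h v = (\<Sum>b\<in>Basis. (v \<bullet> b) *\<^sub>R h b)"
  using euclidean_representation[of v] linear_sum[of h "\<lambda>b. (v \<bullet> b) *\<^sub>R b" Basis] linear_cmul[of h]
  by simp

text \<open>In the chain rule the outer factor \<open>FD f (g x) b\<close> is again a smooth
  function composed with \<open>g\<close>. The induction therefore varies \<open>f\<close>, keeps
  \<open>g\<close> fixed and assumes full smoothness of both, so that no order of differentiability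
  has to be tracked.\<close>

lemma Ck_on_compose:
  fixes f :: "'b::euclidean_space \<Rightarrow> 'c::real_normed_vector"
  assumes "open S" "Cinf S g" "Cinf T f" "g ` S \<subseteq> T"
  shows "Ck_on k S (\<lambda>x. f (g x))"
  using assms(3)
proof (induction k arbitrary: f)
  case 0
  then show ?case using assms Cinf_continuous_on continuous_on_compose2 by (metis Ck_on.simps(1))
next
  case (Suc k)
  have d: "((\<lambda>x. f (g x)) has_derivative (\<lambda>v. FD f (g x) (FD g x v))) (at x)" if "x \<in> S" for x
    using diff_chain_at[OF Cinf_has_derivative[OF assms(2) that] Cinf_has_derivative[OF Suc.prems]] assms that
    by (auto simp: o_def)
  have "Ck_on k S (\<lambda>x. FD g x v \<bullet> b)" for v b
    using Cinf_inner[OF Cinf_FD[OF assms(2)] Cinf_const[OF assms(1)]] by (simp add: Cinf_def)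
  then have t: "Ck_on k S (\<lambda>x. (FD g x v \<bullet> b) *\<^sub>R FD f (g x) b)" for v b
    by (rule Ck_on_bilinear[OF bounded_bilinear_scaleR assms(1) _ Suc.IH[OF Cinf_FD[OF Suc.prems]]])
  have s: "Ck_on k S (\<lambda>x. \<Sum>b\<in>B. (FD g x v \<bullet> b) *\<^sub>R FD f (g x) b)" for v B
    using t by (induction B rule: infinite_finite_induct) (auto intro: Ck_on_const Ck_on_add assms(1))
  have "Ck_on k S (\<lambda>x. FD (\<lambda>x. f (g x)) x v)" for v
    by (rule Ck_on_cong[OF assms(1) _ s[of v Basis]])
      (use FD_eqI[OF d] linear_euclidean_sum[OF Cinf_linear_FD[OF Suc.prems]] assms(4) in auto)
  then show ?case using d by (auto simp: differentiable_def)
qed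

lemma Cinf_compose: "Cinf T f \<Longrightarrow> Cinf S g \<Longrightarrow> (\<And>x. x \<in> S \<Longrightarrow> g x \<in> T) \<Longrightarrow> Cinf S (\<lambda>x. f (g x))"
  unfolding Cinf_def[of S "\<lambda>x. f (g x)"]
  using Ck_on_compose[of S g T f] Cinf_open by blast

lemma Cinf_FD_compose:
  assumes "Cinf T f" "Cinf S h" "Cinf S X" "\<And>x. x \<in> S \<Longrightarrow> h x \<in> T"
  shows "Cinf S (\<lambda>x. FD f (h x) (X x))"
proof -
  have "Cinf S (\<lambda>x. \<Sum>b\<in>Basis. (X x \<bullet> b) *\<^sub>R FD f (h x) b)"
    by (intro Cinf_sum Cinf_scaleR Cinf_inner assms Cinf_const Cinf_compose[OF Cinf_FD[OF assms(1)] assms(2)]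
        Cinf_open[OF assms(2)])
  then show ?thesis
    by (rule Cinf_cong) (metis assms(1,4) linear_euclidean_sum Cinf_linear_FD)
qed

text \<open>The derivative of the inverse is a polynomial in the inverse itself, so the induction
  hypothesis at order \<open>k\<close> already covers it.\<close>

lemma Ck_on_inverse: "Ck_on k (- {0}) (inverse :: real \<Rightarrow> real)"
proof (induction k)
  case (Suc k)
  have d: "((inverse :: real \<Rightarrow> real) has_derivative (\<lambda>v. - (inverse x * v * inverse x))) (at x)"
    if "x \<in> - {0}" for x
    using that by (auto intro!: derivative_eq_intros)
  have "Ck_on k (-{0}) (\<lambda>x. inverse x * (- v * inverse x))" for v :: real
    by (rule Ck_on_bilinear[OF bounded_bilinear_mult _ Suc
          Ck_on_bilinear[OF bounded_bilinear_mult _ Ck_on_const Suc]]) auto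
  then have "Ck_on k (-{0}) (\<lambda>x. FD inverse x v)" for v :: real
    by (rule Ck_on_cong[rotated 2]) (use FD_eqI[OF d] in auto)
  then show ?case using d by (auto simp: differentiable_def)
qed (auto intro!: continuous_intros)

lemma Cinf_inverse:
  fixes f :: "'a::euclidean_space \<Rightarrow> real"
  assumes "Cinf S f" "\<And>x. x \<in> S \<Longrightarrow> f x \<noteq> 0"
  shows "Cinf S (\<lambda>x. inverse (f x))"
  by (rule Cinf_compose[of "-{0}" inverse S f]) (use assms in \<open>auto simp: Cinf_def Ck_on_inverse\<close>)

lemma FD_compose:
  assumes "g differentiable at x" "f differentiable at (g x)"
  shows "FD (\<lambda>x. f (g x)) x v = FD f (g x) (FD g x v)"
  using frechet_derivative_compose[OF assms] by (simp add: o_def)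

section \<open>Symmetry of second derivatives\<close>

lemma second_difference_mvt:
  fixes \<phi> :: "real \<Rightarrow> real \<Rightarrow> real"
  assumes "h > 0"
    and 1: "\<And>t s. t \<in> {0..h} \<Longrightarrow> s \<in> {0..h} \<Longrightarrow> ((\<lambda>t. \<phi> t s) has_real_derivative d\<phi> t s) (at t)"
    and 2: "\<And>t s. t \<in> {0..h} \<Longrightarrow> s \<in> {0..h} \<Longrightarrow> ((\<lambda>s. d\<phi> t s) has_real_derivative dd\<phi> t s) (at s)"
  shows "\<exists>t\<in>{0..h}. \<exists>s\<in>{0..h}. \<phi> h h - \<phi> h 0 - \<phi> 0 h + \<phi> 0 0 = h * h * dd\<phi> t s"
proof -
  have "\<exists>z. z > 0 \<and> z < h \<and> (\<phi> h h - \<phi> h 0) - (\<phi> 0 h - \<phi> 0 0) = (h - 0) * (d\<phi> z h - d\<phi> z 0)"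
    by (rule MVT2[OF \<open>h > 0\<close>, of "\<lambda>t. \<phi> t h - \<phi> t 0" "\<lambda>t. d\<phi> t h - d\<phi> t 0"])
      (use assms in \<open>auto intro!: derivative_intros\<close>)
  then obtain z where z: "z > 0" "z < h" "(\<phi> h h - \<phi> h 0) - (\<phi> 0 h - \<phi> 0 0) = h * (d\<phi> z h - d\<phi> z 0)" by auto
  have "\<exists>s. s > 0 \<and> s < h \<and> d\<phi> z h - d\<phi> z 0 = (h - 0) * dd\<phi> z s"
    by (rule MVT2[OF \<open>h > 0\<close>]) (use assms z in auto)
  then obtain s where "s > 0" "s < h" "d\<phi> z h - d\<phi> z 0 = h * dd\<phi> z s" by auto
  with z show ?thesis by (intro bexI[of _ z] bexI[of _ s]) auto
qed

lemma line_derivative: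
  assumes "F differentiable at (a + t *\<^sub>R w)"
  shows "((\<lambda>t. F (a + t *\<^sub>R w)) has_vector_derivative FD F (a + t *\<^sub>R w) w) (at t)"
proof -
  have "((\<lambda>t. a + t *\<^sub>R w) has_derivative (\<lambda>t. t *\<^sub>R w)) (at t)"
    by (auto intro!: derivative_eq_intros)
  from diff_chain_at[OF this FD_has_derivative[OF assms]]
  have "((\<lambda>t. F (a + t *\<^sub>R w)) has_derivative (\<lambda>r. FD F (a + t *\<^sub>R w) (r *\<^sub>R w))) (at t)" by (simp add: o_def)
  then show ?thesis
    by (simp add: has_vector_derivative_def linear_cmul[OF linear_frechet_derivative[OF assms]])
qed

lemma line_derivative_0:
  assumes "F differentiable at a"
  shows "((\<lambda>t. F (a + t *\<^sub>R w)) has_vector_derivative FD F a w) (at 0)"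
  using line_derivative[of F a 0 w] assms by simp

lemma line_derivative_real:
  fixes F :: "'a::real_normed_vector \<Rightarrow> real"
  assumes "F differentiable at a"
  shows "((\<lambda>t. F (a + t *\<^sub>R w)) has_real_derivative FD F a w) (at 0)"
  using line_derivative_0[OF assms] by (simp add: has_real_derivative_iff_has_vector_derivative)

text \<open>The second difference over a small parallelogram with sides \<open>h *\<^sub>R u\<close>
  and \<open>h *\<^sub>R v\<close> is \<open>h * h\<close> times the mixed derivative in one order
  at some point, and in the other order at another point. By continuity both values are close to
  those at \<open>x\<close>, so a gap between these is contradictory.\<close>

lemma FD_real_symmetric:
  fixes f :: "'a::euclidean_space \<Rightarrow> real"
  assumes f: "Cinf S f" and x: "x \<in> S"
  shows "FD (\<lambda>y. FD f y u) x v = FD (\<lambda>y. FD f y v) x u"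
proof (rule ccontr)
  define G where "G u v = (\<lambda>y. FD (\<lambda>y. FD f y u) y v)" for u v
  assume "\<not> ?thesis"
  then have ne: "G u v x \<noteq> G v u x" by (simp add: G_def)
  \<comment> \<open>Half of the gap: two errors below \<open>e\<close> cannot bridge it.\<close>
  define e where "e = \<bar>G u v x - G v u x\<bar> / 2"
  have e: "e > 0" using ne by (simp add: e_def)
  have cont: "isCont (G u v) x" for u v
    unfolding G_def
    using Cinf_continuous_on[OF Cinf_FD[OF Cinf_FD[OF f]]] x Cinf_open[OF f] continuous_on_eq_continuous_at by blast
  have near: "\<exists>d>0. \<forall>y. dist y x < d \<longrightarrow> \<bar>G u v y - G u v x\<bar> < e" for u v
    using cont[of u v] e unfolding continuous_at_eps_delta by (simp add: dist_real_def)
  obtain d1 where d1: "d1 > 0" "\<And>y. dist y x < d1 \<Longrightarrow> \<bar>G u v y - G u v x\<bar> < e" using near by metis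
  obtain d2 where d2: "d2 > 0" "\<And>y. dist y x < d2 \<Longrightarrow> \<bar>G v u y - G v u x\<bar> < e" using near by metis
  obtain d3 where d3: "d3 > 0" "\<And>y. dist y x < d3 \<Longrightarrow> y \<in> S"
    using x Cinf_open[OF f] by (metis open_dist)
  define d where "d = min d1 (min d2 d3)"
  \<comment> \<open>The parallelogram then lies in the ball of radius \<open>d\<close>; the summand
    1 keeps the denominator positive whatever \<open>u\<close> and \<open>v\<close> are.\<close>
  define h where "h = d / (2 * (norm u + norm v + 1))"
  have h: "h > 0" using d1 d2 d3 by (simp add: h_def d_def add_nonneg_pos)
  have close: "dist (x + t *\<^sub>R u + s *\<^sub>R v) x < d" if "t \<in> {0..h}" "s \<in> {0..h}" for t s
  proof -
    have "dist (x + t *\<^sub>R u + s *\<^sub>R v) x \<le> \<bar>t\<bar> * norm u + \<bar>s\<bar> * norm v"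
      by (simp add: dist_norm) (metis norm_scaleR norm_triangle_ineq)
    also have "\<dots> \<le> h * norm u + h * norm v" using that by (intro add_mono mult_right_mono) auto
    also have "\<dots> < h * (2 * (norm u + norm v + 1))"
    proof -
      have "0 \<le> h * norm u" "0 \<le> h * norm v" using h by auto
      moreover have "h * (2 * (norm u + norm v + 1)) = 2 * (h * norm u) + 2 * (h * norm v) + 2 * h"
        by (simp add: algebra_simps)
      ultimately show ?thesis using h by linarith
    qed
    also have "\<dots> = d" using add_nonneg_pos[of "norm u + norm v" 1] by (simp add: h_def)
    finally show ?thesis .
  qed
  have inS: "x + t *\<^sub>R u + s *\<^sub>R v \<in> S" if "t \<in> {0..h}" "s \<in> {0..h}" for t s
    using close[OF that] d3(2) by (simp add: d_def)
  have der: "((\<lambda>t. F (a + t *\<^sub>R w)) has_real_derivative FD F (a + t *\<^sub>R w) w) (at t)"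
    if "F differentiable at (a + t *\<^sub>R w)" for F :: "'a \<Rightarrow> real" and t a w
    using line_derivative[OF that] by (simp add: has_real_derivative_iff_has_vector_derivative)
  let ?\<phi> = "\<lambda>t s. f (x + t *\<^sub>R u + s *\<^sub>R v)"
  have "\<exists>t\<in>{0..h}. \<exists>s\<in>{0..h}. ?\<phi> h h - ?\<phi> h 0 - ?\<phi> 0 h + ?\<phi> 0 0 = h * h * G u v (x + t *\<^sub>R u + s *\<^sub>R v)"
  proof (rule second_difference_mvt[OF h, where d\<phi> = "\<lambda>t s. FD f (x + t *\<^sub>R u + s *\<^sub>R v) u"])
    fix t s assume ts: "t \<in> {0..h}" "s \<in> {0..h}"
    have "f differentiable at (x + s *\<^sub>R v + t *\<^sub>R u)"
      using Cinf_differentiable[OF f inS[OF ts]] by (simp add: algebra_simps)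
    from der[OF this] show "((\<lambda>t. ?\<phi> t s) has_real_derivative FD f (x + t *\<^sub>R u + s *\<^sub>R v) u) (at t)"
      by (simp add: algebra_simps)
    show "((\<lambda>s. FD f (x + t *\<^sub>R u + s *\<^sub>R v) u) has_real_derivative G u v (x + t *\<^sub>R u + s *\<^sub>R v)) (at s)"
      unfolding G_def by (rule der) (rule Cinf_differentiable[OF Cinf_FD[OF f] inS[OF ts]])
  qed
  moreover
  \<comment> \<open>The second difference is symmetric in its two parameters, so exchanging their
    roles gives the other order of differentiation.\<close>
  have "\<exists>s\<in>{0..h}. \<exists>t\<in>{0..h}. ?\<phi> h h - ?\<phi> 0 h - ?\<phi> h 0 + ?\<phi> 0 0 = h * h * G v u (x + t *\<^sub>R u + s *\<^sub>R v)"
  proof (rule second_difference_mvt[OF h, where d\<phi> = "\<lambda>s t. FD f (x + t *\<^sub>R u + s *\<^sub>R v) v" and \<phi> = "\<lambda>s t. ?\<phi> t s"])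
    fix t s assume ts: "s \<in> {0..h}" "t \<in> {0..h}"
    have "(\<lambda>y. FD f y v) differentiable at (x + s *\<^sub>R v + t *\<^sub>R u)"
      using Cinf_differentiable[OF Cinf_FD[OF f] inS[OF ts(2,1)]] by (simp add: algebra_simps)
    from der[OF this] show "((\<lambda>t. FD f (x + t *\<^sub>R u + s *\<^sub>R v) v) has_real_derivative G v u (x + t *\<^sub>R u + s *\<^sub>R v)) (at t)"
      unfolding G_def by (simp add: algebra_simps)
    show "((\<lambda>s. ?\<phi> t s) has_real_derivative FD f (x + t *\<^sub>R u + s *\<^sub>R v) v) (at s)"
      by (rule der) (rule Cinf_differentiable[OF f inS[OF ts(2,1)]])
  qed
  ultimately obtain t s t' s' where ts: "t \<in> {0..h}" "s \<in> {0..h}" "t' \<in> {0..h}" "s' \<in> {0..h}"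
    and eq: "G u v (x + t *\<^sub>R u + s *\<^sub>R v) = G v u (x + t' *\<^sub>R u + s' *\<^sub>R v)"
    using h by (auto simp: algebra_simps)
  have "\<bar>G u v (x + t *\<^sub>R u + s *\<^sub>R v) - G u v x\<bar> < e" "\<bar>G v u (x + t' *\<^sub>R u + s' *\<^sub>R v) - G v u x\<bar> < e"
    using d1(2) d2(2) close[OF ts(1,2)] close[OF ts(3,4)] by (simp_all add: d_def)
  with eq have "\<bar>G u v x - G v u x\<bar> < e + e" by linarith
  then show False by (simp add: e_def)
qed

lemma FD_symmetric:
  fixes f :: "'a::euclidean_space \<Rightarrow> 'b::euclidean_space"
  assumes f: "Cinf S f" and x: "x \<in> S"
  shows "FD (\<lambda>y. FD f y u) x v = FD (\<lambda>y. FD f y v) x u"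
proof (rule euclidean_eqI)
  fix b :: 'b
  have i: "FD (\<lambda>y. g y \<bullet> b) y w = FD g y w \<bullet> b" if "g differentiable at y" for g :: "'a \<Rightarrow> 'b" and y w
    using FD_eqI[OF has_derivative_inner_left[OF FD_has_derivative[OF that]]] by simp
  have fb: "Cinf S (\<lambda>y. f y \<bullet> b)" by (intro Cinf_inner f Cinf_const Cinf_open[OF f])
  have "FD (\<lambda>y. FD (\<lambda>y. f y \<bullet> b) y u) x v = FD (\<lambda>y. FD f y u) x v \<bullet> b" for u v
  proof -
    have "FD (\<lambda>y. FD (\<lambda>y. f y \<bullet> b) y u) x v = FD (\<lambda>y. FD f y u \<bullet> b) x v"
      by (rule arg_cong[where f="\<lambda>g. g v"],
          rule FD_cong[OF Cinf_differentiable[OF Cinf_FD[OF fb] x] Cinf_open[OF f] x])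
        (rule i[OF Cinf_differentiable[OF f]])
    also have "\<dots> = FD (\<lambda>y. FD f y u) x v \<bullet> b" by (rule i[OF Cinf_differentiable[OF Cinf_FD[OF f] x]])
    finally show ?thesis .
  qed
  with FD_real_symmetric[OF fb x, of u v]
  show "FD (\<lambda>y. FD f y u) x v \<bullet> b = FD (\<lambda>y. FD f y v) x u \<bullet> b" by simp
qed

text \<open>Product rule for \<open>D f\<close> at a moving point applied to a moving vector: a
  second-derivative term with the vector frozen, plus \<open>D f\<close> of the derivative of the
  vector. Chart changes of vector fields and of accelerations and the derivative of the Legendre map
  all rest on it. The set \<open>T\<close> admits one-sided derivatives.\<close>

lemma has_derivative_FD_apply:
  fixes f :: "'a::euclidean_space \<Rightarrow> 'b::real_normed_vector" and h :: "'d::real_normed_vector \<Rightarrow> 'a"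
  assumes f: "Cinf S f" "h t \<in> S" and h: "(h has_derivative h') (at t within T)"
    and X: "(X has_derivative X') (at t within T)" and t: "t \<in> T"
  shows "((\<lambda>y. FD f (h y) (X y)) has_derivative
    (\<lambda>u. FD (\<lambda>y. FD f y (X t)) (h t) (h' u) + FD f (h t) (X' u))) (at t within T)"
proof -
  have g: "((\<lambda>y. FD f y w) has_derivative FD (\<lambda>y. FD f y w) (h t)) (at (h t))" for w
    by (rule Cinf_has_derivative[OF Cinf_FD[OF f(1)] f(2)])
  have gh: "((\<lambda>y. FD f (h y) w) has_derivative (\<lambda>u. FD (\<lambda>y. FD f y w) (h t) (h' u))) (at t within T)" for w
    using diff_chain_within[OF h has_derivative_at_withinI[OF g]] by (simp add: o_def)
  have l: "linear (FD f y)" if "y \<in> S" for y by (rule Cinf_linear_FD[OF f(1) that])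
  have "((\<lambda>y. \<Sum>b\<in>Basis. (X t \<bullet> b) *\<^sub>R FD f y b) has_derivative
      (\<lambda>u. \<Sum>b\<in>Basis. (X t \<bullet> b) *\<^sub>R FD (\<lambda>y. FD f y b) (h t) u)) (at (h t))"
    by (auto intro!: derivative_eq_intros g)
  then have "((\<lambda>y. FD f y (X t)) has_derivative
      (\<lambda>u. \<Sum>b\<in>Basis. (X t \<bullet> b) *\<^sub>R FD (\<lambda>y. FD f y b) (h t) u)) (at (h t))"
    by (rule has_derivative_transform_within_open[OF _ Cinf_open[OF f(1)] f(2)])
      (simp add: linear_euclidean_sum[OF l, symmetric])
  from FD_eqI[OF this]
  have eq: "(\<lambda>u. \<Sum>b\<in>Basis. (X t \<bullet> b) *\<^sub>R FD (\<lambda>y. FD f y b) (h t) (h' u) + (X' u \<bullet> b) *\<^sub>R FD f (h t) b)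
      = (\<lambda>u. FD (\<lambda>y. FD f y (X t)) (h t) (h' u) + FD f (h t) (X' u))"
    using linear_euclidean_sum[OF l[OF f(2)], of "X' _"] by (simp add: sum.distrib)
  have "((\<lambda>y. \<Sum>b\<in>Basis. (X y \<bullet> b) *\<^sub>R FD f (h y) b) has_derivative
      (\<lambda>u. FD (\<lambda>y. FD f y (X t)) (h t) (h' u) + FD f (h t) (X' u))) (at t within T)"
    unfolding eq[symmetric] by (intro derivative_intros gh X)
  moreover have "\<forall>\<^sub>F y in at t within T. h y \<in> S"
    using has_derivative_continuous[OF h] Cinf_open[OF f(1)] f(2)
    by (simp add: continuous_within topological_tendstoD)
  then have "\<forall>\<^sub>F y in at t within T. (\<Sum>b\<in>Basis. (X y \<bullet> b) *\<^sub>R FD f (h y) b) = FD f (h y) (X y)"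
    by eventually_elim (simp add: linear_euclidean_sum[OF l, symmetric])
  ultimately show ?thesis
    by (rule has_derivative_transform_eventually)
      (use f(2) t in \<open>simp_all add: linear_euclidean_sum[OF l, symmetric]\<close>)
qed

section \<open>Partial derivatives and slices of maps of two parameters\<close>

lemma partial_derivative_1:
  fixes F :: "real \<times> real \<Rightarrow> 'b::real_normed_vector"
  assumes "F differentiable at (t, s)"
  shows "((\<lambda>\<tau>. F (\<tau>, s)) has_vector_derivative FD F (t, s) (1, 0)) (at t)"
  using line_derivative[of F "(0, s)" t "(1, 0)"] assms by simp

lemma partial_derivative_2:
  fixes F :: "real \<times> real \<Rightarrow> 'b::real_normed_vector"
  assumes "F differentiable at (t, s)"
  shows "((\<lambda>\<sigma>. F (t, \<sigma>)) has_vector_derivative FD F (t, s) (0, 1)) (at s)"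
  using line_derivative[of F "(t, 0)" s "(0, 1)"] assms by simp

lemma has_vector_derivative_transform_eventually:
  assumes "(f has_vector_derivative f') (at x within S)" "\<forall>\<^sub>F y in at x within S. f y = g y" "f x = g x" "x \<in> S"
  shows "(g has_vector_derivative f') (at x within S)"
  using assms unfolding has_vector_derivative_def by (rule has_derivative_transform_eventually)

lemma has_derivative_imp_vector_derivative:
  fixes f :: "real \<Rightarrow> 'b::real_normed_vector"
  assumes "(f has_derivative K) (at x within S)"
  shows "(f has_vector_derivative K 1) (at x within S)"
proof -
  have "K h = h *\<^sub>R K 1" for h using linear_cmul[OF has_derivative_linear[OF assms], of h 1] by simp
  then show ?thesis
    unfolding has_vector_derivative_def by (intro has_derivative_eq_rhs[OF assms] ext)
qed

lemma eventually_slice_1: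
  fixes U :: "(real \<times> real) set"
  shows "open U \<Longrightarrow> (t, s) \<in> U \<Longrightarrow> \<forall>\<^sub>F \<tau> in at t within S. \<tau> \<in> S \<and> (\<tau>, s) \<in> U"
  unfolding eventually_at_topological
  by (intro exI[of _ "(\<lambda>\<tau>. (\<tau>, s)) -` U"]) (auto intro!: open_vimage continuous_intros)

lemma Cinf_slice:
  fixes F :: "real \<times> real \<Rightarrow> 'b::real_normed_vector"
  assumes "Cinf U F"
  shows "Cinf ((\<lambda>\<sigma>. (\<tau>, \<sigma>)) -` U) (\<lambda>\<sigma>. F (\<tau>, \<sigma>))"
  by (rule Cinf_compose[OF assms])
    (auto intro!: Cinf_Pair Cinf_const Cinf_ident open_vimage Cinf_open[OF assms] continuous_intros)

lemma FD_slice: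
  fixes F :: "real \<times> real \<Rightarrow> 'b::real_normed_vector"
  assumes "F differentiable at (\<tau>, \<sigma>)"
  shows "FD (\<lambda>\<sigma>. F (\<tau>, \<sigma>)) \<sigma> 1 = FD F (\<tau>, \<sigma>) (0, 1)"
  using FD_eqI[OF partial_derivative_2[OF assms, unfolded has_vector_derivative_def]] by simp

lemma Cinf_real_derivative:
  fixes f :: "real \<Rightarrow> 'b::real_normed_vector"
  shows "Cinf J f \<Longrightarrow> s \<in> J \<Longrightarrow> (f has_vector_derivative FD f s 1) (at s)"
  by (intro has_derivative_imp_vector_derivative Cinf_has_derivative)

section \<open>Bump functions\<close>

text \<open>The usual flat function exp(-1/x) is \<open>flat_exp 0\<close>. The powers of
  \<open>inverse x\<close> are included because the derivative of a member is then a linear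
  combination of members, which makes smoothness a plain induction over the whole family.\<close>

definition flat_exp :: "nat \<Rightarrow> real \<Rightarrow> real" where
  "flat_exp n x = (if x \<le> 0 then 0 else inverse x ^ n * exp (- inverse x))"

lemma flat_exp_tendsto_0: "(flat_exp n \<longlongrightarrow> 0) (at_right 0)"
proof -
  have "((\<lambda>y::real. y ^ n / exp y) \<longlongrightarrow> 0) at_top" by (rule tendsto_power_div_exp_0)
  then have "((\<lambda>x::real. inverse x ^ n / exp (inverse x)) \<longlongrightarrow> 0) (at_right 0)"
    by (rule filterlim_compose[OF _ filterlim_inverse_at_top_right])
  then show ?thesis
    by (rule Lim_transform_eventually)
      (auto simp: eventually_at_filter flat_exp_def exp_minus field_simps intro!: always_eventually)
qed

lemma flat_exp_derivative:
  "(flat_exp n has_real_derivative (flat_exp (n + 2) x - real n * flat_exp (n + 1) x)) (at x)"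
proof -
  consider "x < 0" | "x > 0" | "x = 0" by linarith
  then show ?thesis
  proof cases
    case 1
    have "((\<lambda>x. 0::real) has_real_derivative 0) (at x)" by simp
    then have "(flat_exp n has_real_derivative 0) (at x)"
      by (rule has_field_derivative_transform_within_open[where S="{..<0}"])
        (use 1 in \<open>auto simp: flat_exp_def\<close>)
    then show ?thesis using 1 by (simp add: flat_exp_def)
  next
    case 2
    have d: "((\<lambda>y. inverse y) has_real_derivative - (inverse x)\<^sup>2) (at x)"
      using 2 DERIV_inverse[of x] by (simp add: power2_eq_square)
    have "((\<lambda>x. inverse x ^ n * exp (- inverse x)) has_real_derivative
        inverse x ^ n * (exp (- inverse x) * (inverse x)\<^sup>2)
        + (real n * (- (inverse x)\<^sup>2 * inverse x ^ (n - Suc 0))) * exp (- inverse x)) (at x)"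
      using DERIV_mult[OF DERIV_power[OF d, of n] DERIV_fun_exp[OF DERIV_minus[OF d]]]
      by (simp add: algebra_simps)
    moreover have "real n * inverse x ^ (n - Suc 0) * (inverse x)\<^sup>2 = real n * inverse x ^ (n + 1)"
      by (cases n) (auto simp: power2_eq_square)
    ultimately have "((\<lambda>x. inverse x ^ n * exp (- inverse x)) has_real_derivative
        flat_exp (n + 2) x - real n * flat_exp (n + 1) x) (at x)"
      by (elim DERIV_cong) (use 2 in \<open>auto simp add: flat_exp_def power_add power2_eq_square algebra_simps\<close>)
    then show ?thesis
      by (rule has_field_derivative_transform_within_open[where S="{0<..}"])
        (use 2 in \<open>auto simp: flat_exp_def\<close>)
  next
    case 3
    have "((\<lambda>h. (flat_exp n (0 + h) - flat_exp n 0) / h) \<longlongrightarrow> 0) (at 0)"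
    proof (rule filterlim_split_at_real)
      show "((\<lambda>h. (flat_exp n (0 + h) - flat_exp n 0) / h) \<longlongrightarrow> 0) (at_left 0)"
        by (rule Lim_transform_eventually[OF tendsto_const])
          (auto simp: eventually_at_filter flat_exp_def intro!: always_eventually)
      \<comment> \<open>On the right the difference quotient of \<open>flat_exp n\<close> at 0 is
        \<open>flat_exp (Suc n)\<close> itself.\<close>
      show "((\<lambda>h. (flat_exp n (0 + h) - flat_exp n 0) / h) \<longlongrightarrow> 0) (at_right 0)"
        by (rule Lim_transform_eventually[OF flat_exp_tendsto_0[of "Suc n"]])
          (auto simp: eventually_at_filter flat_exp_def field_simps intro!: always_eventually)
    qed
    then show ?thesis using 3 by (simp add: DERIV_def flat_exp_def)
  qed
qed

lemma Ck_on_flat_exp: "Ck_on k UNIV (flat_exp n)"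
proof (induction k arbitrary: n)
  case 0
  then show ?case using flat_exp_derivative DERIV_isCont continuous_at_imp_continuous_on[of UNIV] by (metis Ck_on.simps(1))
next
  case (Suc k)
  have d: "(flat_exp n has_derivative (\<lambda>v. v * (flat_exp (n + 2) x - real n * flat_exp (n + 1) x))) (at x)" for x
    by (rule has_derivative_eq_rhs[OF flat_exp_derivative[unfolded has_field_derivative_def]]) (simp add: fun_eq_iff)
  have bl: "bounded_linear (\<lambda>x::real. c * x)" for c by (rule bounded_linear_mult_right)
  have e: "FD (flat_exp n) x v = v * flat_exp (n + 2) x + (- v * real n) * flat_exp (n + 1) x" for x v
    using FD_eqI[OF d[of x]] by (simp add: algebra_simps)
  have "Ck_on k UNIV (\<lambda>x. FD (flat_exp n) x v)" for v
    unfolding e by (intro Ck_on_add Ck_on_bounded_linear[OF bl] Suc open_UNIV)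
  then show ?case using d by (auto simp: differentiable_def)
qed

lemma Cinf_flat_exp: "Cinf UNIV (flat_exp n)"
  by (simp add: Cinf_def Ck_on_flat_exp)

text \<open>A quotient \<open>a / (a + b)\<close> of two flat functions: \<open>a\<close> vanishes
  outside the ball of radius \<open>r\<close>, \<open>b\<close> inside the ball of radius
  \<open>r / 2\<close>. No point lies in both zero sets, so the denominator is positive.\<close>

lemma bump_euclidean:
  fixes x0 :: "'a::euclidean_space"
  assumes "r > 0"
  obtains \<psi> :: "'a \<Rightarrow> real" where "Cinf UNIV \<psi>" "\<And>x. x \<in> ball x0 (r / 2) \<Longrightarrow> \<psi> x = 1"
    "\<And>x. x \<notin> ball x0 r \<Longrightarrow> \<psi> x = 0"
proof -
  define a where "a x = flat_exp 0 (r\<^sup>2 - (x - x0) \<bullet> (x - x0))" for x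
  define b where "b x = flat_exp 0 ((x - x0) \<bullet> (x - x0) - (r / 2)\<^sup>2)" for x
  have pos: "flat_exp 0 t > 0" if "t > 0" for t using that by (simp add: flat_exp_def)
  have nn: "flat_exp 0 t \<ge> 0" for t by (simp add: flat_exp_def)
  have "a x + b x > 0" for x
  proof (cases "(x - x0) \<bullet> (x - x0) < r\<^sup>2")
    case True
    then show ?thesis unfolding a_def b_def by (intro add_pos_nonneg pos nn) auto
  next
    case False
    have "(r/2)\<^sup>2 < r\<^sup>2" using assms by (simp add: power2_eq_square)
    with False show ?thesis unfolding a_def b_def by (intro add_nonneg_pos pos nn) auto
  qed
  then have ne: "a x + b x \<noteq> 0" for x by (metis less_irrefl)
  have "Cinf UNIV (\<lambda>x. a x * inverse (a x + b x))"
    unfolding a_def b_def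
    by (intro Cinf_mult Cinf_inverse Cinf_add Cinf_compose[OF Cinf_flat_exp] Cinf_diff Cinf_inner Cinf_const
        Cinf_ident open_UNIV) (use ne in \<open>auto simp: a_def b_def\<close>)
  moreover have "a x * inverse (a x + b x) = 1" if "x \<in> ball x0 (r / 2)" for x
  proof -
    have "norm (x - x0) < r / 2" using that by (simp add: dist_norm norm_minus_commute)
    then have "(norm (x - x0))\<^sup>2 < (r/2)\<^sup>2" by (intro power_strict_mono) auto
    then have "b x = 0" by (simp add: b_def flat_exp_def dot_square_norm)
    then show ?thesis using ne[of x] by simp
  qed
  moreover have "a x * inverse (a x + b x) = 0" if "x \<notin> ball x0 r" for x
  proof -
    have "norm (x - x0) \<ge> r" using that by (simp add: dist_norm norm_minus_commute)
    then have "(norm (x - x0))\<^sup>2 \<ge> r\<^sup>2" using assms by (intro power_mono) auto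
    then show ?thesis by (simp add: a_def flat_exp_def dot_square_norm)
  qed
  ultimately show ?thesis using that by blast
qed

section \<open>Charts and tangent coordinates\<close>

abbreviation tr :: "('m, 'e) chart \<Rightarrow> ('m, 'e) chart \<Rightarrow> 'e \<Rightarrow> 'e" where
  "tr c d \<equiv> \<lambda>x. cmap d (cinv c x)"

text \<open>The charts of the maximal atlas generated by \<open>M\<close>. Slice charts of a
  submanifold are only known to be of this kind, so the calculus is set up for them rather than for
  members of \<open>M\<close> alone.\<close>

definition mchart :: "('m::topological_space, 'e::euclidean_space) chart set \<Rightarrow> ('m, 'e) chart \<Rightarrow> bool" where
  "mchart M d \<longleftrightarrow> is_chart d \<and> (\<forall>c\<in>M. compatible c d)"

definition vrep :: "('m, 'e::euclidean_space) chart set \<Rightarrow> ('m, 'e) chart \<Rightarrow> ('m \<Rightarrow> 'e) \<Rightarrow> 'e \<Rightarrow> 'e" where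
  "vrep M c X x = tcoord M c (cinv c x) (X (cinv c x))"

lemma is_chart_open_image:
  assumes "is_chart c" "open O'"
  shows "open (cmap c ` (cdom c \<inter> O'))"
proof -
  have h: "homeomorphism (cdom c) (cmap c ` cdom c) (cmap c) (cinv c)" and o: "open (cmap c ` cdom c)"
    using assms by (auto simp: is_chart_def)
  have "cmap c ` (cdom c \<inter> O') = cmap c ` cdom c \<inter> cinv c -` O'"
    using homeomorphism_apply1[OF h] by force
  then show ?thesis
    using continuous_open_preimage[OF homeomorphism_cont2[OF h] o assms(2)] by simp
qed

lemma is_chart_inv [simp]: "is_chart c \<Longrightarrow> p \<in> cdom c \<Longrightarrow> cinv c (cmap c p) = p"
  unfolding is_chart_def using homeomorphism_apply1 by blast

lemma is_chart_open: "is_chart c \<Longrightarrow> open (cdom c)"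
  by (simp add: is_chart_def)

lemma is_chart_continuous: "is_chart c \<Longrightarrow> p \<in> cdom c \<Longrightarrow> isCont (cmap c) p"
  unfolding is_chart_def using homeomorphism_cont1 continuous_on_eq_continuous_at by blast

lemma is_chart_inv_continuous: "is_chart c \<Longrightarrow> p \<in> cdom c \<Longrightarrow> isCont (cinv c) (cmap c p)"
  unfolding is_chart_def using homeomorphism_cont2 continuous_on_eq_continuous_at by blast

locale smooth_mfd =
  fixes M :: "('m::t2_space, 'e::euclidean_space) chart set"
  assumes manifold: "smooth_manifold M"
begin

lemma mchart_atlas: "c \<in> M \<Longrightarrow> mchart M c"
  using manifold by (auto simp: smooth_manifold_def mchart_def)

lemma chart_at: "chart_at M p \<in> M" "p \<in> cdom (chart_at M p)"
proof -
  have "\<exists>c. c \<in> M \<and> p \<in> cdom c"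
    using manifold UNIV_I[of p] unfolding smooth_manifold_def by (metis UN_E)
  then have "chart_at M p \<in> M \<and> p \<in> cdom (chart_at M p)" unfolding chart_at_def by (rule someI_ex)
  then show "chart_at M p \<in> M" "p \<in> cdom (chart_at M p)" by auto
qed

lemma mchart_chart_at [simp]: "mchart M (chart_at M p)"
  by (simp add: chart_at mchart_atlas)

lemma mchart_is_chart: "mchart M c \<Longrightarrow> is_chart c"
  by (simp add: mchart_def)

lemma mchart_inv [simp]: "mchart M c \<Longrightarrow> p \<in> cdom c \<Longrightarrow> cinv c (cmap c p) = p"
  by (simp add: mchart_def)

lemma mchart_inject: "mchart M c \<Longrightarrow> p \<in> cdom c \<Longrightarrow> q \<in> cdom c \<Longrightarrow> cmap c p = cmap c q \<longleftrightarrow> p = q"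
  by (metis mchart_inv)

lemma mchart_open: "mchart M c \<Longrightarrow> open (cdom c)"
  by (simp add: mchart_def is_chart_open)

lemma mchart_open_image: "mchart M c \<Longrightarrow> open O' \<Longrightarrow> open (cmap c ` (cdom c \<inter> O'))"
  by (simp add: mchart_def is_chart_open_image)

lemma mchart_open_image': "mchart M c \<Longrightarrow> open O' \<Longrightarrow> O' \<subseteq> cdom c \<Longrightarrow> open (cmap c ` O')"
  using mchart_open_image[of c O'] by (simp add: Int_absorb1)

lemma compatible_Cinf:
  assumes "is_chart c" "is_chart d" "compatible c d"
  shows "Cinf (cmap c ` (cdom c \<inter> cdom d)) (tr c d)" "Cinf (cmap d ` (cdom c \<inter> cdom d)) (tr d c)"
proof -
  have "open (cmap c ` (cdom c \<inter> cdom d))" "open (cmap d ` (cdom c \<inter> cdom d))"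
    using is_chart_open_image[OF assms(1) is_chart_open[OF assms(2)]]
      is_chart_open_image[OF assms(2) is_chart_open[OF assms(1)]] by (auto simp: Int_commute)
  then show "Cinf (cmap c ` (cdom c \<inter> cdom d)) (tr c d)" "Cinf (cmap d ` (cdom c \<inter> cdom d)) (tr d c)"
    using assms(3) by (auto simp: compatible_def o_def intro: smooth_on_Cinf)
qed

text \<open>Compatibility with \<open>M\<close> says nothing directly about two charts outside
  \<open>M\<close>. Near each point the transition factors through an atlas chart.\<close>

lemma tr_Cinf:
  assumes c: "mchart M c" and d: "mchart M d"
  shows "Cinf (cmap c ` (cdom c \<inter> cdom d)) (tr c d)"
proof (rule Cinf_local)
  fix x assume "x \<in> cmap c ` (cdom c \<inter> cdom d)"
  then obtain p where p: "x = cmap c p" "p \<in> cdom c" "p \<in> cdom d" by auto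
  define e where "e = chart_at M p"
  have e: "e \<in> M" "p \<in> cdom e" "is_chart e" using chart_at mchart_is_chart mchart_chart_at by (auto simp: e_def)
  have ce: "compatible e c" "compatible e d" using c d e by (auto simp: mchart_def)
  define O' where "O' = cdom c \<inter> cdom d \<inter> cdom e"
  have "open O'" using c d e by (auto simp: O'_def mchart_def intro!: open_Int is_chart_open)
  then have oU: "open (cmap c ` O')" using mchart_open_image'[OF c] by (auto simp: O'_def)
  have 1: "Cinf (cmap c ` O') (tr c e)"
    by (rule Cinf_subset[OF compatible_Cinf(2)[OF e(3) mchart_is_chart[OF c] ce(1)] oU]) (auto simp: O'_def)
  have "Cinf (cmap c ` O') (\<lambda>x. tr e d (tr c e x))"
    by (rule Cinf_compose[OF compatible_Cinf(1)[OF e(3) mchart_is_chart[OF d] ce(2)] 1])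
      (use c in \<open>auto simp: O'_def\<close>)
  then have "Cinf (cmap c ` O') (tr c d)"
    by (rule Cinf_cong) (use c e in \<open>auto simp: O'_def\<close>)
  then show "\<exists>U. x \<in> U \<and> U \<subseteq> cmap c ` (cdom c \<inter> cdom d) \<and> Cinf U (tr c d)"
    using p e by (intro exI[of _ "cmap c ` O'"]) (auto simp: O'_def)
qed

lemma tr_differentiable:
  "mchart M c \<Longrightarrow> mchart M d \<Longrightarrow> p \<in> cdom c \<Longrightarrow> p \<in> cdom d \<Longrightarrow> tr c d differentiable at (cmap c p)"
  by (rule Cinf_differentiable[OF tr_Cinf]) auto

lemma FD_tr_compose:
  assumes "mchart M c" "mchart M d" "mchart M e" "p \<in> cdom c" "p \<in> cdom d" "p \<in> cdom e"
  shows "FD (tr d e) (cmap d p) (FD (tr c d) (cmap c p) v) = FD (tr c e) (cmap c p) v"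
proof -
  have "FD (\<lambda>x. tr d e (tr c d x)) (cmap c p) v = FD (tr d e) (cmap d p) (FD (tr c d) (cmap c p) v)"
    using FD_compose[OF tr_differentiable[of c d p], of "tr d e"] tr_differentiable[of d e p] assms by auto
  moreover have "FD (tr c e) (cmap c p) = FD (\<lambda>x. tr d e (tr c d x)) (cmap c p)"
    by (rule FD_cong[OF tr_differentiable mchart_open_image[of c "cdom d \<inter> cdom e"]])
      (use assms in \<open>auto simp: mchart_open\<close>)
  ultimately show ?thesis by simp
qed

lemma FD_tr_self:
  assumes "mchart M c" "p \<in> cdom c"
  shows "FD (tr c c) (cmap c p) v = v"
proof -
  have "FD (tr c c) (cmap c p) = FD (\<lambda>x. x) (cmap c p)"
    by (rule FD_cong[OF tr_differentiable mchart_open_image[of c UNIV]]) (use assms in auto)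
  then show ?thesis by simp
qed

lemma tcoord_FD: "tcoord M d p v = FD (tr (chart_at M p) d) (cmap (chart_at M p) p) v"
  by (simp add: tcoord_def o_def)

lemma tvec_FD: "tvec M d p v = FD (tr d (chart_at M p)) (cmap d p) v"
  by (simp add: tvec_def o_def)

lemma tcoord_chart_at [simp]: "tcoord M (chart_at M p) p v = v"
  by (simp add: tcoord_FD FD_tr_self chart_at)

lemma tcoord_change:
  assumes "mchart M c" "mchart M d" "p \<in> cdom c" "p \<in> cdom d"
  shows "tcoord M d p v = FD (tr c d) (cmap c p) (tcoord M c p v)"
  unfolding tcoord_FD by (rule FD_tr_compose[symmetric]) (use assms chart_at in auto)

lemma tcoord_tvec [simp]: "mchart M c \<Longrightarrow> p \<in> cdom c \<Longrightarrow> tcoord M c p (tvec M c p x) = x"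
  unfolding tcoord_FD tvec_FD by (subst FD_tr_compose) (auto simp: chart_at FD_tr_self)

lemma tvec_tcoord [simp]: "mchart M c \<Longrightarrow> p \<in> cdom c \<Longrightarrow> tvec M c p (tcoord M c p x) = x"
  unfolding tcoord_FD tvec_FD by (subst FD_tr_compose) (auto simp: chart_at FD_tr_self)

lemma linear_tcoord: "mchart M c \<Longrightarrow> p \<in> cdom c \<Longrightarrow> linear (tcoord M c p)"
  unfolding tcoord_FD[abs_def] using Cinf_linear_FD[OF tr_Cinf[of "chart_at M p" c]] chart_at by auto

lemma linear_tvec: "mchart M c \<Longrightarrow> p \<in> cdom c \<Longrightarrow> linear (tvec M c p)"
  unfolding tvec_FD[abs_def] using Cinf_linear_FD[OF tr_Cinf[of c "chart_at M p"]] chart_at by auto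

lemma tcoord_inject:
  "mchart M c \<Longrightarrow> p \<in> cdom c \<Longrightarrow> tcoord M c p x = tcoord M c p y \<longleftrightarrow> x = y"
  by (metis tvec_tcoord)

lemma vrep_at [simp]: "mchart M c \<Longrightarrow> p \<in> cdom c \<Longrightarrow> vrep M c X (cmap c p) = tcoord M c p (X p)"
  by (simp add: vrep_def)

subsection \<open>Smooth functions and vector fields\<close>

lemma fun_change:
  assumes "mchart M c" "mchart M d" "open O'" "O' \<subseteq> cdom c" "Cinf (cmap c ` O') (\<lambda>x. f (cinv c x))"
  shows "Cinf (cmap d ` (cdom d \<inter> O')) (\<lambda>x. f (cinv d x))"
proof -
  have o: "open (cmap d ` (cdom d \<inter> O'))" by (rule mchart_open_image[OF assms(2,3)])
  have t: "Cinf (cmap d ` (cdom d \<inter> O')) (tr d c)"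
    by (rule Cinf_subset[OF tr_Cinf[OF assms(2,1)] o]) (use assms in auto)
  have "Cinf (cmap d ` (cdom d \<inter> O')) (\<lambda>x. f (cinv c (tr d c x)))"
    by (rule Cinf_compose[OF assms(5) t]) (use assms in auto)
  then show ?thesis by (rule Cinf_cong) (use assms in auto)
qed

lemma vrep_change:
  assumes "mchart M c" "mchart M d" "open O'" "O' \<subseteq> cdom c" "Cinf (cmap c ` O') (vrep M c X)"
  shows "Cinf (cmap d ` (cdom d \<inter> O')) (vrep M d X)"
proof -
  have o: "open (cmap d ` (cdom d \<inter> O'))" by (rule mchart_open_image[OF assms(2,3)])
  have t: "Cinf (cmap d ` (cdom d \<inter> O')) (tr d c)"
    by (rule Cinf_subset[OF tr_Cinf[OF assms(2,1)] o]) (use assms in auto)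
  have v: "Cinf (cmap d ` (cdom d \<inter> O')) (\<lambda>x. vrep M c X (tr d c x))"
    by (rule Cinf_compose[OF assms(5) t]) (use assms in auto)
  have "Cinf (cmap d ` (cdom d \<inter> O')) (\<lambda>x. FD (tr c d) (tr d c x) (vrep M c X (tr d c x)))"
    by (rule Cinf_FD_compose[OF tr_Cinf[OF assms(1,2)] t v]) (use assms in auto)
  then show ?thesis
  proof (rule Cinf_cong)
    fix x assume "x \<in> cmap d ` (cdom d \<inter> O')"
    then obtain p where p: "x = cmap d p" "p \<in> cdom d" "p \<in> cdom c" using assms by auto
    then show "FD (tr c d) (tr d c x) (vrep M c X (tr d c x)) = vrep M d X x"
      using tcoord_change[OF assms(1,2), of p] assms by simp
  qed
qed

text \<open>Smoothness is defined by all charts in \<open>M\<close>, but may be checked near each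
  point in a single chart of the maximal atlas; \<open>smooth_fun_Cinf\<close> transfers it back to
  any such chart.\<close>

lemma smooth_funI:
  assumes "\<And>q. \<exists>c O'. mchart M c \<and> open O' \<and> q \<in> O' \<and> O' \<subseteq> cdom c \<and> Cinf (cmap c ` O') (\<lambda>x. f (cinv c x))"
  shows "smooth_fun M f"
  unfolding smooth_fun_def
proof (intro ballI Cinf_smooth_on Cinf_local)
  fix d x assume d: "d \<in> M" and "x \<in> cmap d ` cdom d"
  then obtain q where q: "x = cmap d q" "q \<in> cdom d" by auto
  obtain c O' where c: "mchart M c" "open O'" "q \<in> O'" "O' \<subseteq> cdom c" "Cinf (cmap c ` O') (\<lambda>x. f (cinv c x))"
    using assms by metis
  from fun_change[OF c(1) mchart_atlas[OF d] c(2,4,5)] 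
  show "\<exists>U. x \<in> U \<and> U \<subseteq> cmap d ` cdom d \<and> Cinf U (f \<circ> cinv d)"
    using q c(3) by (intro exI[of _ "cmap d ` (cdom d \<inter> O')"]) (auto simp: o_def)
qed

lemma smooth_fun_Cinf:
  assumes "smooth_fun M f" "mchart M c"
  shows "Cinf (cmap c ` cdom c) (\<lambda>x. f (cinv c x))"
proof (rule Cinf_local)
  fix x assume "x \<in> cmap c ` cdom c"
  then obtain p where p: "x = cmap c p" "p \<in> cdom c" by auto
  let ?d = "chart_at M p"
  have "Cinf (cmap ?d ` cdom ?d) (\<lambda>x. f (cinv ?d x))"
    using assms chart_at[of p] mchart_open_image'[OF mchart_chart_at mchart_open[OF mchart_chart_at[of p]]]
    by (auto simp: smooth_fun_def o_def intro!: smooth_on_Cinf)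
  from fun_change[OF mchart_chart_at assms(2) mchart_open[OF mchart_chart_at] order_refl this]
  show "\<exists>U. x \<in> U \<and> U \<subseteq> cmap c ` cdom c \<and> Cinf U (\<lambda>x. f (cinv c x))"
    using p chart_at[of p] by (intro exI[of _ "cmap c ` (cdom c \<inter> cdom ?d)"]) auto
qed

lemma smooth_vfI:
  assumes "open \<Omega>" "\<And>q. q \<in> \<Omega> \<Longrightarrow> \<exists>c O'. mchart M c \<and> open O' \<and> q \<in> O' \<and> O' \<subseteq> cdom c \<and> Cinf (cmap c ` O') (vrep M c X)"
  shows "smooth_vf_on M \<Omega> X"
  unfolding smooth_vf_on_def vrep_def[symmetric]
proof (intro ballI Cinf_smooth_on Cinf_local)
  fix d x assume d: "d \<in> M" and "x \<in> cmap d ` (cdom d \<inter> \<Omega>)"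
  then obtain q where q: "x = cmap d q" "q \<in> cdom d" "q \<in> \<Omega>" by auto
  obtain c O' where c: "mchart M c" "open O'" "q \<in> O'" "O' \<subseteq> cdom c" "Cinf (cmap c ` O') (vrep M c X)"
    using assms(2)[OF q(3)] by metis
  have "Cinf (cmap c ` (O' \<inter> \<Omega>)) (vrep M c X)"
    by (rule Cinf_subset[OF c(5) mchart_open_image'[OF c(1)]]) (use c assms(1) in auto)
  from vrep_change[OF c(1) mchart_atlas[OF d] _ _ this] c assms(1)
  show "\<exists>U. x \<in> U \<and> U \<subseteq> cmap d ` (cdom d \<inter> \<Omega>) \<and> Cinf U (vrep M d X)"
    using q c(3) by (intro exI[of _ "cmap d ` (cdom d \<inter> (O' \<inter> \<Omega>))"]) auto
qed

lemma smooth_vf_Cinf: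
  assumes "open \<Omega>" "smooth_vf_on M \<Omega> X" "mchart M c"
  shows "Cinf (cmap c ` (cdom c \<inter> \<Omega>)) (vrep M c X)"
proof (rule Cinf_local)
  fix x assume "x \<in> cmap c ` (cdom c \<inter> \<Omega>)"
  then obtain p where p: "x = cmap c p" "p \<in> cdom c" "p \<in> \<Omega>" by auto
  let ?d = "chart_at M p"
  have o: "open (cdom ?d \<inter> \<Omega>)" using mchart_open[of ?d] assms by auto
  have "Cinf (cmap ?d ` (cdom ?d \<inter> \<Omega>)) (vrep M ?d X)"
    using assms chart_at[of p] mchart_open_image'[OF mchart_chart_at o]
    by (auto simp: smooth_vf_on_def vrep_def[symmetric] intro!: smooth_on_Cinf)
  from vrep_change[OF mchart_chart_at assms(3) o _ this]
  show "\<exists>U. x \<in> U \<and> U \<subseteq> cmap c ` (cdom c \<inter> \<Omega>) \<and> Cinf U (vrep M c X)"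
    using p chart_at[of p] by (intro exI[of _ "cmap c ` (cdom c \<inter> (cdom ?d \<inter> \<Omega>))"]) auto
qed

lemma vector_field_Cinf: "X \<in> vector_fields M \<Longrightarrow> mchart M c \<Longrightarrow> Cinf (cmap c ` cdom c) (vrep M c X)"
  using smooth_vf_Cinf[of UNIV X c] by (simp add: vector_fields_def)

lemma smooth_vf_subset: "open \<Omega> \<Longrightarrow> smooth_vf_on M \<Omega> X \<Longrightarrow> open \<Omega>' \<Longrightarrow> \<Omega>' \<subseteq> \<Omega> \<Longrightarrow> smooth_vf_on M \<Omega>' X"
proof (rule smooth_vfI)
  fix q assume "open \<Omega>" "smooth_vf_on M \<Omega> X" "\<Omega>' \<subseteq> \<Omega>" "q \<in> \<Omega>'"
  then show "\<exists>c O'. mchart M c \<and> open O' \<and> q \<in> O' \<and> O' \<subseteq> cdom c \<and> Cinf (cmap c ` O') (vrep M c X)"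
    using smooth_vf_Cinf[of \<Omega> X "chart_at M q"] chart_at[of q] mchart_open[of "chart_at M q"]
    by (intro exI[of _ "chart_at M q"] exI[of _ "cdom (chart_at M q) \<inter> \<Omega>"]) auto
qed

section \<open>Bump functions on the manifold and extension of local objects\<close>

lemma bump_manifold:
  assumes "open \<Omega>" "p \<in> \<Omega>"
  obtains f K O' where "smooth_fun M f" "closed K" "K \<subseteq> \<Omega>" "\<And>q. q \<notin> K \<Longrightarrow> f q = 0"
    "open O'" "p \<in> O'" "\<And>q. q \<in> O' \<Longrightarrow> f q = 1"
proof -
  define c where "c = chart_at M p"
  have c: "mchart M c" "p \<in> cdom c" using chart_at by (auto simp: c_def)
  have "open (cmap c ` (cdom c \<inter> \<Omega>))" using mchart_open_image[OF c(1) assms(1)] .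
  then obtain r where r: "r > 0" "cball (cmap c p) r \<subseteq> cmap c ` (cdom c \<inter> \<Omega>)"
    using c assms(2) by (metis IntI imageI open_contains_cball)
  obtain \<psi> :: "'e \<Rightarrow> real" where \<psi>: "Cinf UNIV \<psi>" "\<And>x. x \<in> ball (cmap c p) (r / 2) \<Longrightarrow> \<psi> x = 1"
    "\<And>x. x \<notin> ball (cmap c p) r \<Longrightarrow> \<psi> x = 0"
    using bump_euclidean[OF r(1), of "cmap c p"] by blast
  define K where "K = cinv c ` cball (cmap c p) r"
  have sub: "cball (cmap c p) r \<subseteq> cmap c ` cdom c" using r(2) by auto
  have "continuous_on (cball (cmap c p) r) (cinv c)"
    by (rule continuous_at_imp_continuous_on) (use sub is_chart_inv_continuous[OF mchart_is_chart[OF c(1)]] in blast)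
  then have "compact K" unfolding K_def by (rule compact_continuous_image) simp
  \<comment> \<open>Here the Hausdorff property enters. Closedness of \<open>K\<close> makes its
    complement an open set on which \<open>f\<close> is zero, so extension by zero beyond the chart
    domain is smooth.\<close>
  then have cK: "closed K" by (rule compact_imp_closed)
  have KO: "K \<subseteq> \<Omega>" "K \<subseteq> cdom c" using r(2) c by (force simp: K_def)+
  define f where "f q = (if q \<in> cdom c then \<psi> (cmap c q) else 0)" for q
  have f0: "f q = 0" if "q \<notin> K" for q
  proof (rule ccontr)
    assume "f q \<noteq> 0"
    then have "q \<in> cdom c" "cmap c q \<in> ball (cmap c p) r" using \<psi>(3) by (auto simp: f_def split: if_splits)
    then have "q \<in> K" unfolding K_def using c by (intro image_eqI[of _ _ "cmap c q"]) auto
    with that show False by simp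
  qed
  have "smooth_fun M f"
  proof (rule smooth_funI)
    fix q
    show "\<exists>c O'. mchart M c \<and> open O' \<and> q \<in> O' \<and> O' \<subseteq> cdom c \<and> Cinf (cmap c ` O') (\<lambda>x. f (cinv c x))"
    proof (cases "q \<in> K")
      case True
      have "Cinf (cmap c ` cdom c) \<psi>"
        by (rule Cinf_subset[OF \<psi>(1)]) (use mchart_open_image'[OF c(1) mchart_open[OF c(1)]] in auto)
      then have "Cinf (cmap c ` cdom c) (\<lambda>x. f (cinv c x))"
        by (rule Cinf_cong) (use c in \<open>auto simp: f_def\<close>)
      then show ?thesis using True KO c(1) mchart_open[OF c(1)] by blast
    next
      case False
      let ?d = "chart_at M q" and ?O = "cdom (chart_at M q) \<inter> - K"
      have o: "open ?O" using cK mchart_open[OF mchart_chart_at, of q] by auto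
      have "Cinf (cmap ?d ` ?O) (\<lambda>x. f (cinv ?d x))"
        by (rule Cinf_cong[OF Cinf_const[of _ 0]]) (use mchart_open_image'[OF mchart_chart_at o] f0 in auto)
      then show ?thesis using o False chart_at[of q] by (intro exI[of _ ?d] exI[of _ ?O]) auto
    qed
  qed
  moreover define O' where "O' = cinv c ` ball (cmap c p) (r/2)"
  have bs: "ball (cmap c p) (r/2) \<subseteq> cmap c ` cdom c" using sub r(1) by force
  have O'eq: "O' = cdom c \<inter> cmap c -` ball (cmap c p) (r/2)"
  proof (intro equalityI subsetI)
    fix q assume "q \<in> O'"
    then obtain x where x: "q = cinv c x" "x \<in> ball (cmap c p) (r/2)" by (auto simp: O'_def)
    then obtain q' where "x = cmap c q'" "q' \<in> cdom c" using bs by blast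
    then show "q \<in> cdom c \<inter> cmap c -` ball (cmap c p) (r/2)" using x c by simp
  next
    fix q assume "q \<in> cdom c \<inter> cmap c -` ball (cmap c p) (r/2)"
    then show "q \<in> O'" unfolding O'_def using c by (intro image_eqI[of _ _ "cmap c q"]) auto
  qed
  have "continuous_on (cdom c) (cmap c)"
    by (rule continuous_at_imp_continuous_on) (use is_chart_continuous[OF mchart_is_chart[OF c(1)]] in blast)
  then have "open O'" unfolding O'eq by (rule continuous_open_preimage) (use mchart_open[OF c(1)] in auto)
  moreover have "p \<in> O'" using c r(1) by (simp add: O'eq)
  moreover have "f q = 1" if "q \<in> O'" for q using that \<psi>(2) by (auto simp: O'eq f_def)
  ultimately show ?thesis using that cK KO(1) f0 by blast
qed

text \<open>On \<open>\<Omega>\<close> the product is smooth because both factors are, off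
  \<open>K\<close> it is zero; these two open regions cover the manifold. The values of
  \<open>X\<close> outside \<open>\<Omega>\<close> may be arbitrary.\<close>

lemma vf_cutoff:
  assumes "open \<Omega>" "smooth_vf_on M \<Omega> X" "smooth_fun M f" "closed K" "K \<subseteq> \<Omega>" "\<And>q. q \<notin> K \<Longrightarrow> f q = 0"
  shows "(\<lambda>q. f q *\<^sub>R X q) \<in> vector_fields M"
  unfolding vector_fields_def mem_Collect_eq
proof (rule smooth_vfI)
  fix q
  let ?d = "chart_at M q"
  have l: "linear (tcoord M ?d q')" if "q' \<in> cdom ?d" for q' using linear_tcoord that by simp
  show "\<exists>c O'. mchart M c \<and> open O' \<and> q \<in> O' \<and> O' \<subseteq> cdom c \<and> Cinf (cmap c ` O') (vrep M c (\<lambda>q. f q *\<^sub>R X q))"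
  proof (cases "q \<in> K")
    case True
    let ?O = "cdom ?d \<inter> \<Omega>"
    have o: "open ?O" using assms mchart_open[OF mchart_chart_at, of q] by auto
    have "Cinf (cmap ?d ` ?O) (\<lambda>x. f (cinv ?d x) *\<^sub>R vrep M ?d X x)"
      by (intro Cinf_scaleR smooth_vf_Cinf assms mchart_chart_at
          Cinf_subset[OF smooth_fun_Cinf[OF assms(3) mchart_chart_at]] mchart_open_image) auto
    then have "Cinf (cmap ?d ` ?O) (vrep M ?d (\<lambda>q. f q *\<^sub>R X q))"
      by (rule Cinf_cong) (use l linear_cmul in \<open>fastforce simp: vrep_def\<close>)
    then show ?thesis using o True assms(5) chart_at[of q] by (intro exI[of _ ?d] exI[of _ ?O]) auto
  next
    case False
    let ?O = "cdom ?d \<inter> - K"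
    have o: "open ?O" using assms mchart_open[OF mchart_chart_at, of q] by auto
    have "Cinf (cmap ?d ` ?O) (vrep M ?d (\<lambda>q. f q *\<^sub>R X q))"
      by (rule Cinf_cong[OF Cinf_const[of _ 0]])
        (use mchart_open_image'[OF mchart_chart_at o] assms(6) linear_0[OF l] in \<open>auto simp: vrep_def\<close>)
    then show ?thesis using o False chart_at[of q] by (intro exI[of _ ?d] exI[of _ ?O]) auto
  qed
qed simp

lemma vf_extend:
  assumes "open \<Omega>" "p \<in> \<Omega>" "smooth_vf_on M \<Omega> X"
  obtains Y O' where "Y \<in> vector_fields M" "open O'" "p \<in> O'" "O' \<subseteq> \<Omega>" "\<And>q. q \<in> O' \<Longrightarrow> Y q = X q"
proof -
  obtain f K O' where f: "smooth_fun M f" "closed K" "K \<subseteq> \<Omega>" "\<And>q. q \<notin> K \<Longrightarrow> f q = 0"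
    "open O'" "p \<in> O'" "\<And>q. q \<in> O' \<Longrightarrow> f q = 1"
    using bump_manifold[OF assms(1,2)] by metis
  show ?thesis
    by (rule that[OF vf_cutoff[OF assms(1,3) f(1-4)], of "O' \<inter> \<Omega>"]) (use f assms in auto)
qed

text \<open>Supplies the existence that the choice in \<open>germ_ext\<close> presupposes.\<close>

lemma germ_ext:
  assumes "open \<Omega>" "p \<in> \<Omega>" "smooth_vf_on M \<Omega> X"
  shows "germ_ext M p X \<in> vector_fields M" "\<forall>\<^sub>F q in nhds p. germ_ext M p X q = X q"
proof -
  obtain Y O' where "Y \<in> vector_fields M" "open O'" "p \<in> O'" "\<And>q. q \<in> O' \<Longrightarrow> Y q = X q"
    using vf_extend[OF assms] by metis
  then have "Y \<in> vector_fields M \<and> (\<forall>\<^sub>F q in nhds p. Y q = X q)" by (auto simp: eventually_nhds)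
  then have "germ_ext M p X \<in> vector_fields M \<and> (\<forall>\<^sub>F q in nhds p. germ_ext M p X q = X q)"
    unfolding germ_ext_def
    by (rule someI[where P="\<lambda>Y. Y \<in> vector_fields M \<and> (\<forall>\<^sub>F q in nhds p. Y q = X q)"])
  then show "germ_ext M p X \<in> vector_fields M" "\<forall>\<^sub>F q in nhds p. germ_ext M p X q = X q" by auto
qed

text \<open>The axioms of a connection accept only globally smooth coefficients, whereas components
  in a chart are local. The cut-off keeps their germ at \<open>p\<close>.\<close>

lemma smooth_fun_extend:
  assumes "mchart M c" "open O'" "O' \<subseteq> cdom c" "p \<in> O'" "Cinf (cmap c ` O') (\<lambda>x. h (cinv c x))"
  obtains f N where "smooth_fun M f" "open N" "p \<in> N" "N \<subseteq> O'" "\<And>q. q \<in> N \<Longrightarrow> f q = h q"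
proof -
  obtain f K N where f: "smooth_fun M f" "closed K" "K \<subseteq> O'" "\<And>q. q \<notin> K \<Longrightarrow> f q = 0"
    "open N" "p \<in> N" "\<And>q. q \<in> N \<Longrightarrow> f q = 1"
    using bump_manifold[OF assms(2,4)] by metis
  have "smooth_fun M (\<lambda>q. f q * h q)"
  proof (rule smooth_funI)
    fix q
    show "\<exists>c O'. mchart M c \<and> open O' \<and> q \<in> O' \<and> O' \<subseteq> cdom c \<and> Cinf (cmap c ` O') (\<lambda>x. f (cinv c x) * h (cinv c x))"
    proof (cases "q \<in> K")
      case True
      have "Cinf (cmap c ` O') (\<lambda>x. f (cinv c x) * h (cinv c x))"
        by (intro Cinf_mult assms(5) Cinf_subset[OF smooth_fun_Cinf[OF f(1) assms(1)]] mchart_open_image')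
          (use assms in auto)
      then show ?thesis using True assms f(3) by blast
    next
      case False
      let ?d = "chart_at M q" and ?O = "cdom (chart_at M q) \<inter> - K"
      have o: "open ?O" using f mchart_open[OF mchart_chart_at, of q] by auto
      have "Cinf (cmap ?d ` ?O) (\<lambda>x. f (cinv ?d x) * h (cinv ?d x))"
        by (rule Cinf_cong[OF Cinf_const[of _ 0]]) (use mchart_open_image'[OF mchart_chart_at o] f(4) in auto)
      then show ?thesis using o False chart_at[of q] by (intro exI[of _ ?d] exI[of _ ?O]) auto
    qed
  qed
  then show ?thesis by (rule that[of _ "N \<inter> O'"]) (use f assms in auto)
qed

lemma coord_field_smooth:
  assumes "mchart M c"
  shows "smooth_vf_on M (cdom c) (\<lambda>q. tvec M c q x)"
proof (rule smooth_vfI)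
  have "Cinf (cmap c ` cdom c) (vrep M c (\<lambda>q. tvec M c q x))"
    by (rule Cinf_cong[OF Cinf_const[of _ x]])
      (use assms mchart_open_image'[OF assms mchart_open[OF assms]] in \<open>auto simp: vrep_def\<close>)
  then show "\<exists>c' O'. mchart M c' \<and> open O' \<and> q \<in> O' \<and> O' \<subseteq> cdom c' \<and> Cinf (cmap c' ` O') (vrep M c' (\<lambda>q. tvec M c q x))"
    if "q \<in> cdom c" for q
    using that assms mchart_open by blast
qed (use assms mchart_open in auto)

lemma vec_ext: "vec_ext M p x \<in> vector_fields M" "vec_ext M p x p = x"
proof -
  let ?c = "chart_at M p"
  obtain Y O' where "Y \<in> vector_fields M" "p \<in> O'" "\<And>q. q \<in> O' \<Longrightarrow> Y q = tvec M ?c q (tcoord M ?c p x)"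
    using vf_extend[OF mchart_open[of ?c] chart_at(2)[of p] coord_field_smooth[of ?c]] mchart_chart_at by metis
  then have "Y \<in> vector_fields M \<and> Y p = x" using chart_at[of p] by (metis mchart_chart_at tvec_tcoord)
  then have "vec_ext M p x \<in> vector_fields M \<and> vec_ext M p x p = x" 
    unfolding vec_ext_def by (rule someI[where P="\<lambda>X. X \<in> vector_fields M \<and> X p = x"])
  then show "vec_ext M p x \<in> vector_fields M" "vec_ext M p x p = x" by auto
qed

lemma vf_smooth_on: "X \<in> vector_fields M \<Longrightarrow> smooth_vf_on M UNIV X"
  by (simp add: vector_fields_def)

lemma vf_scale: "smooth_fun M f \<Longrightarrow> X \<in> vector_fields M \<Longrightarrow> (\<lambda>q. f q *\<^sub>R X q) \<in> vector_fields M"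
  using vf_cutoff[of UNIV X f UNIV] by (simp add: vf_smooth_on)

lemma smooth_fun_const: "smooth_fun M (\<lambda>q. k)"
proof (rule smooth_funI)
  fix q
  show "\<exists>c O'. mchart M c \<and> open O' \<and> q \<in> O' \<and> O' \<subseteq> cdom c \<and> Cinf (cmap c ` O') (\<lambda>x. k)"
    using chart_at[of q] mchart_open[of "chart_at M q"] mchart_open_image'[of "chart_at M q" "cdom (chart_at M q)"]
    by (intro exI[of _ "chart_at M q"] exI[of _ "cdom (chart_at M q)"]) (auto intro: Cinf_const)
qed

lemma vf_add:
  assumes "X \<in> vector_fields M" "Y \<in> vector_fields M"
  shows "(\<lambda>q. X q + Y q) \<in> vector_fields M"
  unfolding vector_fields_def mem_Collect_eq
proof (rule smooth_vfI)
  fix q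
  let ?c = "chart_at M q"
  have "Cinf (cmap ?c ` cdom ?c) (\<lambda>x. vrep M ?c X x + vrep M ?c Y x)"
    by (intro Cinf_add vector_field_Cinf assms mchart_chart_at)
  then have "Cinf (cmap ?c ` cdom ?c) (vrep M ?c (\<lambda>q. X q + Y q))"
    by (rule Cinf_cong) (use linear_add[OF linear_tcoord[OF mchart_chart_at]] in \<open>auto simp: vrep_def\<close>)
  then show "\<exists>c O'. mchart M c \<and> open O' \<and> q \<in> O' \<and> O' \<subseteq> cdom c \<and> Cinf (cmap c ` O') (vrep M c (\<lambda>q. X q + Y q))"
    using chart_at[of q] mchart_open[of ?c] by (intro exI[of _ ?c] exI[of _ "cdom ?c"]) auto
qed simp

lemma vf_zero: "(\<lambda>q. 0) \<in> vector_fields M"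
  using vf_scale[OF smooth_fun_const[of 0] vec_ext(1)] by simp

lemma vf_sum: "(\<And>i. i \<in> I \<Longrightarrow> X i \<in> vector_fields M) \<Longrightarrow> (\<lambda>q. \<Sum>i\<in>I. X i q) \<in> vector_fields M"
  by (induction I rule: infinite_finite_induct) (auto simp: vf_zero vf_add)

text \<open>A single bump function, independent of \<open>u\<close>, serves all fields, so that the
  whole frame consists of coordinate fields on one common neighbourhood \<open>O'\<close>.\<close>

lemma coord_frame:
  assumes "mchart M c" "p \<in> cdom c"
  obtains E O' where "\<And>u. E u \<in> vector_fields M" "open O'" "p \<in> O'" "O' \<subseteq> cdom c"
    "\<And>u q. q \<in> O' \<Longrightarrow> E u q = tvec M c q u"
proof -
  obtain f K O' where f: "smooth_fun M f" "closed K" "K \<subseteq> cdom c" "\<And>q. q \<notin> K \<Longrightarrow> f q = 0"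
    "open O'" "p \<in> O'" "\<And>q. q \<in> O' \<Longrightarrow> f q = 1"
    using bump_manifold[OF mchart_open[OF assms(1)] assms(2)] by metis
  show ?thesis
    by (rule that[of "\<lambda>u q. f q *\<^sub>R tvec M c q u" "O' \<inter> cdom c"])
      (use f vf_cutoff[OF mchart_open[OF assms(1)] coord_field_smooth[OF assms(1)] f(1-4)] assms
        mchart_open[OF assms(1)] in auto)
qed

section \<open>Chart changes of derivatives, brackets and directional derivatives\<close>

lemma FD_vrep_cong:
  assumes c: "mchart M c" "p \<in> cdom c" and ev: "\<forall>\<^sub>F q in nhds p. X q = Y q"
    and d: "vrep M c X differentiable at (cmap c p)"
  shows "FD (vrep M c X) (cmap c p) = FD (vrep M c Y) (cmap c p)"
proof -
  obtain O' where O': "open O'" "p \<in> O'" "\<And>q. q \<in> O' \<Longrightarrow> X q = Y q" using ev unfolding eventually_nhds by blast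
  show ?thesis
    by (rule FD_cong[OF d mchart_open_image[OF c(1) O'(1)]]) (use c O' in \<open>auto simp: vrep_def\<close>)
qed

text \<open>The derivative of the components of a vector field is not tensorial: differentiating the
  transformation law of \<open>X\<close> along \<open>u\<close> produces the Hessian of the
  transition map. This inhomogeneous term cancels in a bracket and is compensated by the Christoffel
  symbols in a connection.\<close>

lemma FD_vrep_change:
  assumes c: "mchart M c" "mchart M d" "p \<in> cdom c" "p \<in> cdom d"
    and X: "open \<Omega>" "p \<in> \<Omega>" "smooth_vf_on M \<Omega> X"
  shows "FD (vrep M d X) (cmap d p) (FD (tr c d) (cmap c p) u) =
    FD (\<lambda>x. FD (tr c d) x (tcoord M c p (X p))) (cmap c p) u + FD (tr c d) (cmap c p) (FD (vrep M c X) (cmap c p) u)"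
proof -
  let ?N = "cmap c ` (cdom c \<inter> (cdom d \<inter> \<Omega>))"
  have oN: "open ?N" using mchart_open_image[OF c(1), of "cdom d \<inter> \<Omega>"] mchart_open[OF c(2)] X by auto
  have dc: "vrep M c X differentiable at (cmap c p)"
    by (rule Cinf_differentiable[OF smooth_vf_Cinf[OF X(1,3) c(1)]]) (use c X in auto)
  have dd: "vrep M d X differentiable at (cmap d p)"
    by (rule Cinf_differentiable[OF smooth_vf_Cinf[OF X(1,3) c(2)]]) (use c X in auto)
  have 1: "((\<lambda>x. FD (tr c d) x (vrep M c X x)) has_derivative
      (\<lambda>u. FD (\<lambda>x. FD (tr c d) x (vrep M c X (cmap c p))) (cmap c p) u
         + FD (tr c d) (cmap c p) (FD (vrep M c X) (cmap c p) u))) (at (cmap c p))"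
    by (rule has_derivative_FD_apply[OF tr_Cinf[OF c(1,2)] _ has_derivative_ident FD_has_derivative[OF dc]]) (use c in auto)
  have 2: "((\<lambda>x. vrep M d X (tr c d x)) has_derivative
      (\<lambda>u. FD (vrep M d X) (cmap d p) (FD (tr c d) (cmap c p) u))) (at (cmap c p))"
    using diff_chain_at[OF FD_has_derivative[OF tr_differentiable[OF c]], of "vrep M d X"]
      FD_has_derivative[OF dd] c by (simp add: o_def)
  have "((\<lambda>x. FD (tr c d) x (vrep M c X x)) has_derivative
      (\<lambda>u. FD (vrep M d X) (cmap d p) (FD (tr c d) (cmap c p) u))) (at (cmap c p))"
    by (rule has_derivative_transform_within_open[OF 2 oN])
      (use c X tcoord_change[OF c(1,2)] in auto)
  from has_derivative_unique[OF this 1] show ?thesis using c by (simp add: fun_eq_iff)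
qed

text \<open>The Hessian terms that \<open>FD_vrep_change\<close> gives for \<open>X\<close> and
  \<open>Y\<close> coincide by symmetry of second derivatives, so the bracket formula of the
  preferred chart holds in every chart.\<close>

lemma lie_bracket_chart:
  assumes c: "mchart M c" "p \<in> cdom c" and X: "X \<in> vector_fields M" and Y: "Y \<in> vector_fields M"
  shows "tcoord M c p (lie_bracket M X Y p) =
    FD (vrep M c Y) (cmap c p) (tcoord M c p (X p)) - FD (vrep M c X) (cmap c p) (tcoord M c p (Y p))"
proof -
  let ?e = "chart_at M p"
  have e: "mchart M ?e" "p \<in> cdom ?e" using chart_at by auto
  have s: "FD (vrep M c Z) (cmap c p) (tcoord M c p u) =
    FD (\<lambda>x. FD (tr ?e c) x (Z p)) (cmap ?e p) u + tcoord M c p (FD (vrep M ?e Z) (cmap ?e p) u)"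
    if "Z \<in> vector_fields M" for Z u
    using FD_vrep_change[OF e(1) c(1) e(2) c(2), of UNIV Z u] that
    by (simp add: vector_fields_def tcoord_FD[of c])
  have "lie_bracket M X Y p = FD (vrep M ?e Y) (cmap ?e p) (X p) - FD (vrep M ?e X) (cmap ?e p) (Y p)"
    by (simp add: lie_bracket_def Let_def vrep_def[abs_def])
  then show ?thesis
    using s[OF X] s[OF Y] linear_diff[OF linear_tcoord[OF c]]
      FD_symmetric[OF tr_Cinf[OF e(1) c(1)], of "cmap ?e p" "X p" "Y p"] e c by simp
qed

lemma dir_deriv_chart:
  assumes "mchart M c" "p \<in> cdom c" "(\<lambda>x. f (cinv c x)) differentiable at (cmap c p)"
  shows "dir_deriv M p v f = FD (\<lambda>x. f (cinv c x)) (cmap c p) (tcoord M c p v)"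
proof -
  let ?e = "chart_at M p"
  have e: "mchart M ?e" "p \<in> cdom ?e" using chart_at by auto
  have t: "tr ?e c differentiable at (cmap ?e p)" by (rule tr_differentiable) (use e assms in auto)
  have d: "((\<lambda>x. f (cinv c (tr ?e c x))) has_derivative
      (\<lambda>v. FD (\<lambda>x. f (cinv c x)) (cmap c p) (FD (tr ?e c) (cmap ?e p) v))) (at (cmap ?e p))"
    using diff_chain_at[OF FD_has_derivative[OF t], of "\<lambda>x. f (cinv c x)"]
      FD_has_derivative[OF assms(3)] e by (simp add: o_def)
  have "((\<lambda>x. f (cinv ?e x)) has_derivative
      (\<lambda>v. FD (\<lambda>x. f (cinv c x)) (cmap c p) (FD (tr ?e c) (cmap ?e p) v))) (at (cmap ?e p))"
    by (rule has_derivative_transform_within_open[OF d mchart_open_image[OF e(1) mchart_open[OF assms(1)]]])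
      (use e assms in auto)
  from FD_eqI[OF this] show ?thesis by (simp add: dir_deriv_def tcoord_FD o_def)
qed

subsection \<open>The tangent bundle in charts\<close>

lemma bundle_image_iff:
  assumes "mchart M c"
  shows "z \<in> bundle_image M c A \<longleftrightarrow> fst z \<in> cmap c ` cdom c \<and> bundle_inv M c z \<in> A"
proof
  assume "z \<in> bundle_image M c A"
  then obtain v where "v \<in> A" "fst v \<in> cdom c" "z = bundle_map M c v" by (auto simp: bundle_image_def)
  then show "fst z \<in> cmap c ` cdom c \<and> bundle_inv M c z \<in> A"
    using assms by (auto simp: bundle_map_def bundle_inv_def)
next
  assume z: "fst z \<in> cmap c ` cdom c \<and> bundle_inv M c z \<in> A"
  then obtain p where p: "fst z = cmap c p" "p \<in> cdom c" by auto
  have "z = bundle_map M c (bundle_inv M c z)"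
    using p assms by (cases z) (simp add: bundle_map_def bundle_inv_def)
  moreover have "fst (bundle_inv M c z) \<in> cdom c" using p assms by (simp add: bundle_inv_def)
  ultimately show "z \<in> bundle_image M c A" using z unfolding bundle_image_def by blast
qed

lemma bundle_inv_map [simp]: "mchart M c \<Longrightarrow> fst v \<in> cdom c \<Longrightarrow> bundle_inv M c (bundle_map M c v) = v"
  by (cases v) (simp add: bundle_map_def bundle_inv_def)

lemma bundle_map_inv: "mchart M c \<Longrightarrow> fst z \<in> cmap c ` cdom c \<Longrightarrow> bundle_map M c (bundle_inv M c z) = z"
  by (cases z) (auto simp: bundle_map_def bundle_inv_def)

lemma fst_bundle_map [simp]: "fst (bundle_map M c v) = cmap c (fst v)"
  by (simp add: bundle_map_def)

lemma snd_bundle_map [simp]: "snd (bundle_map M c v) = tcoord M c (fst v) (snd v)"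
  by (simp add: bundle_map_def)

lemma bundle_map_mem: "mchart M c \<Longrightarrow> v \<in> A \<Longrightarrow> fst v \<in> cdom c \<Longrightarrow> bundle_map M c v \<in> bundle_image M c A"
  by (auto simp: bundle_image_def)

end

section \<open>The local model\<close>

locale finsler_model =
  fixes D :: "('e::euclidean_space \<times> 'e) set" and Lh :: "'e \<times> 'e \<Rightarrow> real"
  assumes Lh_smooth: "Cinf D Lh"
    and cone: "\<And>x v r. (x, v) \<in> D \<Longrightarrow> r > 0 \<Longrightarrow> (x, r *\<^sub>R v) \<in> D"
    and homogeneous: "\<And>x v r. (x, v) \<in> D \<Longrightarrow> r > 0 \<Longrightarrow> Lh (x, r *\<^sub>R v) = r\<^sup>2 * Lh (x, v)"
begin

text \<open>The form \<open>\<ell>\<close> of the overview, introduced as half the fibre derivative;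
  that it equals \<open>fund z (snd z)\<close> is \<open>fund_leg\<close>.\<close>

definition leg :: "'e \<times> 'e \<Rightarrow> 'e \<Rightarrow> real" where
  "leg z w = 1 / 2 * FD Lh z (0, w)"

definition fund :: "'e \<times> 'e \<Rightarrow> 'e \<Rightarrow> 'e \<Rightarrow> real" where
  "fund z u w = 1 / 2 * FD (\<lambda>z. FD Lh z (0, w)) z (0, u)"

lemma leg_smooth: "Cinf D (\<lambda>z. leg z w)"
  unfolding leg_def by (intro Cinf_mult Cinf_const Cinf_FD Lh_smooth Cinf_open[OF Lh_smooth])

lemma fund_smooth: "Cinf D (\<lambda>z. fund z u w)"
  unfolding fund_def by (intro Cinf_mult Cinf_const Cinf_FD Lh_smooth Cinf_open[OF Lh_smooth])

lemma leg_linear: "z \<in> D \<Longrightarrow> linear (leg z)"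
proof -
  assume "z \<in> D"
  then have "linear (FD Lh z)" by (rule Cinf_linear_FD[OF Lh_smooth])
  then have "linear (FD Lh z \<circ> (\<lambda>w. (0, w)))"
    by (rule linear_compose[rotated]) (auto intro!: linearI)
  then show ?thesis
    by (auto intro!: linearI simp: leg_def linear_add[of "FD Lh z \<circ> (\<lambda>w. (0, w))", simplified] distrib_left
        linear_cmul[of "FD Lh z \<circ> (\<lambda>w. (0, w))", simplified])
qed

lemma FD_leg: "z \<in> D \<Longrightarrow> FD (\<lambda>z. leg z w) z (0, b) = fund z b w"
proof -
  assume "z \<in> D"
  then have "((\<lambda>z. leg z w) has_derivative (\<lambda>h. 1 / 2 * FD (\<lambda>z. FD Lh z (0, w)) z h)) (at z)"
    unfolding leg_def by (intro derivative_intros Cinf_has_derivative[OF Cinf_FD[OF Lh_smooth]])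
  from FD_eqI[OF this] show ?thesis by (simp add: fund_def)
qed

lemma fund_linear1: "z \<in> D \<Longrightarrow> linear (\<lambda>u. fund z u w)"
proof -
  assume "z \<in> D"
  then have l: "linear (FD (\<lambda>z. FD Lh z (0, w)) z)" by (rule Cinf_linear_FD[OF Cinf_FD[OF Lh_smooth]])
  have "linear (FD (\<lambda>z. FD Lh z (0, w)) z \<circ> (\<lambda>w. (0, w)))"
    by (rule linear_compose[OF _ l]) (auto intro!: linearI)
  then show ?thesis
    by (auto intro!: linearI simp: fund_def distrib_left linear_add[of "FD _ z \<circ> (\<lambda>w. (0, w))", simplified]
        linear_cmul[of "FD _ z \<circ> (\<lambda>w. (0, w))", simplified])
qed

lemma fund_sym: "z \<in> D \<Longrightarrow> fund z u w = fund z w u"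
  unfolding fund_def using FD_symmetric[OF Lh_smooth, of z "(0, w)" "(0, u)"] by simp

lemma fund_linear2: "z \<in> D \<Longrightarrow> linear (\<lambda>w. fund z u w)"
  using fund_linear1[of z u] fund_sym[of z u] by simp

text \<open>Euler's identity: differentiate the homogeneity relation in the scaling factor
  \<open>r\<close> at \<open>r = 1\<close>.\<close>

lemma euler: 
  assumes "z \<in> D"
  shows "FD Lh z (0, snd z) = 2 * Lh z"
proof -
  have d: "((\<lambda>r. (fst z, r *\<^sub>R snd z)) has_derivative (\<lambda>r. (0, r *\<^sub>R snd z))) (at (1::real))"
    by (auto intro!: derivative_eq_intros)
  have "((\<lambda>r. Lh (fst z, r *\<^sub>R snd z)) has_derivative (\<lambda>r. FD Lh z (0, r *\<^sub>R snd z))) (at 1)"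
    using diff_chain_at[OF d, of Lh] Cinf_has_derivative[OF Lh_smooth assms] by (simp add: o_def)
  moreover have "((\<lambda>r. Lh (fst z, r *\<^sub>R snd z)) has_derivative (\<lambda>r. 2 * r * Lh z)) (at 1)"
  proof (rule has_derivative_transform_within_open)
    show "((\<lambda>r. r\<^sup>2 * Lh z) has_derivative (\<lambda>r. 2 * r * Lh z)) (at 1)"
      by (auto intro!: derivative_eq_intros)
    show "r\<^sup>2 * Lh z = Lh (fst z, r *\<^sub>R snd z)" if "r \<in> {0<..}" for r
      using homogeneous[of "fst z" "snd z" r] assms that by simp
  qed auto
  ultimately show ?thesis using has_derivative_unique by (metis scaleR_one mult_1_right mult.right_neutral)
qed

text \<open>When Euler's identity is differentiated in direction \<open>(0, w)\<close>, the first
  derivative of \<open>Lh\<close> along \<open>w\<close> occurs once on the left, from the moving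
  slot, and twice on the right. The remaining copy equals the second derivative along
  \<open>snd z\<close> and \<open>w\<close>.\<close>

lemma fund_leg:
  assumes "z \<in> D"
  shows "fund z (snd z) w = leg z w"
proof -
  have "((\<lambda>y. FD Lh y (0, snd y)) has_derivative
      (\<lambda>u. FD (\<lambda>y. FD Lh y (0, snd z)) z u + FD Lh z (0, snd u))) (at z)"
    by (rule has_derivative_FD_apply[OF Lh_smooth assms has_derivative_ident])
      (auto intro!: derivative_eq_intros)
  then have "((\<lambda>y. 2 * Lh y) has_derivative
      (\<lambda>u. FD (\<lambda>y. FD Lh y (0, snd z)) z u + FD Lh z (0, snd u))) (at z)"
    by (rule has_derivative_transform_within_open[OF _ Cinf_open[OF Lh_smooth] assms]) (simp add: euler)
  moreover have "((\<lambda>y. 2 * Lh y) has_derivative (\<lambda>u. 2 * FD Lh z u)) (at z)"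
    by (intro derivative_intros Cinf_has_derivative[OF Lh_smooth assms])
  ultimately have "(\<lambda>u. FD (\<lambda>y. FD Lh y (0, snd z)) z u + FD Lh z (0, snd u)) = (\<lambda>u. 2 * FD Lh z u)"
    by (rule has_derivative_unique)
  from fun_cong[OF this, of "(0, w)"] have "fund z w (snd z) = leg z w" by (simp add: fund_def leg_def)
  then show ?thesis using fund_sym[OF assms] by simp
qed

lemma leg_euler: "z \<in> D \<Longrightarrow> leg z (snd z) = Lh z"
  by (simp add: leg_def euler)

lemma has_derivative_leg:
  fixes h :: "'d::real_normed_vector \<Rightarrow> 'e \<times> 'e"
  assumes "h t \<in> D" "(h has_derivative h') (at t within T)" "(Y has_derivative Y') (at t within T)" "t \<in> T"
  shows "((\<lambda>y. leg (h y) (Y y)) has_derivative (\<lambda>u. FD (\<lambda>z. leg z (Y t)) (h t) (h' u) + leg (h t) (Y' u))) (at t within T)"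
proof -
  have "((\<lambda>y. FD Lh (h y) (0, Y y)) has_derivative
      (\<lambda>u. FD (\<lambda>y. FD Lh y (0, Y t)) (h t) (h' u) + FD Lh (h t) (0, Y' u))) (at t within T)"
    by (rule has_derivative_FD_apply[OF Lh_smooth assms(1,2) _ assms(4)]) (auto intro!: derivative_eq_intros assms(3))
  then have "((\<lambda>y. leg (h y) (Y y)) has_derivative
      (\<lambda>u. 1 / 2 * (FD (\<lambda>y. FD Lh y (0, Y t)) (h t) (h' u) + FD Lh (h t) (0, Y' u)))) (at t within T)"
    unfolding leg_def by (rule has_derivative_mult_right)
  moreover have "((\<lambda>z. leg z (Y t)) has_derivative (\<lambda>h'. 1 / 2 * FD (\<lambda>z. FD Lh z (0, Y t)) (h t) h')) (at (h t))"
    unfolding leg_def by (intro derivative_intros Cinf_has_derivative[OF Cinf_FD[OF Lh_smooth]] assms)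
  note e = FD_eqI[OF this]
  ultimately show ?thesis
    by (elim has_derivative_eq_rhs) (simp add: e leg_def[of "h t"] fun_eq_iff)
qed

text \<open>The fibre direction \<open>b\<close> drops out, which is the vanishing of the Cartan
  tensor with the base vector in one slot. The derivative of
  \<open>fund y (snd y) w = leg y w\<close> splits into the derivative with frozen slot and
  \<open>fund z b w\<close>, and the latter is exactly the fibre part of the derivative of
  \<open>leg\<close>.\<close>

lemma FD_fund_snd:
  assumes "z \<in> D"
  shows "FD (\<lambda>y. fund y (snd z) w) z (a, b) = FD (\<lambda>y. leg y w) z (a, 0)"
proof -
  have c: "Cinf D (\<lambda>z. FD Lh z (0, w))" by (rule Cinf_FD[OF Lh_smooth])
  have "((\<lambda>y. FD (\<lambda>z. FD Lh z (0, w)) y (0, snd y)) has_derivative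
      (\<lambda>u. FD (\<lambda>y. FD (\<lambda>z. FD Lh z (0, w)) y (0, snd z)) z u + FD (\<lambda>z. FD Lh z (0, w)) z (0, snd u))) (at z)"
    by (rule has_derivative_FD_apply[OF c assms has_derivative_ident])
      (auto intro!: derivative_eq_intros)
  then have "((\<lambda>y. fund y (snd y) w) has_derivative
      (\<lambda>u. 1 / 2 * (FD (\<lambda>y. FD (\<lambda>z. FD Lh z (0, w)) y (0, snd z)) z u + FD (\<lambda>z. FD Lh z (0, w)) z (0, snd u)))) (at z)"
    unfolding fund_def by (rule has_derivative_mult_right)
  then have 1: "((\<lambda>y. leg y w) has_derivative
      (\<lambda>u. 1 / 2 * (FD (\<lambda>y. FD (\<lambda>z. FD Lh z (0, w)) y (0, snd z)) z u + FD (\<lambda>z. FD Lh z (0, w)) z (0, snd u)))) (at z)"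
    by (rule has_derivative_transform_within_open[OF _ Cinf_open[OF Lh_smooth] assms]) (simp add: fund_leg)
  have 2: "((\<lambda>y. fund y (snd z) w) has_derivative (\<lambda>u. 1 / 2 * FD (\<lambda>y. FD (\<lambda>z. FD Lh z (0, w)) y (0, snd z)) z u)) (at z)"
    unfolding fund_def by (intro derivative_intros Cinf_has_derivative[OF Cinf_FD[OF c] assms])
  have "linear (FD (\<lambda>y. leg y w) z)" by (rule Cinf_linear_FD[OF leg_smooth assms])
  then have "FD (\<lambda>y. leg y w) z (a, b) = FD (\<lambda>y. leg y w) z (a, 0) + FD (\<lambda>y. leg y w) z (0, b)"
    using linear_add[of "FD (\<lambda>y. leg y w) z" "(a, 0)" "(0, b)"] by simp
  then show ?thesis
    using fun_cong[OF FD_eqI[OF 1], of "(a, b)"] fun_cong[OF FD_eqI[OF 2], of "(a, b)"] FD_leg[OF assms, of w b]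
    by (simp add: fund_def)
qed

end

text \<open>The assumption \<open>metric\<close> is the coordinate form of (nabla_u g)_v(v, w) = 0.
  Its fibre component \<open>- \<Gamma> z u (snd z)\<close> is the vertical correction in the
  derivative of an anisotropic function; together with \<open>u\<close> it forms the horizontal lift
  of \<open>u\<close>.\<close>

locale finsler_connection_model = finsler_model D Lh
  for D :: "('e::euclidean_space \<times> 'e) set" and Lh +
  fixes \<Gamma> :: "'e \<times> 'e \<Rightarrow> 'e \<Rightarrow> 'e \<Rightarrow> 'e"
  assumes Gam_smooth: "\<And>u w. Cinf D (\<lambda>z. \<Gamma> z u w)"
    and Gam_linear1: "\<And>z w. linear (\<lambda>u. \<Gamma> z u w)"
    and Gam_linear2: "\<And>z u. linear (\<lambda>w. \<Gamma> z u w)"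
    and Gam_sym: "\<And>z u w. z \<in> D \<Longrightarrow> \<Gamma> z u w = \<Gamma> z w u"
    and metric: "\<And>z u w. z \<in> D \<Longrightarrow>
      FD (\<lambda>y. fund y (snd z) w) z (u, - \<Gamma> z u (snd z)) = fund z (\<Gamma> z u (snd z)) w + fund z (snd z) (\<Gamma> z u w)"
begin

text \<open>Smoothness is assumed for fixed arguments of \<open>\<Gamma>\<close> only; moving
  arguments are reduced to basis vectors by this expansion.\<close>

lemma Gam_expand: "\<Gamma> z u w = (\<Sum>i\<in>Basis. \<Sum>j\<in>Basis. ((u \<bullet> i) * (w \<bullet> j)) *\<^sub>R \<Gamma> z i j)"
proof -
  have "\<Gamma> z u w = (\<Sum>i\<in>Basis. (u \<bullet> i) *\<^sub>R \<Gamma> z i w)" by (rule linear_euclidean_sum[OF Gam_linear1])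
  also have "\<dots> = (\<Sum>i\<in>Basis. (u \<bullet> i) *\<^sub>R (\<Sum>j\<in>Basis. (w \<bullet> j) *\<^sub>R \<Gamma> z i j))"
    by (subst linear_euclidean_sum[OF Gam_linear2]) simp
  finally show ?thesis by (simp add: scaleR_sum_right)
qed

lemma has_derivative_Gam:
  fixes h :: "'d::real_normed_vector \<Rightarrow> 'e \<times> 'e"
  assumes h: "h t \<in> D" "(h has_derivative h') (at t within T)"
    and X: "(X has_derivative X') (at t within T)" and Y: "(Y has_derivative Y') (at t within T)"
  shows "((\<lambda>y. \<Gamma> (h y) (X y) (Y y)) has_derivative
    (\<lambda>k. FD (\<lambda>z. \<Gamma> z (X t) (Y t)) (h t) (h' k) + \<Gamma> (h t) (X' k) (Y t) + \<Gamma> (h t) (X t) (Y' k))) (at t within T)"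
proof -
  have g: "((\<lambda>z. \<Gamma> z i j) has_derivative FD (\<lambda>z. \<Gamma> z i j) (h t)) (at (h t))" for i j
    by (rule Cinf_has_derivative[OF Gam_smooth h(1)])
  have gh: "((\<lambda>y. \<Gamma> (h y) i j) has_derivative (\<lambda>k. FD (\<lambda>z. \<Gamma> z i j) (h t) (h' k))) (at t within T)" for i j
    using diff_chain_within[OF h(2) has_derivative_at_withinI[OF g]] by (simp add: o_def)
  have "((\<lambda>z. \<Gamma> z (X t) (Y t)) has_derivative
      (\<lambda>k. \<Sum>i\<in>Basis. \<Sum>j\<in>Basis. ((X t \<bullet> i) * (Y t \<bullet> j)) *\<^sub>R FD (\<lambda>z. \<Gamma> z i j) (h t) k)) (at (h t))"
    by (subst Gam_expand[abs_def]) (auto intro!: derivative_eq_intros g)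
  note e = FD_eqI[OF this]
  have "((\<lambda>y. \<Sum>i\<in>Basis. \<Sum>j\<in>Basis. ((X y \<bullet> i) * (Y y \<bullet> j)) *\<^sub>R \<Gamma> (h y) i j) has_derivative
      (\<lambda>k. \<Sum>i\<in>Basis. \<Sum>j\<in>Basis. ((X t \<bullet> i) * (Y t \<bullet> j)) *\<^sub>R FD (\<lambda>z. \<Gamma> z i j) (h t) (h' k)
        + ((X t \<bullet> i) * (Y' k \<bullet> j) + (X' k \<bullet> i) * (Y t \<bullet> j)) *\<^sub>R \<Gamma> (h t) i j)) (at t within T)"
    by (intro derivative_intros gh X Y)
  moreover have "(\<Sum>i\<in>Basis. \<Sum>j\<in>Basis. ((X t \<bullet> i) * (Y t \<bullet> j)) *\<^sub>R FD (\<lambda>z. \<Gamma> z i j) (h t) (h' k)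
        + ((X t \<bullet> i) * (Y' k \<bullet> j) + (X' k \<bullet> i) * (Y t \<bullet> j)) *\<^sub>R \<Gamma> (h t) i j) =
     FD (\<lambda>z. \<Gamma> z (X t) (Y t)) (h t) (h' k) + \<Gamma> (h t) (X' k) (Y t) + \<Gamma> (h t) (X t) (Y' k)" for k
    unfolding e Gam_expand[of "h t" "X' k" "Y t"] Gam_expand[of "h t" "X t" "Y' k"]
    by (simp add: sum.distrib scaleR_add_left)
  ultimately show ?thesis unfolding Gam_expand[symmetric] by simp
qed

lemma leg_Cinf:
  assumes "Cinf U h" "Cinf U Y" "\<And>y. y \<in> U \<Longrightarrow> h y \<in> D"
  shows "Cinf U (\<lambda>y. leg (h y) (Y y))"
  unfolding leg_def
  by (intro Cinf_mult Cinf_const Cinf_open[OF assms(1)] Cinf_FD_compose[OF Lh_smooth] Cinf_Pair assms)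

lemma Gam_Cinf:
  assumes "Cinf U h" "Cinf U X" "Cinf U Y" "\<And>y. y \<in> U \<Longrightarrow> h y \<in> D"
  shows "Cinf U (\<lambda>y. \<Gamma> (h y) (X y) (Y y))"
  by (subst Gam_expand)
    (intro Cinf_sum Cinf_scaleR Cinf_mult Cinf_inner Cinf_const Cinf_open[OF assms(1)] Cinf_compose[OF Gam_smooth] assms)

text \<open>\<open>FD_fund_snd\<close> discards the fibre component on the left of
  \<open>metric\<close>, and \<open>fund_leg\<close> rewrites the last term on its right.\<close>

lemma FD_leg_base:
  assumes "z \<in> D"
  shows "FD (\<lambda>y. leg y w) z (u, 0) = fund z (\<Gamma> z u (snd z)) w + leg z (\<Gamma> z u w)"
  using metric[OF assms, of w u] FD_fund_snd[OF assms, of w u] fund_leg[OF assms] by simp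

lemma FD_leg_full:
  assumes "z \<in> D"
  shows "FD (\<lambda>y. leg y w) z (u, b) = fund z (b + \<Gamma> z u (snd z)) w + leg z (\<Gamma> z u w)"
proof -
  have "linear (FD (\<lambda>y. leg y w) z)" by (rule Cinf_linear_FD[OF leg_smooth assms])
  then have "FD (\<lambda>y. leg y w) z (u, b) = FD (\<lambda>y. leg y w) z (u, 0) + FD (\<lambda>y. leg y w) z (0, b)"
    using linear_add[of "FD (\<lambda>y. leg y w) z" "(u, 0)" "(0, b)"] by simp
  then show ?thesis
    using FD_leg_base[OF assms] FD_leg[OF assms] linear_add[OF fund_linear1[OF assms]] by simp
qed

text \<open>Equivalently, \<open>Lh\<close> is constant along horizontal directions. Since
  \<open>Lh\<close> is \<open>leg y (snd y)\<close>, its derivative is given by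
  \<open>FD_leg_base\<close> with \<open>w = snd z\<close>, whose two terms agree by symmetry of
  \<open>fund\<close>; hence the factor 2.\<close>

lemma FD_Lh_base:
  assumes "z \<in> D"
  shows "FD Lh z (u, 0) = 2 * leg z (\<Gamma> z u (snd z))"
proof -
  have "((\<lambda>y. leg y (snd y)) has_derivative (\<lambda>h. FD (\<lambda>y. leg y (snd z)) z h + leg z (snd h))) (at z)"
    by (rule has_derivative_leg[OF assms has_derivative_ident]) (auto intro!: derivative_eq_intros)
  then have "(Lh has_derivative (\<lambda>h. FD (\<lambda>y. leg y (snd z)) z h + leg z (snd h))) (at z)"
    by (rule has_derivative_transform_within_open[OF _ Cinf_open[OF Lh_smooth] assms]) (simp add: leg_euler)
  from FD_eqI[OF this] show ?thesis
    using FD_leg_base[OF assms, of "snd z" u] linear_0[OF leg_linear[OF assms]] fund_leg[OF assms]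
      fund_sym[OF assms, of _ "snd z"] by simp
qed

text \<open>This removes the Landsberg-type term from the second variation.\<close>

lemma leg_vertical_Gam:
  assumes "z \<in> D"
  shows "leg z (FD (\<lambda>y. \<Gamma> y u (snd z)) z (0, b)) = 0"
proof -
  have G: "((\<lambda>y. \<Gamma> y u (snd y)) has_derivative
      (\<lambda>h. FD (\<lambda>y. \<Gamma> y u (snd z)) z h + \<Gamma> z 0 (snd z) + \<Gamma> z u (snd h))) (at z)"
    by (rule has_derivative_Gam[where h="\<lambda>y. y" and X="\<lambda>y. u" and Y=snd])
      (use assms in \<open>auto intro!: derivative_eq_intros\<close>)
  have "((\<lambda>y. leg y (\<Gamma> y u (snd y))) has_derivative
      (\<lambda>h. FD (\<lambda>y. leg y (\<Gamma> z u (snd z))) z h +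
        leg z (FD (\<lambda>y. \<Gamma> y u (snd z)) z h + \<Gamma> z 0 (snd z) + \<Gamma> z u (snd h)))) (at z)"
    by (rule has_derivative_leg[OF assms has_derivative_ident G]) simp
  then have "((\<lambda>y. FD Lh y (u, 0)) has_derivative
      (\<lambda>h. 2 * (FD (\<lambda>y. leg y (\<Gamma> z u (snd z))) z h +
        leg z (FD (\<lambda>y. \<Gamma> y u (snd z)) z h + \<Gamma> z 0 (snd z) + \<Gamma> z u (snd h))))) (at z)"
    by (intro has_derivative_transform_within_open[OF has_derivative_mult_right Cinf_open[OF Lh_smooth] assms])
      (auto simp: FD_Lh_base)
  \<comment> \<open>The mixed derivative of \<open>Lh\<close> in the base direction \<open>u\<close>
    and the fibre direction \<open>b\<close>, here from \<open>FD_Lh_base\<close> and below from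
    \<open>FD_leg_base\<close>. The results agree by symmetry, and everything except the vertical
    derivative of \<open>\<Gamma>\<close> cancels.\<close>
  from FD_eqI[OF this] have "FD (\<lambda>y. FD Lh y (u, 0)) z (0, b) =
      2 * (fund z b (\<Gamma> z u (snd z)) + (leg z (FD (\<lambda>y. \<Gamma> y u (snd z)) z (0, b)) + leg z (\<Gamma> z u b)))"
    using FD_leg[OF assms] linear_add[OF leg_linear[OF assms]] linear_0[OF Gam_linear1] by simp
  moreover have "FD (\<lambda>y. FD Lh y (u, 0)) z (0, b) = 2 * (fund z (\<Gamma> z u (snd z)) b + leg z (\<Gamma> z u b))"
  proof -
    have "((\<lambda>y. leg y b) has_derivative (\<lambda>h. 1 / 2 * FD (\<lambda>z. FD Lh z (0, b)) z h)) (at z)"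
      unfolding leg_def by (intro derivative_intros Cinf_has_derivative[OF Cinf_FD[OF Lh_smooth]] assms)
    from FD_eqI[OF this] show ?thesis
      using FD_leg_base[OF assms, of b u] FD_symmetric[OF Lh_smooth assms, of "(u, 0)" "(0, b)"] by simp
  qed
  ultimately show ?thesis using fund_sym[OF assms, of b] by simp
qed

text \<open>The parameter space is arbitrary: for a variation the direction \<open>k\<close> is
  \<open>(1, 0)\<close> or \<open>(0, 1)\<close>, so that one rule gives the derivatives along
  \<open>t\<close> and along \<open>s\<close>.\<close>

lemma has_derivative_leg_along:
  fixes F V Y :: "'d::real_normed_vector \<Rightarrow> 'e"
  assumes z: "(F t, V t) \<in> D" and d: "(F has_derivative F') (at t within T)" "(V has_derivative V') (at t within T)"
    "(Y has_derivative Y') (at t within T)" "t \<in> T"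
  shows "((\<lambda>t. leg (F t, V t) (Y t)) has_derivative
    (\<lambda>k. fund (F t, V t) (V' k + \<Gamma> (F t, V t) (F' k) (V t)) (Y t)
       + leg (F t, V t) (Y' k + \<Gamma> (F t, V t) (F' k) (Y t)))) (at t within T)"
proof -
  have "((\<lambda>t. leg (F t, V t) (Y t)) has_derivative
      (\<lambda>k. FD (\<lambda>z. leg z (Y t)) (F t, V t) (F' k, V' k) + leg (F t, V t) (Y' k))) (at t within T)"
    by (rule has_derivative_leg[OF z has_derivative_Pair[OF d(1,2)] d(3,4)])
  then show ?thesis
    using FD_leg_full[OF z] linear_add[OF leg_linear[OF z]] by (simp add: algebra_simps)
qed

lemma has_derivative_Lh_along:
  fixes F V :: "'d::real_normed_vector \<Rightarrow> 'e"
  assumes z: "(F t, V t) \<in> D" and d: "(F has_derivative F') (at t within T)" "(V has_derivative V') (at t within T)"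
  shows "((\<lambda>t. Lh (F t, V t)) has_derivative
    (\<lambda>k. 2 * leg (F t, V t) (V' k + \<Gamma> (F t, V t) (F' k) (V t)))) (at t within T)"
proof -
  have "((\<lambda>t. Lh (F t, V t)) has_derivative (\<lambda>k. FD Lh (F t, V t) (F' k, V' k))) (at t within T)"
    using diff_chain_within[OF has_derivative_Pair[OF d] has_derivative_at_withinI[OF Cinf_has_derivative[OF Lh_smooth z]]]
    by (simp add: o_def)
  moreover have "FD Lh (F t, V t) (a, b) = 2 * leg (F t, V t) (b + \<Gamma> (F t, V t) a (V t))" for a b
    using linear_add[OF Cinf_linear_FD[OF Lh_smooth z], of "(a, 0)" "(0, b)"] FD_Lh_base[OF z, of a]
      linear_add[OF leg_linear[OF z], of b] by (simp add: leg_def[of _ b])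
  ultimately show ?thesis by simp
qed

text \<open>Since \<open>(x, - \<Gamma> z x (snd z))\<close> is the horizontal lift of
  \<open>x\<close>, this is the classical expression built from derivatives and products of
  Christoffel symbols, with horizontal derivatives. It is the curvature on fields with constant
  components, whose bracket vanishes; \<open>curvature_chart\<close> proves the agreement in
  general.\<close>

definition curv :: "'e \<times> 'e \<Rightarrow> 'e \<Rightarrow> 'e \<Rightarrow> 'e \<Rightarrow> 'e" where
  "curv z x y w =
     (FD (\<lambda>z. \<Gamma> z y w) z (x, - \<Gamma> z x (snd z)) + \<Gamma> z x (\<Gamma> z y w))
     - (FD (\<lambda>z. \<Gamma> z x w) z (y, - \<Gamma> z y (snd z)) + \<Gamma> z y (\<Gamma> z x w))"

section \<open>Variation identities for a map of two parameters in coordinates\<close>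

context
  fixes U :: "(real \<times> real) set" and F V W :: "real \<times> real \<Rightarrow> 'e" and \<zeta> :: "real \<times> real \<Rightarrow> 'e \<times> 'e"
  assumes F: "Cinf U F"
    and V_def: "V = (\<lambda>y. FD F y (1, 0))" and W_def: "W = (\<lambda>y. FD F y (0, 1))"
    and \<zeta>_def: "\<zeta> = (\<lambda>y. (F y, V y))"
    and in_D: "\<And>y. y \<in> U \<Longrightarrow> \<zeta> y \<in> D"
begin

lemma VW_smooth: "Cinf U V" "Cinf U W"
  unfolding V_def W_def by (intro Cinf_FD F)+

lemma VW_mixed: "y \<in> U \<Longrightarrow> FD W y (1, 0) = FD V y (0, 1)"
  unfolding V_def W_def by (rule FD_symmetric[OF F])

lemma variation_derivs:
  assumes "y \<in> U"
  shows "(F has_derivative FD F y) (at y)" "(V has_derivative FD V y) (at y)" "(W has_derivative FD W y) (at y)"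
    "(\<zeta> has_derivative (\<lambda>h. (FD F y h, FD V y h))) (at y)"
proof -
  show "(F has_derivative FD F y) (at y)" "(V has_derivative FD V y) (at y)" "(W has_derivative FD W y) (at y)"
    using Cinf_has_derivative F VW_smooth assms by blast+
  then show "(\<zeta> has_derivative (\<lambda>h. (FD F y h, FD V y h))) (at y)"
    unfolding \<zeta>_def by (intro has_derivative_Pair)
qed

lemma energy_density_deriv:
  assumes "y \<in> U"
  shows "FD (\<lambda>y. Lh (\<zeta> y)) y (0, 1) = 2 * leg (\<zeta> y) (FD V y (0, 1) + \<Gamma> (\<zeta> y) (W y) (V y))"
  using FD_eqI[OF has_derivative_Lh_along[OF in_D[OF assms, unfolded \<zeta>_def] variation_derivs(1,2)[OF assms]]]
  by (simp add: \<zeta>_def W_def)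

text \<open>The product rule for \<open>leg\<close> along \<open>t\<close>. The covariant
  \<open>t\<close>-derivative of \<open>W\<close> is the covariant \<open>s\<close>-derivative of
  \<open>V\<close>, by equality of mixed partials and symmetry of \<open>\<Gamma>\<close>, so
  \<open>leg\<close> of it is half the \<open>s\<close>-derivative of the energy density.\<close>

lemma first_variation_identity:
  assumes "y \<in> U"
  shows "FD (\<lambda>y. leg (\<zeta> y) (W y)) y (1, 0) =
    1 / 2 * FD (\<lambda>y. Lh (\<zeta> y)) y (0, 1) + fund (\<zeta> y) (FD V y (1, 0) + \<Gamma> (\<zeta> y) (V y) (V y)) (W y)"
proof -
  have "FD (\<lambda>y. leg (\<zeta> y) (W y)) y (1, 0) =
     fund (\<zeta> y) (FD V y (1, 0) + \<Gamma> (\<zeta> y) (V y) (V y)) (W y) + leg (\<zeta> y) (FD W y (1, 0) + \<Gamma> (\<zeta> y) (V y) (W y))"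
    using FD_eqI[OF has_derivative_leg_along[OF in_D[OF assms, unfolded \<zeta>_def] variation_derivs(1-3)[OF assms]]]
    by (simp add: \<zeta>_def V_def)
  then show ?thesis
    using energy_density_deriv[OF assms] VW_mixed[OF assms] Gam_sym[OF in_D[OF assms]] by simp
qed

text \<open>\<open>DW\<close> is also the covariant \<open>s\<close>-derivative of the velocity, so
  the product rule along \<open>s\<close> gives \<open>fund (\<zeta> y) DW DW\<close> plus
  \<open>leg\<close> of a second covariant derivative. Commuting the latter yields the curvature and
  a defect \<open>P\<close>. The geodesic equation acts twice: it removes the pairing of the
  acceleration with \<open>Z\<close>, and it makes the velocity lift horizontal along
  \<open>t\<close>.\<close>

lemma second_variation_identity:
  assumes y: "y \<in> U" and geo: "FD V y (1, 0) + \<Gamma> (\<zeta> y) (V y) (V y) = 0"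
  defines "DW \<equiv> FD W y (1, 0) + \<Gamma> (\<zeta> y) (V y) (W y)"
  shows "FD (\<lambda>y. leg (\<zeta> y) (FD V y (0, 1) + \<Gamma> (\<zeta> y) (W y) (V y))) y (0, 1) =
    fund (\<zeta> y) DW DW - leg (\<zeta> y) (curv (\<zeta> y) (V y) (W y) (W y))
    + FD (\<lambda>y. leg (\<zeta> y) (FD W y (0, 1) + \<Gamma> (\<zeta> y) (W y) (W y))) y (1, 0)"
proof -
  define Y where "Y = (\<lambda>y. FD V y (0, 1) + \<Gamma> (\<zeta> y) (W y) (V y))"
  define Z where "Z = (\<lambda>y. FD W y (0, 1) + \<Gamma> (\<zeta> y) (W y) (W y))"
  let ?z = "\<zeta> y"
  note zD = in_D[OF y] and ds = variation_derivs[OF y]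
  have sndz: "snd (\<zeta> y) = V y" by (simp add: \<zeta>_def)
  have FV: "FD F y (1, 0) = V y" "FD F y (0, 1) = W y" by (simp_all add: V_def W_def)
  have l1: "linear (\<lambda>u. \<Gamma> ?z u w)" and l2: "linear (\<lambda>w. \<Gamma> ?z u w)" for u w
    by (rule Gam_linear1 Gam_linear2)+
  have Yd: "(Y has_derivative (\<lambda>k. FD (\<lambda>y. FD V y (0, 1)) y k + (FD (\<lambda>z. \<Gamma> z (W y) (V y)) ?z (FD F y k, FD V y k)
      + \<Gamma> ?z (FD W y k) (V y) + \<Gamma> ?z (W y) (FD V y k)))) (at y)"
    unfolding Y_def
    by (intro has_derivative_add Cinf_has_derivative[OF Cinf_FD[OF VW_smooth(1)] y] has_derivative_Gam[OF zD ds(4,3,2)])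
  have Zd: "(Z has_derivative (\<lambda>k. FD (\<lambda>y. FD W y (0, 1)) y k + (FD (\<lambda>z. \<Gamma> z (W y) (W y)) ?z (FD F y k, FD V y k)
      + \<Gamma> ?z (FD W y k) (W y) + \<Gamma> ?z (W y) (FD W y k)))) (at y)"
    unfolding Z_def
    by (intro has_derivative_add Cinf_has_derivative[OF Cinf_FD[OF VW_smooth(2)] y] has_derivative_Gam[OF zD ds(4,3,3)])
  \<comment> \<open>Equality of the third partial derivatives of \<open>F\<close>, once along
    \<open>t\<close> and twice along \<open>s\<close>, taken in two orders.\<close>
  have third: "FD (\<lambda>y. FD V y (0, 1)) y (0, 1) = FD (\<lambda>y. FD W y (0, 1)) y (1, 0)"
  proof -
    have "FD (\<lambda>y. FD V y (0, 1)) y = FD (\<lambda>y. FD W y (1, 0)) y"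
      by (rule FD_cong[OF Cinf_differentiable[OF Cinf_FD[OF VW_smooth(1)] y] Cinf_open[OF F] y])
        (simp add: VW_mixed)
    then show ?thesis using FD_symmetric[OF VW_smooth(2) y, of "(1, 0)" "(0, 1)"] by simp
  qed
  have YDW: "Y y = DW"
    using VW_mixed[OF y] Gam_sym[OF zD, of "W y" "V y"] by (simp add: Y_def DW_def)
  have lhs: "FD (\<lambda>y. leg (\<zeta> y) (Y y)) y (0, 1) =
      fund ?z (FD V y (0, 1) + \<Gamma> ?z (W y) (V y)) (Y y) + leg ?z (FD Y y (0, 1) + \<Gamma> ?z (W y) (Y y))"
    using FD_eqI[OF has_derivative_leg_along[OF zD[unfolded \<zeta>_def] ds(1,2) Yd]] FD_eqI[OF Yd] FV by (simp add: \<zeta>_def)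
  have rhs: "FD (\<lambda>y. leg (\<zeta> y) (Z y)) y (1, 0) =
      fund ?z (FD V y (1, 0) + \<Gamma> ?z (V y) (V y)) (Z y) + leg ?z (FD Z y (1, 0) + \<Gamma> ?z (V y) (Z y))"
    using FD_eqI[OF has_derivative_leg_along[OF zD[unfolded \<zeta>_def] ds(1,2) Zd]] FD_eqI[OF Zd] FV by (simp add: \<zeta>_def)
  have f0: "fund ?z 0 x = 0" for x using linear_0[OF fund_linear1[OF zD]] .
  have lin: "linear (FD (\<lambda>z. \<Gamma> z a b) ?z)" for a b by (rule Cinf_linear_FD[OF Gam_smooth zD])
  \<comment> \<open>Along \<open>s\<close> the velocity lift is not horizontal: its fibre derivative
    exceeds that of the horizontal lift of \<open>W y\<close> by the covariant derivative
    \<open>Y y\<close>. \<open>P\<close> is the effect of this excess on \<open>\<Gamma>\<close>. It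
    is killed by \<open>leg_vertical_Gam\<close>, which applies because the last argument of
    \<open>\<Gamma>\<close> is the base vector \<open>V y\<close>.\<close>
  define P where "P = FD (\<lambda>z. \<Gamma> z (W y) (V y)) ?z (0, FD V y (0, 1) + \<Gamma> ?z (W y) (V y))"
  have P0: "leg ?z P = 0"
    unfolding P_def using leg_vertical_Gam[OF zD, of "W y"] by (simp add: sndz)
  have sym: "FD (\<lambda>z. \<Gamma> z (V y) (W y)) ?z = FD (\<lambda>z. \<Gamma> z (W y) (V y)) ?z"
    by (rule FD_cong[OF Cinf_differentiable[OF Gam_smooth zD] Cinf_open[OF Lh_smooth] zD]) (rule Gam_sym)
  have split: "FD (\<lambda>z. \<Gamma> z a b) ?z (x, c) = FD (\<lambda>z. \<Gamma> z a b) ?z (x, d) + FD (\<lambda>z. \<Gamma> z a b) ?z (0, c - d)" for a b x c d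
    using linear_add[OF lin, of a b "(x, d)" "(0, c - d)"] by simp
  \<comment> \<open>Along \<open>t\<close> the geodesic equation makes the lift horizontal, so no
    such defect arises there.\<close>
  have Vt: "FD V y (1, 0) = - \<Gamma> ?z (V y) (V y)" using geo by (simp add: eq_neg_iff_add_eq_0)
  have "FD Y y (0, 1) + \<Gamma> ?z (W y) (Y y) =
      FD (\<lambda>y. FD W y (0, 1)) y (1, 0) + FD (\<lambda>z. \<Gamma> z (W y) (V y)) ?z (W y, - \<Gamma> ?z (W y) (V y)) + P
      + \<Gamma> ?z (FD W y (0, 1)) (V y) + \<Gamma> ?z (W y) (FD V y (0, 1)) + \<Gamma> ?z (W y) (FD V y (0, 1))
      + \<Gamma> ?z (W y) (\<Gamma> ?z (W y) (V y))"
    using FD_eqI[OF Yd] split[of "W y" "V y" "W y" "FD V y (0, 1)" "- \<Gamma> ?z (W y) (V y)"]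
    by (simp add: third FV P_def Y_def linear_add[OF l2])
  moreover have "FD Z y (1, 0) + \<Gamma> ?z (V y) (Z y) =
      FD (\<lambda>y. FD W y (0, 1)) y (1, 0) + FD (\<lambda>z. \<Gamma> z (W y) (W y)) ?z (V y, - \<Gamma> ?z (V y) (V y))
      + \<Gamma> ?z (W y) (FD V y (0, 1)) + \<Gamma> ?z (W y) (FD V y (0, 1))
      + \<Gamma> ?z (FD W y (0, 1)) (V y) + \<Gamma> ?z (V y) (\<Gamma> ?z (W y) (W y))"
    using FD_eqI[OF Zd] VW_mixed[OF y] Gam_sym[OF zD, of "FD V y (0, 1)" "W y"] Gam_sym[OF zD, of "V y" "FD W y (0, 1)"]
    by (simp add: Vt FV Z_def linear_add[OF l2])
  moreover have "curv ?z (V y) (W y) (W y) =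
      FD (\<lambda>z. \<Gamma> z (W y) (W y)) ?z (V y, - \<Gamma> ?z (V y) (V y)) + \<Gamma> ?z (V y) (\<Gamma> ?z (W y) (W y))
      - FD (\<lambda>z. \<Gamma> z (W y) (V y)) ?z (W y, - \<Gamma> ?z (W y) (V y)) - \<Gamma> ?z (W y) (\<Gamma> ?z (W y) (V y))"
    using Gam_sym[OF zD, of "V y" "W y"] by (simp add: curv_def sym sndz)
  ultimately have "FD Y y (0, 1) + \<Gamma> ?z (W y) (Y y) =
      (FD Z y (1, 0) + \<Gamma> ?z (V y) (Z y)) - curv ?z (V y) (W y) (W y) + P"
    by (simp add: algebra_simps)
  then have "leg ?z (FD Y y (0, 1) + \<Gamma> ?z (W y) (Y y)) =
      leg ?z (FD Z y (1, 0) + \<Gamma> ?z (V y) (Z y)) - leg ?z (curv ?z (V y) (W y) (W y))"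
    using P0 linear_add[OF leg_linear[OF zD]] linear_diff[OF leg_linear[OF zD]] by simp
  with lhs rhs YDW show ?thesis
    unfolding geo f0 by (simp add: Y_def Z_def)
qed

end

end

section \<open>Anisotropic connections in charts\<close>

text \<open>Extended bilinearly from basis vectors, so that linearity holds by construction at every
  \<open>z\<close>, even off the domain, and smoothness concerns finitely many components.\<close>

definition Gam :: "('m::topological_space, 'e::euclidean_space) chart set \<Rightarrow> ('m, 'e) aniso_map
    \<Rightarrow> ('m, 'e) chart \<Rightarrow> 'e \<times> 'e \<Rightarrow> 'e \<Rightarrow> 'e \<Rightarrow> 'e" where
  "Gam M nabla c z u w = (\<Sum>i\<in>Basis. \<Sum>j\<in>Basis. ((u \<bullet> i) * (w \<bullet> j)) *\<^sub>R
     tcoord M c (cinv c (fst z)) (christoffel M nabla c (bundle_inv M c z) i j))"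

locale aniso_conn = smooth_mfd M for M :: "('m::t2_space, 'e::euclidean_space) chart set" +
  fixes A :: "('m \<times> 'e) set" and nabla :: "('m, 'e) aniso_map"
  assumes conic: "conic_domain M A"
    and connection: "aniso_connection M A nabla"
    and torsion: "torsion_free M A nabla"
begin

abbreviation \<Gamma> where "\<Gamma> \<equiv> Gam M nabla"
abbreviation dom where "dom c \<equiv> bundle_image M c A"
abbreviation VF where "VF \<equiv> vector_fields M"

lemma dom_open: "c \<in> M \<Longrightarrow> open (dom c)"
  using conic by (simp add: conic_domain_def)

section \<open>Algebraic rules and locality of the connection\<close>

lemma conn_add: "v \<in> A \<Longrightarrow> X \<in> VF \<Longrightarrow> Y \<in> VF \<Longrightarrow> Z \<in> VF \<Longrightarrow>
    nabla v X (\<lambda>q. Y q + Z q) = nabla v X Y + nabla v X Z"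
  using connection unfolding aniso_connection_def by blast

lemma conn_scale: "v \<in> A \<Longrightarrow> X \<in> VF \<Longrightarrow> Y \<in> VF \<Longrightarrow> smooth_fun M f \<Longrightarrow>
    nabla v X (\<lambda>q. f q *\<^sub>R Y q) = dir_deriv M (fst v) (X (fst v)) f *\<^sub>R Y (fst v) + f (fst v) *\<^sub>R nabla v X Y"
  using connection unfolding aniso_connection_def by blast

lemma conn_linear1: "v \<in> A \<Longrightarrow> X \<in> VF \<Longrightarrow> Y \<in> VF \<Longrightarrow> Z \<in> VF \<Longrightarrow> smooth_fun M f \<Longrightarrow> smooth_fun M h \<Longrightarrow>
    nabla v (\<lambda>q. f q *\<^sub>R X q + h q *\<^sub>R Y q) Z = f (fst v) *\<^sub>R nabla v X Z + h (fst v) *\<^sub>R nabla v Y Z"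
  using connection unfolding aniso_connection_def by blast

lemma conn_aniso_field: "X \<in> VF \<Longrightarrow> Y \<in> VF \<Longrightarrow> (\<lambda>v. nabla v X Y) \<in> aniso_fields M A"
  using connection unfolding aniso_connection_def by blast

lemma dir_deriv_const: "dir_deriv M p x (\<lambda>q. k) = 0"
  by (simp add: dir_deriv_def o_def)

lemma conn_zero2: "v \<in> A \<Longrightarrow> X \<in> VF \<Longrightarrow> nabla v X (\<lambda>q. 0) = 0"
  using conn_scale[OF _ _ vf_zero smooth_fun_const[of 0], of v X] by (simp add: dir_deriv_const)

lemma conn_scale1: "v \<in> A \<Longrightarrow> X \<in> VF \<Longrightarrow> Z \<in> VF \<Longrightarrow> smooth_fun M f \<Longrightarrow>
    nabla v (\<lambda>q. f q *\<^sub>R X q) Z = f (fst v) *\<^sub>R nabla v X Z"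
  using conn_linear1[OF _ _ vf_zero _ _ smooth_fun_const[of 0], of v X Z f] by simp

lemma conn_add1: "v \<in> A \<Longrightarrow> X \<in> VF \<Longrightarrow> Y \<in> VF \<Longrightarrow> Z \<in> VF \<Longrightarrow>
    nabla v (\<lambda>q. X q + Y q) Z = nabla v X Z + nabla v Y Z"
  using conn_linear1[OF _ _ _ _ smooth_fun_const[of 1] smooth_fun_const[of 1], of v X Y Z] by simp

lemma conn_zero1: "v \<in> A \<Longrightarrow> Z \<in> VF \<Longrightarrow> nabla v (\<lambda>q. 0) Z = 0"
  using conn_scale1[OF _ vf_zero _ smooth_fun_const[of 0], of v Z] by simp

lemma conn_sum1:
  assumes "v \<in> A" "Z \<in> VF" "\<And>i. i \<in> I \<Longrightarrow> smooth_fun M (f i)" "\<And>i. i \<in> I \<Longrightarrow> X i \<in> VF"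
  shows "nabla v (\<lambda>q. \<Sum>i\<in>I. f i q *\<^sub>R X i q) Z = (\<Sum>i\<in>I. f i (fst v) *\<^sub>R nabla v (X i) Z)"
  using assms(3,4)
proof (induction I rule: infinite_finite_induct)
  case (insert i I)
  have "(\<lambda>q. f i q *\<^sub>R X i q) \<in> VF" using insert.prems by (auto intro: vf_scale)
  moreover have "(\<lambda>q. \<Sum>i\<in>I. f i q *\<^sub>R X i q) \<in> VF"
    by (rule vf_sum) (use insert.prems in \<open>auto intro: vf_scale\<close>)
  ultimately have *: "(\<lambda>q. f i q *\<^sub>R X i q) \<in> VF" "(\<lambda>q. \<Sum>i\<in>I. f i q *\<^sub>R X i q) \<in> VF" by auto
  from conn_add1[OF assms(1) * assms(2)] show ?case
    using insert conn_scale1[OF assms(1) _ assms(2)] by simp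
qed (auto simp: conn_zero1 assms)

lemma conn_sum2:
  assumes "v \<in> A" "X \<in> VF" "\<And>i. i \<in> I \<Longrightarrow> smooth_fun M (f i)" "\<And>i. i \<in> I \<Longrightarrow> Y i \<in> VF"
  shows "nabla v X (\<lambda>q. \<Sum>i\<in>I. f i q *\<^sub>R Y i q) =
    (\<Sum>i\<in>I. dir_deriv M (fst v) (X (fst v)) (f i) *\<^sub>R Y i (fst v) + f i (fst v) *\<^sub>R nabla v X (Y i))"
  using assms(3,4)
proof (induction I rule: infinite_finite_induct)
  case (insert i I)
  have "(\<lambda>q. f i q *\<^sub>R Y i q) \<in> VF" using insert.prems by (auto intro: vf_scale)
  moreover have "(\<lambda>q. \<Sum>i\<in>I. f i q *\<^sub>R Y i q) \<in> VF"
    by (rule vf_sum) (use insert.prems in \<open>auto intro: vf_scale\<close>)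
  ultimately have *: "(\<lambda>q. f i q *\<^sub>R Y i q) \<in> VF" "(\<lambda>q. \<Sum>i\<in>I. f i q *\<^sub>R Y i q) \<in> VF" by auto
  from conn_add[OF assms(1,2) *] show ?case
    using insert conn_scale[OF assms(1,2)] by simp
qed (auto simp: conn_zero2 assms)

text \<open>With a bump function \<open>f\<close> equal to 1 near the point, the fields
  \<open>f X\<close> and \<open>f X'\<close> are equal globally, and linearity over functions in the
  first argument recovers the values. In the second argument the Leibniz terms agree because they
  involve \<open>Y\<close> and \<open>Y'\<close> only at the point itself.\<close>

lemma conn_local:
  assumes v: "v \<in> A" and X: "X \<in> VF" "X' \<in> VF" "\<forall>\<^sub>F q in nhds (fst v). X q = X' q"
    and Y: "Y \<in> VF" "Y' \<in> VF" "\<forall>\<^sub>F q in nhds (fst v). Y q = Y' q"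
  shows "nabla v X Y = nabla v X' Y'"
proof -
  have "\<forall>\<^sub>F q in nhds (fst v). X q = X' q \<and> Y q = Y' q" using X(3) Y(3) by eventually_elim auto
  then obtain N where N: "open N" "fst v \<in> N" "\<And>q. q \<in> N \<Longrightarrow> X q = X' q \<and> Y q = Y' q"
    unfolding eventually_nhds by blast
  obtain f K O' where f: "smooth_fun M f" "closed K" "K \<subseteq> N" "\<And>q. q \<notin> K \<Longrightarrow> f q = 0"
    "open O'" "fst v \<in> O'" "\<And>q. q \<in> O' \<Longrightarrow> f q = 1"
    using bump_manifold[OF N(1,2)] by metis
  have fX: "(\<lambda>q. f q *\<^sub>R X q) = (\<lambda>q. f q *\<^sub>R X' q)" and fY: "(\<lambda>q. f q *\<^sub>R Y q) = (\<lambda>q. f q *\<^sub>R Y' q)"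
    using f(3,4) N(3) by (metis scaleR_zero_left subsetD)+
  have "nabla v X Y = nabla v X' Y"
    using arg_cong[OF fX, of "\<lambda>Z. nabla v Z Y"] conn_scale1[OF v X(1) Y(1) f(1)] conn_scale1[OF v X(2) Y(1) f(1)]
      f(6,7) by simp
  also have "\<dots> = nabla v X' Y'"
    using arg_cong[OF fY, of "nabla v X'"] conn_scale[OF v X(2) Y(1) f(1)] conn_scale[OF v X(2) Y(2) f(1)]
      f(6,7) N(2,3) by simp
  finally show ?thesis .
qed

lemma nabla_local:
  assumes v: "v \<in> A" and X: "X \<in> VF" "\<forall>\<^sub>F q in nhds (fst v). X q = X' q"
    and Y: "Y \<in> VF" "\<forall>\<^sub>F q in nhds (fst v). Y q = Y' q"
    and X': "open \<Omega>" "fst v \<in> \<Omega>" "smooth_vf_on M \<Omega> X'" and Y': "open \<Omega>'" "fst v \<in> \<Omega>'" "smooth_vf_on M \<Omega>' Y'"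
  shows "nabla_local M nabla v X' Y' = nabla v X Y"
  unfolding nabla_local_def
proof (rule conn_local[OF v germ_ext(1)[OF X'] X(1) _ germ_ext(1)[OF Y'] Y(1)])
  show "\<forall>\<^sub>F q in nhds (fst v). germ_ext M (fst v) X' q = X q"
    using germ_ext(2)[OF X'] X(2) by eventually_elim simp
  show "\<forall>\<^sub>F q in nhds (fst v). germ_ext M (fst v) Y' q = Y q"
    using germ_ext(2)[OF Y'] Y(2) by eventually_elim simp
qed

section \<open>Christoffel symbols in a chart\<close>

lemma christoffel_frame:
  assumes c: "mchart M c" and v: "v \<in> A" "fst v \<in> O'" and O': "open O'" "O' \<subseteq> cdom c"
    and E: "\<And>u. E u \<in> VF" "\<And>u q. q \<in> O' \<Longrightarrow> E u q = tvec M c q u"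
  shows "christoffel M nabla c v i j = nabla v (E i) (E j)"
  unfolding christoffel_def
proof (rule nabla_local[OF v(1) E(1) _ E(1) _ mchart_open[OF c] _ coord_field_smooth[OF c]
        mchart_open[OF c] _ coord_field_smooth[OF c]])
  show "fst v \<in> cdom c" "fst v \<in> cdom c" using v(2) O'(2) by auto
  show "\<forall>\<^sub>F q in nhds (fst v). E i q = tvec M c q i" "\<forall>\<^sub>F q in nhds (fst v). E j q = tvec M c q j"
    unfolding eventually_nhds using O'(1) v(2) E(2) by blast+
qed

lemma Gam_linear1: "linear (\<lambda>u. \<Gamma> c z u w)"
  unfolding Gam_def by (intro linear_compose_sum ballI linearI) (simp_all add: inner_add_left algebra_simps)

lemma Gam_linear2: "linear (\<lambda>w. \<Gamma> c z u w)"
  unfolding Gam_def by (intro linear_compose_sum ballI linearI) (simp_all add: inner_add_left algebra_simps)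

text \<open>\<open>christoffel\<close> chooses germ extensions anew at every base point, so its
  smoothness is not visible. Near a given point all of them may be replaced by one fixed global
  frame, for which smoothness in the base vector is part of the definition of a connection.\<close>

lemma Gam_smooth:
  assumes c: "c \<in> M"
  shows "Cinf (dom c) (\<lambda>z. \<Gamma> c z u w)"
proof (rule Cinf_local)
  have mc: "mchart M c" using c by (rule mchart_atlas)
  fix z assume z: "z \<in> dom c"
  let ?p = "cinv c (fst z)"
  have zc: "fst z \<in> cmap c ` cdom c" "bundle_inv M c z \<in> A" using z bundle_image_iff[OF mc] by auto
  then have p: "?p \<in> cdom c" using mc by auto
  obtain E O' where E: "\<And>u. E u \<in> vector_fields M" "open O'" "?p \<in> O'" "O' \<subseteq> cdom c"
    "\<And>u q. q \<in> O' \<Longrightarrow> E u q = tvec M c q u"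
    using coord_frame[OF mc p] by blast
  define U where "U = dom c \<inter> fst -` (cmap c ` O')"
  have oU: "open U" unfolding U_def
    by (intro open_Int open_vimage_fst dom_open c mchart_open_image'[OF mc] E)
  have "Cinf (dom c) (\<lambda>z. tcoord M c (cinv c (fst z)) (nabla (bundle_inv M c z) (E i) (E j)))" for i j
    using conn_aniso_field[OF E(1) E(1)] c smooth_on_Cinf[OF dom_open[OF c]] by (auto simp: aniso_fields_def)
  then have s: "Cinf U (\<lambda>z. tcoord M c (cinv c (fst z)) (nabla (bundle_inv M c z) (E i) (E j)))" for i j
    by (rule Cinf_subset[OF _ oU]) (auto simp: U_def)
  have "Cinf U (\<lambda>z. \<Sum>i\<in>Basis. \<Sum>j\<in>Basis. ((u \<bullet> i) * (w \<bullet> j)) *\<^sub>R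
      tcoord M c (cinv c (fst z)) (nabla (bundle_inv M c z) (E i) (E j)))"
    by (intro Cinf_sum Cinf_scaleR s oU Cinf_const)
  then have "Cinf U (\<lambda>z. \<Gamma> c z u w)"
  proof (rule Cinf_cong)
    fix z assume z: "z \<in> U"
    then obtain q where q: "fst z = cmap c q" "q \<in> O'" by (auto simp: U_def)
    then have "bundle_inv M c z \<in> A" "fst (bundle_inv M c z) \<in> O'"
      using z bundle_image_iff[OF mc, of z A] E(4) mc by (auto simp: U_def bundle_inv_def subset_iff)
    then show "(\<Sum>i\<in>Basis. \<Sum>j\<in>Basis. ((u \<bullet> i) * (w \<bullet> j)) *\<^sub>R
      tcoord M c (cinv c (fst z)) (nabla (bundle_inv M c z) (E i) (E j))) = \<Gamma> c z u w"
      using christoffel_frame[OF mc _ _ E(2,4,1,5)] by (simp add: Gam_def)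
  qed
  moreover have "z \<in> U" using z zc E(3) mc by (auto simp: U_def)
  ultimately show "\<exists>U. z \<in> U \<and> U \<subseteq> dom c \<and> Cinf U (\<lambda>z. \<Gamma> c z u w)"
    by (intro exI[of _ U]) (auto simp: U_def)
qed

text \<open>By locality both fields may be replaced by their expansions in a coordinate frame with
  globally smooth coefficients. Linearity in \<open>X\<close> and the Leibniz rule in
  \<open>Y\<close> then leave the derivative of the components of \<open>Y\<close> and the
  Christoffel sum.\<close>

lemma nabla_chart:
  assumes mc: "mchart M c" and v: "v \<in> A" "fst v \<in> cdom c" and X: "X \<in> VF" and Y: "Y \<in> VF"
  shows "tcoord M c (fst v) (nabla v X Y) =
    FD (vrep M c Y) (cmap c (fst v)) (tcoord M c (fst v) (X (fst v)))
    + \<Gamma> c (bundle_map M c v) (tcoord M c (fst v) (X (fst v))) (tcoord M c (fst v) (Y (fst v)))"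
proof -
  let ?p = "fst v"
  let ?tc = "tcoord M c ?p"
  obtain E O' where E: "\<And>u. E u \<in> vector_fields M" "open O'" "?p \<in> O'" "O' \<subseteq> cdom c"
    "\<And>u q. q \<in> O' \<Longrightarrow> E u q = tvec M c q u"
    using coord_frame[OF mc v(2)] by blast
  have comp: "\<exists>f. \<forall>j\<in>Basis. smooth_fun M (f j) \<and> (\<forall>\<^sub>F q in nhds ?p. f j q = tcoord M c q (Z q) \<bullet> j)"
    if Z: "Z \<in> VF" for Z
  proof (rule bchoice, rule ballI)
    fix j :: 'e
    have "Cinf (cmap c ` cdom c) (\<lambda>x. vrep M c Z x \<bullet> j)"
      by (intro Cinf_inner vector_field_Cinf Z mc Cinf_const mchart_open_image' mchart_open) auto
    then have "Cinf (cmap c ` cdom c) (\<lambda>x. (\<lambda>q. tcoord M c q (Z q) \<bullet> j) (cinv c x))" by (simp add: vrep_def)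
    from smooth_fun_extend[OF mc mchart_open[OF mc] order_refl v(2) this]
    show "\<exists>f. smooth_fun M f \<and> (\<forall>\<^sub>F q in nhds ?p. f q = tcoord M c q (Z q) \<bullet> j)"
      unfolding eventually_nhds by metis
  qed
  have rep: "\<forall>\<^sub>F q in nhds ?p. Z q = (\<Sum>j\<in>Basis. f j q *\<^sub>R E j q)"
    if f: "\<forall>j\<in>Basis. smooth_fun M (f j) \<and> (\<forall>\<^sub>F q in nhds ?p. f j q = tcoord M c q (Z q) \<bullet> j)" for f Z
  proof -
    have "\<forall>\<^sub>F q in nhds ?p. \<forall>j\<in>Basis. f j q = tcoord M c q (Z q) \<bullet> j"
      by (rule eventually_ball_finite) (use f in auto)
    moreover have "\<forall>\<^sub>F q in nhds ?p. q \<in> O'" using E(2,3) by (rule eventually_nhds_in_open)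
    ultimately show ?thesis
    proof eventually_elim
      case (elim q)
      then have q: "q \<in> cdom c" using E(4) by auto
      have "Z q = tvec M c q (tcoord M c q (Z q))" using mc q by simp
      also have "\<dots> = (\<Sum>j\<in>Basis. (tcoord M c q (Z q) \<bullet> j) *\<^sub>R tvec M c q j)"
        by (rule linear_euclidean_sum[OF linear_tvec[OF mc q]])
      finally show ?case using elim E(5) by simp
    qed
  qed
  obtain fX where fX: "\<forall>j\<in>Basis. smooth_fun M (fX j) \<and> (\<forall>\<^sub>F q in nhds ?p. fX j q = tcoord M c q (X q) \<bullet> j)"
    using comp[OF X] by metis
  obtain fY where fY: "\<forall>j\<in>Basis. smooth_fun M (fY j) \<and> (\<forall>\<^sub>F q in nhds ?p. fY j q = tcoord M c q (Y q) \<bullet> j)"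
    using comp[OF Y] by metis
  have fXp: "fX j ?p = ?tc (X ?p) \<bullet> j" and fYp: "fY j ?p = ?tc (Y ?p) \<bullet> j" if "j \<in> Basis" for j
    using fX fY that eventually_nhds_x_imp_x by fast+
  have XV: "(\<lambda>q. \<Sum>j\<in>Basis. fX j q *\<^sub>R E j q) \<in> VF" and YV: "(\<lambda>q. \<Sum>j\<in>Basis. fY j q *\<^sub>R E j q) \<in> VF"
    using fX fY E(1) by (auto intro!: vf_sum vf_scale)
  have l: "linear ?tc" by (rule linear_tcoord[OF mc v(2)])
  have Ep: "?tc (E j ?p) = j" for j using E mc v by simp
  have chr: "\<Gamma> c (bundle_map M c v) a b = (\<Sum>i\<in>Basis. \<Sum>j\<in>Basis. ((a \<bullet> i) * (b \<bullet> j)) *\<^sub>R ?tc (nabla v (E i) (E j)))" for a b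
    using mc v christoffel_frame[OF mc v(1) E(3,2,4,1,5)] by (simp add: Gam_def)
  have XE: "nabla v X (E j) = (\<Sum>i\<in>Basis. (?tc (X ?p) \<bullet> i) *\<^sub>R nabla v (E i) (E j))" for j
  proof -
    have "nabla v X (E j) = nabla v (\<lambda>q. \<Sum>j\<in>Basis. fX j q *\<^sub>R E j q) (E j)"
      by (rule conn_local[OF v(1) X XV rep[OF fX] E(1) E(1)]) simp
    also have "\<dots> = (\<Sum>i\<in>Basis. fX i ?p *\<^sub>R nabla v (E i) (E j))"
      by (rule conn_sum1) (use v E fX in auto)
    finally show ?thesis using fXp by simp
  qed
  have dY: "dir_deriv M ?p (X ?p) (fY j) = FD (vrep M c Y) (cmap c ?p) (?tc (X ?p)) \<bullet> j" if j: "j \<in> Basis" for j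
  proof -
    obtain N where N: "open N" "?p \<in> N" "\<And>q. q \<in> N \<Longrightarrow> fY j q = tcoord M c q (Y q) \<bullet> j"
      using fY j unfolding eventually_nhds by metis
    have dd: "vrep M c Y differentiable at (cmap c ?p)"
      by (rule Cinf_differentiable[OF vector_field_Cinf[OF Y mc]]) (use v in auto)
    have "((\<lambda>x. vrep M c Y x \<bullet> j) has_derivative (\<lambda>u. FD (vrep M c Y) (cmap c ?p) u \<bullet> j)) (at (cmap c ?p))"
      by (rule has_derivative_inner_left[OF FD_has_derivative[OF dd]])
    then have "((\<lambda>x. fY j (cinv c x)) has_derivative (\<lambda>u. FD (vrep M c Y) (cmap c ?p) u \<bullet> j)) (at (cmap c ?p))"
      by (rule has_derivative_transform_within_open[OF _ mchart_open_image[OF mc N(1)]])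
        (use v N mc in \<open>auto simp: vrep_def\<close>)
    then show ?thesis
      using dir_deriv_chart[OF mc v(2), of "fY j" "X ?p"] FD_eqI by (fastforce simp: differentiable_def)
  qed
  have "nabla v X Y = nabla v X (\<lambda>q. \<Sum>j\<in>Basis. fY j q *\<^sub>R E j q)"
    by (rule conn_local[OF v(1) X X _ Y YV rep[OF fY]]) simp
  also have "\<dots> = (\<Sum>j\<in>Basis. dir_deriv M ?p (X ?p) (fY j) *\<^sub>R E j ?p + fY j ?p *\<^sub>R nabla v X (E j))"
    by (rule conn_sum2) (use v X E fY in auto)
  finally have "?tc (nabla v X Y) = (\<Sum>j\<in>Basis. (FD (vrep M c Y) (cmap c ?p) (?tc (X ?p)) \<bullet> j) *\<^sub>R j
      + (?tc (Y ?p) \<bullet> j) *\<^sub>R (\<Sum>i\<in>Basis. (?tc (X ?p) \<bullet> i) *\<^sub>R ?tc (nabla v (E i) (E j))))"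
    using dY fYp by (simp add: linear_sum[OF l] linear_add[OF l] linear_cmul[OF l] Ep XE)
  also have "\<dots> = FD (vrep M c Y) (cmap c ?p) (?tc (X ?p)) + \<Gamma> c (bundle_map M c v) (?tc (X ?p)) (?tc (Y ?p))"
  proof -
    have "(\<Sum>j\<in>Basis. \<Sum>i\<in>Basis. ((?tc (Y ?p) \<bullet> j) * (?tc (X ?p) \<bullet> i)) *\<^sub>R ?tc (nabla v (E i) (E j))) =
        \<Gamma> c (bundle_map M c v) (?tc (X ?p)) (?tc (Y ?p))"
      unfolding chr
      by (rule trans[OF sum.swap]) (intro sum.cong refl arg_cong2[where f=scaleR] mult.commute)
    then show ?thesis by (simp only: sum.distrib scaleR_sum_right scaleR_scaleR euclidean_representation)
  qed
  finally show ?thesis .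
qed

lemma nabla_local_chart:
  assumes mc: "mchart M c" and v: "v \<in> A" "fst v \<in> cdom c"
    and X: "open \<Omega>" "fst v \<in> \<Omega>" "smooth_vf_on M \<Omega> X" and Y: "open \<Omega>'" "fst v \<in> \<Omega>'" "smooth_vf_on M \<Omega>' Y"
  shows "tcoord M c (fst v) (nabla_local M nabla v X Y) =
    FD (vrep M c Y) (cmap c (fst v)) (tcoord M c (fst v) (X (fst v)))
    + \<Gamma> c (bundle_map M c v) (tcoord M c (fst v) (X (fst v))) (tcoord M c (fst v) (Y (fst v)))"
proof -
  let ?p = "fst v"
  have d: "vrep M c (germ_ext M ?p Y) differentiable at (cmap c ?p)"
    by (rule Cinf_differentiable[OF vector_field_Cinf[OF germ_ext(1)[OF Y] mc]]) (use v in auto)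
  show ?thesis
    unfolding nabla_local_def nabla_chart[OF mc v germ_ext(1)[OF X] germ_ext(1)[OF Y]]
    using eventually_nhds_x_imp_x[OF germ_ext(2)[OF X]] eventually_nhds_x_imp_x[OF germ_ext(2)[OF Y]]
      FD_vrep_cong[OF mc v(2) germ_ext(2)[OF Y] d] by simp
qed

text \<open>For fields with locally constant components the derivative term in
  \<open>nabla_chart\<close> vanishes, so that \<open>nabla\<close> of two of them is
  \<open>\<Gamma>\<close> itself.\<close>

lemma const_frame:
  assumes "mchart M c" "p \<in> cdom c"
  obtains E where "\<And>u. E u \<in> VF" "\<And>u. tcoord M c p (E u p) = u" "\<And>u. FD (vrep M c (E u)) (cmap c p) = (\<lambda>_. 0)"
    "\<And>u. \<forall>\<^sub>F q in nhds p. E u q = tvec M c q u"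
proof -
  obtain E O' where E: "\<And>u. E u \<in> vector_fields M" "open O'" "p \<in> O'" "O' \<subseteq> cdom c"
    "\<And>u q. q \<in> O' \<Longrightarrow> E u q = tvec M c q u"
    using coord_frame[OF assms] by blast
  have "FD (vrep M c (E u)) (cmap c p) = FD (\<lambda>x. u) (cmap c p)" for u
    by (rule FD_cong[OF Cinf_differentiable[OF vector_field_Cinf[OF E(1) assms(1)]] mchart_open_image'[OF assms(1) E(2,4)]])
      (use E assms in \<open>auto simp: vrep_def subset_iff\<close>)
  then show ?thesis using E assms by (intro that[of E]) (auto simp: eventually_nhds)
qed

text \<open>Coordinate fields commute, so freedom from torsion becomes symmetry of
  \<open>\<Gamma>\<close>.\<close>

lemma Gam_sym:
  assumes c: "c \<in> M" and z: "z \<in> dom c"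
  shows "\<Gamma> c z u w = \<Gamma> c z w u"
proof -
  have mc: "mchart M c" by (rule mchart_atlas[OF c])
  define v where "v = bundle_inv M c z"
  have v: "v \<in> A" "fst v \<in> cdom c" "bundle_map M c v = z"
    using z bundle_image_iff[OF mc] mc by (auto simp: v_def bundle_map_inv) (auto simp: bundle_inv_def)
  obtain E where E: "\<And>u. E u \<in> VF" "\<And>u. tcoord M c (fst v) (E u (fst v)) = u"
    "\<And>u. FD (vrep M c (E u)) (cmap c (fst v)) = (\<lambda>_. 0)"
    using const_frame[OF mc v(2)] by metis
  have "nabla v (E u) (E w) - nabla v (E w) (E u) = lie_bracket M (E u) (E w) (fst v)"
    using torsion v E(1) by (auto simp: torsion_free_def)
  then have "tcoord M c (fst v) (nabla v (E u) (E w)) - tcoord M c (fst v) (nabla v (E w) (E u)) = 0"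
    using lie_bracket_chart[OF mc v(2) E(1) E(1), of u w]
    by (simp add: E(3) linear_diff[OF linear_tcoord[OF mc v(2)], symmetric])
  then show ?thesis
    using nabla_chart[OF mc v(1,2) E(1) E(1)] E(2,3) v(3) by simp
qed

text \<open>The same vector \<open>nabla v (E u) (E w)\<close> is computed in two charts. The
  Hessian of the transition map comes from the components of \<open>E w\<close>, which are constant
  in \<open>c\<close> near the point but not in \<open>d\<close>.\<close>

lemma Gam_change:
  assumes c: "c \<in> M" and d: "d \<in> M" and v: "v \<in> A" "fst v \<in> cdom c" "fst v \<in> cdom d"
  shows "FD (tr c d) (cmap c (fst v)) (\<Gamma> c (bundle_map M c v) u w) =
    FD (\<lambda>x. FD (tr c d) x w) (cmap c (fst v)) u
    + \<Gamma> d (bundle_map M d v) (FD (tr c d) (cmap c (fst v)) u) (FD (tr c d) (cmap c (fst v)) w)"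
proof -
  note mc = mchart_atlas[OF c] and md = mchart_atlas[OF d]
  obtain E where E: "\<And>u. E u \<in> VF" "\<And>u. tcoord M c (fst v) (E u (fst v)) = u"
    "\<And>u. FD (vrep M c (E u)) (cmap c (fst v)) = (\<lambda>_. 0)"
    using const_frame[OF mc v(2)] by metis
  have td: "tcoord M d (fst v) x = FD (tr c d) (cmap c (fst v)) (tcoord M c (fst v) x)" for x
    by (rule tcoord_change[OF mc md v(2,3)])
  show ?thesis
    using td[of "nabla v (E u) (E w)"] nabla_chart[OF mc v(1,2) E(1) E(1), of u w]
      nabla_chart[OF md v(1,3) E(1) E(1), of u w] FD_vrep_change[OF mc md v(2,3) open_UNIV UNIV_I vf_smooth_on[OF E(1)], of w u]
      linear_0[OF Cinf_linear_FD[OF tr_Cinf[OF mc md]], of "cmap c (fst v)"] v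
    by (simp add: td E)
qed

text \<open>The vector is extended with constant components in its preferred chart. As
  \<open>A\<close> is open in bundle charts, this extension stays in \<open>A\<close> near the base
  point, which is the existence needed for the choice in \<open>adm_ext\<close>.\<close>

lemma adm_ext:
  assumes "v \<in> A"
  obtains \<Omega> where "open \<Omega>" "fst v \<in> \<Omega>" "smooth_vf_on M \<Omega> (adm_ext M A v)"
    "\<And>q. q \<in> \<Omega> \<Longrightarrow> (q, adm_ext M A v q) \<in> A" "adm_ext M A v (fst v) = snd v"
proof -
  let ?c = "chart_at M (fst v)"
  have c: "?c \<in> M" "mchart M ?c" "fst v \<in> cdom ?c" using chart_at by auto
  define W where "W = (\<lambda>x. (x, snd v)) -` dom ?c"
  have oW: "open W" unfolding W_def by (intro open_vimage dom_open c continuous_intros)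
  define \<Omega> where "\<Omega> = cdom ?c \<inter> cmap ?c -` W"
  have "continuous_on (cdom ?c) (cmap ?c)"
    by (rule continuous_at_imp_continuous_on) (use is_chart_continuous[OF mchart_is_chart[OF c(2)]] in blast)
  then have o: "open \<Omega>" unfolding \<Omega>_def by (rule continuous_open_preimage) (use mchart_open[OF c(2)] oW in auto)
  have "bundle_map M ?c v \<in> dom ?c" using bundle_map_mem[OF c(2) assms c(3)] .
  then have vO: "fst v \<in> \<Omega>" using c by (simp add: \<Omega>_def W_def bundle_map_def)
  have "smooth_vf_on M \<Omega> (\<lambda>q. tvec M ?c q (snd v))"
    by (rule smooth_vf_subset[OF mchart_open[OF c(2)] coord_field_smooth[OF c(2)] o]) (auto simp: \<Omega>_def)
  moreover have "(q, tvec M ?c q (snd v)) \<in> A" if "q \<in> \<Omega>" for q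
  proof -
    have "q \<in> cdom ?c" "(cmap ?c q, snd v) \<in> dom ?c" using that by (auto simp: \<Omega>_def W_def)
    then show ?thesis using c(2) bundle_image_iff[OF c(2), of "(cmap ?c q, snd v)" A] by (simp add: bundle_inv_def)
  qed
  moreover have "tvec M ?c (fst v) (snd v) = snd v" using tvec_tcoord[OF c(2,3), of "snd v"] by simp
  ultimately have "\<exists>V \<Omega>. open \<Omega> \<and> fst v \<in> \<Omega> \<and> smooth_vf_on M \<Omega> V \<and> (\<forall>q\<in>\<Omega>. (q, V q) \<in> A) \<and> V (fst v) = snd v"
    using o vO by blast
  then have "\<exists>\<Omega>. open \<Omega> \<and> fst v \<in> \<Omega> \<and> smooth_vf_on M \<Omega> (adm_ext M A v) \<and> (\<forall>q\<in>\<Omega>. (q, adm_ext M A v q) \<in> A)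
      \<and> adm_ext M A v (fst v) = snd v"
    unfolding adm_ext_def by (rule someI_ex)
  then show ?thesis using that by blast
qed

section \<open>Covariant derivatives of anisotropic functions and sections in a chart\<close>

definition arep :: "('m, 'e) chart \<Rightarrow> ('m \<times> 'e \<Rightarrow> 'e) \<Rightarrow> 'e \<times> 'e \<Rightarrow> 'e" where
  "arep c \<Y> z = tcoord M c (cinv c (fst z)) (\<Y> (bundle_inv M c z))"

lemma arep_Cinf: "\<Y> \<in> aniso_fields M A \<Longrightarrow> c \<in> M \<Longrightarrow> Cinf (dom c) (arep c \<Y>)"
  by (auto simp: aniso_fields_def arep_def[abs_def] intro!: smooth_on_Cinf dom_open)

lemma adm_chart:
  assumes mc: "mchart M c" and v: "v \<in> A" "fst v \<in> cdom c" and X: "X \<in> VF"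
  obtains \<Omega> V where "open \<Omega>" "fst v \<in> \<Omega>" "smooth_vf_on M \<Omega> V" "\<And>q. q \<in> \<Omega> \<Longrightarrow> (q, V q) \<in> A"
    "V = adm_ext M A v" "(cmap c (fst v), vrep M c V (cmap c (fst v))) = bundle_map M c v"
    "(vrep M c V has_derivative FD (vrep M c V) (cmap c (fst v))) (at (cmap c (fst v)))"
    "tcoord M c (fst v) (nabla_local M nabla v X V) =
      FD (vrep M c V) (cmap c (fst v)) (tcoord M c (fst v) (X (fst v)))
      + \<Gamma> c (bundle_map M c v) (tcoord M c (fst v) (X (fst v))) (snd (bundle_map M c v))"
proof -
  define V where "V = adm_ext M A v"
  obtain \<Omega> where V: "open \<Omega>" "fst v \<in> \<Omega>" "smooth_vf_on M \<Omega> V" "\<And>q. q \<in> \<Omega> \<Longrightarrow> (q, V q) \<in> A" "V (fst v) = snd v"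
    using adm_ext[OF v(1)] unfolding V_def by metis
  show ?thesis
  proof (rule that[OF V(1-4) V_def])
    show "(cmap c (fst v), vrep M c V (cmap c (fst v))) = bundle_map M c v"
      using mc v V by (simp add: bundle_map_def)
    show "(vrep M c V has_derivative FD (vrep M c V) (cmap c (fst v))) (at (cmap c (fst v)))"
      by (rule Cinf_has_derivative[OF smooth_vf_Cinf[OF V(1,3) mc]]) (use v V in auto)
    show "tcoord M c (fst v) (nabla_local M nabla v X V) =
      FD (vrep M c V) (cmap c (fst v)) (tcoord M c (fst v) (X (fst v)))
      + \<Gamma> c (bundle_map M c v) (tcoord M c (fst v) (X (fst v))) (snd (bundle_map M c v))"
      using nabla_local_chart[OF mc v open_UNIV UNIV_I vf_smooth_on[OF X] V(1-3)] V(5) by simp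
  qed
qed

lemma vertical_line:
  assumes mc: "mchart M c" and v: "fst v \<in> cdom c"
  shows "(fst v, snd v + t *\<^sub>R n) = bundle_inv M c (bundle_map M c v + t *\<^sub>R (0, tcoord M c (fst v) n))"
  using mc v linear_add[OF linear_tvec[OF mc v]] linear_cmul[OF linear_tvec[OF mc v]]
  by (simp add: bundle_map_def bundle_inv_def)

text \<open>The derivative of the auxiliary field \<open>V\<close> enters once through the
  directional derivative and once, with opposite sign, through the vertical correction. What remains
  is the derivative along the horizontal lift of \<open>u\<close>, free of \<open>V\<close>.\<close>

lemma nabla_fun_chart:
  assumes c: "c \<in> M" and v: "v \<in> A" "fst v \<in> cdom c" and X: "X \<in> VF"
    and h: "Cinf U (\<lambda>z. h (bundle_inv M c z))" "bundle_map M c v \<in> U"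
  defines "z \<equiv> bundle_map M c v" and "u \<equiv> tcoord M c (fst v) (X (fst v))"
  shows "nabla_fun M A nabla X h v = FD (\<lambda>z. h (bundle_inv M c z)) z (u, - \<Gamma> c z u (snd z))"
proof -
  note mc = mchart_atlas[OF c]
  obtain \<Omega> V where V: "open \<Omega>" "fst v \<in> \<Omega>" "smooth_vf_on M \<Omega> V" "\<And>q. q \<in> \<Omega> \<Longrightarrow> (q, V q) \<in> A"
    and V_def: "V = adm_ext M A v" and Vz: "(cmap c (fst v), vrep M c V (cmap c (fst v))) = z"
    and dV: "(vrep M c V has_derivative FD (vrep M c V) (cmap c (fst v))) (at (cmap c (fst v)))"
    and nV: "tcoord M c (fst v) (nabla_local M nabla v X V) = FD (vrep M c V) (cmap c (fst v)) u + \<Gamma> c z u (snd z)"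
    using adm_chart[OF mc v X] unfolding z_def u_def by metis
  let ?h = "\<lambda>z. h (bundle_inv M c z)"
  have hd: "(?h has_derivative FD ?h z) (at z)" using Cinf_has_derivative[OF h(1)] h(2) by (simp add: z_def)
  have "((\<lambda>x. (x, vrep M c V x)) has_derivative (\<lambda>k. (k, FD (vrep M c V) (cmap c (fst v)) k))) (at (cmap c (fst v)))"
    by (intro has_derivative_Pair has_derivative_ident dV)
  from diff_chain_at[OF this, of ?h] hd Vz
  have "((\<lambda>x. ?h (x, vrep M c V x)) has_derivative (\<lambda>k. FD ?h z (k, FD (vrep M c V) (cmap c (fst v)) k))) (at (cmap c (fst v)))"
    by (simp add: o_def)
  then have d: "((\<lambda>x. h (cinv c x, V (cinv c x))) has_derivative (\<lambda>k. FD ?h z (k, FD (vrep M c V) (cmap c (fst v)) k))) (at (cmap c (fst v)))"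
    by (rule has_derivative_transform_within_open[OF _ mchart_open_image[OF mc V(1)]])
      (use mc v V in \<open>auto simp: bundle_inv_def vrep_def\<close>)
  have 1: "dir_deriv M (fst v) (X (fst v)) (\<lambda>q. h (q, V q)) = FD ?h z (u, FD (vrep M c V) (cmap c (fst v)) u)"
    using dir_deriv_chart[OF mc v(2), of "\<lambda>q. h (q, V q)" "X (fst v)"] d FD_eqI[OF d]
    by (auto simp: u_def differentiable_def)
  let ?n = "nabla_local M nabla v X V"
  have "((\<lambda>t. ?h (z + t *\<^sub>R (0, tcoord M c (fst v) ?n))) has_vector_derivative FD ?h z (0, tcoord M c (fst v) ?n)) (at 0)"
    using hd by (intro line_derivative_0) (auto simp: differentiable_def)
  then have 2: "vert_deriv h v ?n = FD ?h z (0, tcoord M c (fst v) ?n)"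
    unfolding vert_deriv_def vertical_line[OF mc v(2)] z_def by (rule vector_derivative_at)
  have l: "linear (FD ?h z)" using hd by (rule has_derivative_linear)
  show ?thesis
    unfolding nabla_fun_def Let_def V_def[symmetric] 1 2 nV linear_diff[OF l, symmetric] by simp
qed

text \<open>The same cancellation as for functions. An additional \<open>\<Gamma>\<close> term
  remains because the section restricted to \<open>V\<close> is itself a vector field to be
  differentiated.\<close>

lemma nabla_field_chart:
  assumes c: "c \<in> M" and v: "v \<in> A" "fst v \<in> cdom c" and X: "X \<in> VF" and Y: "\<Y> \<in> aniso_fields M A"
  defines "z \<equiv> bundle_map M c v" and "u \<equiv> tcoord M c (fst v) (X (fst v))"
  shows "tcoord M c (fst v) (nabla_field M A nabla X \<Y> v) =
    FD (arep c \<Y>) z (u, - \<Gamma> c z u (snd z)) + \<Gamma> c z u (arep c \<Y> z)"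
proof -
  note mc = mchart_atlas[OF c]
  obtain \<Omega> V where V: "open \<Omega>" "fst v \<in> \<Omega>" "smooth_vf_on M \<Omega> V" "\<And>q. q \<in> \<Omega> \<Longrightarrow> (q, V q) \<in> A"
    and V_def: "V = adm_ext M A v" and Vz: "(cmap c (fst v), vrep M c V (cmap c (fst v))) = z"
    and dV: "(vrep M c V has_derivative FD (vrep M c V) (cmap c (fst v))) (at (cmap c (fst v)))"
    and nV: "tcoord M c (fst v) (nabla_local M nabla v X V) = FD (vrep M c V) (cmap c (fst v)) u + \<Gamma> c z u (snd z)"
    using adm_chart[OF mc v X] unfolding z_def u_def by metis
  let ?p = "fst v" and ?Y = "\<lambda>q. \<Y> (q, V q)" and ?n = "nabla_local M nabla v X V"
  have rep: "vrep M e ?Y x = arep e \<Y> (x, vrep M e V x)" "(x, vrep M e V x) \<in> dom e"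
    if "e \<in> M" "x \<in> cmap e ` (cdom e \<inter> \<Omega>)" for e x
  proof -
    obtain q where "x = cmap e q" "q \<in> cdom e" "q \<in> \<Omega>" using \<open>x \<in> _\<close> by auto
    then show "vrep M e ?Y x = arep e \<Y> (x, vrep M e V x)" "(x, vrep M e V x) \<in> dom e"
      using mchart_atlas[OF that(1)] V(4) by (auto simp: vrep_def arep_def bundle_inv_def bundle_image_iff)
  qed
  have Ys: "smooth_vf_on M \<Omega> ?Y"
  proof (rule smooth_vfI[OF V(1)])
    fix q assume q: "q \<in> \<Omega>"
    let ?e = "chart_at M q"
    have s: "Cinf (cmap ?e ` (cdom ?e \<inter> \<Omega>)) (\<lambda>x. (x, vrep M ?e V x))"
      by (intro Cinf_Pair Cinf_ident mchart_open_image smooth_vf_Cinf V mchart_chart_at)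
    have "Cinf (cmap ?e ` (cdom ?e \<inter> \<Omega>)) (\<lambda>x. arep ?e \<Y> (x, vrep M ?e V x))"
      by (rule Cinf_compose[OF arep_Cinf[OF Y chart_at(1)] s]) (rule rep(2)[OF chart_at(1)])
    then have "Cinf (cmap ?e ` (cdom ?e \<inter> \<Omega>)) (vrep M ?e ?Y)"
      by (rule Cinf_cong) (rule rep(1)[OF chart_at(1), symmetric])
    then show "\<exists>c O'. mchart M c \<and> open O' \<and> q \<in> O' \<and> O' \<subseteq> cdom c \<and> Cinf (cmap c ` O') (vrep M c ?Y)"
      using q chart_at(2)[of q] mchart_open[OF mchart_chart_at, of q] V(1)
      by (intro exI[of _ ?e] exI[of _ "cdom ?e \<inter> \<Omega>"]) auto
  qed
  have zD: "z \<in> dom c" unfolding z_def by (rule bundle_map_mem[OF mc v])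
  have hd: "(arep c \<Y> has_derivative FD (arep c \<Y>) z) (at z)" by (rule Cinf_has_derivative[OF arep_Cinf[OF Y c] zD])
  have "((\<lambda>x. (x, vrep M c V x)) has_derivative (\<lambda>k. (k, FD (vrep M c V) (cmap c (fst v)) k))) (at (cmap c (fst v)))"
    by (intro has_derivative_Pair has_derivative_ident dV)
  from diff_chain_at[OF this, of "arep c \<Y>"] hd Vz
  have "((\<lambda>x. arep c \<Y> (x, vrep M c V x)) has_derivative (\<lambda>k. FD (arep c \<Y>) z (k, FD (vrep M c V) (cmap c ?p) k))) (at (cmap c ?p))"
    by (simp add: o_def)
  then have "(vrep M c ?Y has_derivative (\<lambda>k. FD (arep c \<Y>) z (k, FD (vrep M c V) (cmap c ?p) k))) (at (cmap c ?p))"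
    by (rule has_derivative_transform_within_open[OF _ mchart_open_image[OF mc V(1)]])
      (use rep[OF c] v V in auto)
  note dY = FD_eqI[OF this]
  have Yz: "tcoord M c ?p (?Y ?p) = arep c \<Y> z"
    using rep(1)[OF c, of "cmap c ?p"] mc v V(2) Vz by simp
  have 1: "tcoord M c ?p (nabla_local M nabla v X ?Y) = FD (arep c \<Y>) z (u, FD (vrep M c V) (cmap c ?p) u) + \<Gamma> c z u (arep c \<Y> z)"
    using nabla_local_chart[OF mc v open_UNIV UNIV_I vf_smooth_on[OF X] V(1,2) Ys]
    unfolding dY Yz z_def[symmetric] u_def[symmetric] .
  let ?A = "\<lambda>z. \<Y> (bundle_inv M c z)"
  have "((\<lambda>t. arep c \<Y> (z + t *\<^sub>R (0, tcoord M c ?p ?n))) has_vector_derivative FD (arep c \<Y>) z (0, tcoord M c ?p ?n)) (at 0)"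
    using hd by (intro line_derivative_0) (auto simp: differentiable_def)
  then have "((\<lambda>t. tvec M c ?p (arep c \<Y> (z + t *\<^sub>R (0, tcoord M c ?p ?n)))) has_vector_derivative
      tvec M c ?p (FD (arep c \<Y>) z (0, tcoord M c ?p ?n))) (at 0)"
    using bounded_linear.has_vector_derivative[OF linear_conv_bounded_linear[THEN iffD1, OF linear_tvec[OF mc v(2)]]] by blast
  moreover have "tvec M c ?p (arep c \<Y> (z + t *\<^sub>R (0, tcoord M c ?p ?n))) = \<Y> (fst v, snd v + t *\<^sub>R ?n)" for t
    unfolding vertical_line[OF mc v(2)] arep_def z_def using mc v by (simp add: bundle_map_def)
  ultimately have 2: "vert_deriv \<Y> v ?n = tvec M c ?p (FD (arep c \<Y>) z (0, tcoord M c ?p ?n))"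
    unfolding vert_deriv_def by (simp add: vector_derivative_at)
  have l: "linear (FD (arep c \<Y>) z)" using hd by (rule has_derivative_linear)
  have "FD (arep c \<Y>) z (u, FD (vrep M c V) (cmap c ?p) u) - FD (arep c \<Y>) z (0, FD (vrep M c V) (cmap c ?p) u + \<Gamma> c z u (snd z))
      = FD (arep c \<Y>) z (u, - \<Gamma> c z u (snd z))"
    unfolding linear_diff[OF l, symmetric] by simp
  then show ?thesis
    unfolding nabla_field_def Let_def V_def[symmetric] linear_diff[OF linear_tcoord[OF mc v(2)]] 1 2
    using mc v nV by simp
qed

text \<open>The curvature applies \<open>nabla\<close> to the bracket as a global field, and the
  chart formula for \<open>nabla\<close> requires that field to be smooth.\<close>

lemma lie_bracket_vf: "X \<in> VF \<Longrightarrow> Y \<in> VF \<Longrightarrow> lie_bracket M X Y \<in> VF"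
  unfolding vector_fields_def[of M] mem_Collect_eq[of "lie_bracket M X Y"]
proof (rule smooth_vfI)
  fix q
  assume "X \<in> {X. smooth_vf_on M UNIV X}" "Y \<in> {X. smooth_vf_on M UNIV X}"
  then have X: "X \<in> VF" and Y: "Y \<in> VF" by (auto simp: vector_fields_def)
  let ?c = "chart_at M q"
  have "Cinf (cmap ?c ` cdom ?c) (\<lambda>x. FD (vrep M ?c Y) x (vrep M ?c X x) - FD (vrep M ?c X) x (vrep M ?c Y x))"
    by (intro Cinf_diff Cinf_FD_compose[OF vector_field_Cinf] X Y Cinf_ident vector_field_Cinf mchart_chart_at
       mchart_open_image' mchart_open) auto
  then have "Cinf (cmap ?c ` cdom ?c) (vrep M ?c (lie_bracket M X Y))"
    by (rule Cinf_cong) (use lie_bracket_chart[OF mchart_chart_at _ X Y] in \<open>auto simp: vrep_at\<close>)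
  then show "\<exists>c O'. mchart M c \<and> open O' \<and> q \<in> O' \<and> O' \<subseteq> cdom c \<and> Cinf (cmap c ` O') (vrep M c (lie_bracket M X Y))"
    using chart_at[of q] mchart_open[OF mchart_chart_at, of q] by (intro exI[of _ ?c] exI[of _ "cdom ?c"]) auto
qed simp

end

section \<open>Pseudo-Finsler metrics in charts\<close>

locale pseudo_finsler_mfd = aniso_conn M A nabla
  for M :: "('m::t2_space, 'e::euclidean_space) chart set" and A nabla +
  fixes L :: "'m \<times> 'e \<Rightarrow> real" and Q :: "'m \<times> 'e \<Rightarrow> 'e \<Rightarrow> 'e \<Rightarrow> 'e \<Rightarrow> real"
  assumes finsler: "pseudo_finsler M A L"
    and Q_sym: "symmetric3 A Q"
    and Q_vanish: "\<forall>v\<in>A. \<forall>u w. Q v (snd v) u w = 0"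
    and metric_eq: "nabla_metric_eq M A nabla (fundamental_tensor L) Q"
begin

abbreviation "Lhat c \<equiv> \<lambda>z. L (bundle_inv M c z)"
abbreviation "g \<equiv> fundamental_tensor L"

lemma model0:
  assumes c: "c \<in> M"
  shows "finsler_model (dom c) (Lhat c)"
proof
  note mc = mchart_atlas[OF c]
  show "Cinf (dom c) (Lhat c)"
    using finsler c dom_open[OF c] by (auto simp: pseudo_finsler_def smooth_fun_on_bundle_def o_def intro: smooth_on_Cinf)
  fix x v and r :: real assume z: "(x, v) \<in> dom c" and r: "r > 0"
  obtain q where q: "x = cmap c q" "q \<in> cdom c" using z bundle_image_iff[OF mc] by force
  then have A: "(q, tvec M c q v) \<in> A" using z mc by (simp add: bundle_image_iff[OF mc] bundle_inv_def)
  have t: "tvec M c q (r *\<^sub>R v) = r *\<^sub>R tvec M c q v" by (rule linear_cmul[OF linear_tvec[OF mc q(2)]])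
  have "(q, r *\<^sub>R tvec M c q v) \<in> A" using conic A r unfolding conic_domain_def by blast
  then show "(x, r *\<^sub>R v) \<in> dom c" using q mc t by (simp add: bundle_image_iff[OF mc] bundle_inv_def)
  show "Lhat c (x, r *\<^sub>R v) = r\<^sup>2 * Lhat c (x, v)"
    using finsler A r q mc t unfolding pseudo_finsler_def by (simp add: bundle_inv_def)
qed

abbreviation "fnd c \<equiv> finsler_model.fund (Lhat c)"
abbreviation "lg c \<equiv> finsler_model.leg (Lhat c)"

text \<open>Vertical lines correspond to lines in fibre coordinates, so the iterated ordinary
  derivatives become iterated Frechet derivatives. The inner one must be identified for all small
  \<open>t\<close> and not only at 0, which openness of the domain permits.\<close>

lemma fundamental_tensor_chart:
  assumes c: "c \<in> M" and v: "v \<in> A" "fst v \<in> cdom c"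
  shows "g v a b = fnd c (bundle_map M c v) (tcoord M c (fst v) a) (tcoord M c (fst v) b)"
proof -
  note mc = mchart_atlas[OF c]
  interpret m: finsler_model "dom c" "Lhat c" by (rule model0[OF c])
  let ?z = "bundle_map M c v" and ?a = "(0, tcoord M c (fst v) a)" and ?b = "(0, tcoord M c (fst v) b)"
  have zD: "?z \<in> dom c" by (rule bundle_map_mem[OF mc v])
  have line: "(fst v, snd v + t *\<^sub>R a + s *\<^sub>R b) = bundle_inv M c (?z + t *\<^sub>R ?a + s *\<^sub>R ?b)" for t s
    using vertical_line[OF mc v(2), of 1 "t *\<^sub>R a + s *\<^sub>R b"] linear_add[OF linear_tcoord[OF mc v(2)]]
      linear_cmul[OF linear_tcoord[OF mc v(2)]] by (simp add: add.assoc)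
  have 1: "deriv (\<lambda>s. L (fst v, snd v + t *\<^sub>R a + s *\<^sub>R b)) 0 = FD (Lhat c) (?z + t *\<^sub>R ?a) ?b"
    if "?z + t *\<^sub>R ?a \<in> dom c" for t
    unfolding line
    by (intro DERIV_imp_deriv line_derivative_real
        Cinf_differentiable[OF m.Lh_smooth that])
  let ?T = "(\<lambda>t. ?z + t *\<^sub>R ?a) -` dom c"
  have oT: "open ?T" by (intro open_vimage dom_open c continuous_intros)
  have "((\<lambda>t. FD (Lhat c) (?z + t *\<^sub>R ?a) ?b) has_real_derivative FD (\<lambda>z. FD (Lhat c) z ?b) ?z ?a) (at 0)"
    by (intro line_derivative_real
        Cinf_differentiable[OF Cinf_FD[OF m.Lh_smooth] zD])
  then have "((\<lambda>t. deriv (\<lambda>s. L (fst v, snd v + t *\<^sub>R a + s *\<^sub>R b)) 0) has_real_derivative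
      FD (\<lambda>z. FD (Lhat c) z ?b) ?z ?a) (at 0)"
    by (rule has_field_derivative_transform_within_open[OF _ oT]) (use zD 1 in \<open>auto simp: vimage_def zero_prod_def[symmetric]\<close>)
  then show ?thesis by (simp add: fundamental_tensor_def DERIV_imp_deriv m.fund_def)
qed

text \<open>The substance is \<open>metric\<close>. The equation for \<open>g\<close> is evaluated
  on fields with constant components, the first argument of \<open>g\<close> being a field through
  the base vector, so that all covariant derivatives reduce to \<open>\<Gamma>\<close>.\<close>

lemma model:
  assumes c: "c \<in> M"
  shows "finsler_connection_model (dom c) (Lhat c) (\<Gamma> c)"
proof -
  note mc = mchart_atlas[OF c]
  interpret m: finsler_model "dom c" "Lhat c" by (rule model0[OF c])
  show ?thesis
  proof (intro finsler_connection_model.intro finsler_connection_model_axioms.intro)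
    show "finsler_model (dom c) (Lhat c)" by (rule model0[OF c])
    show "Cinf (dom c) (\<lambda>z. \<Gamma> c z u w)" for u w by (rule Gam_smooth[OF c])
    show "linear (\<lambda>u. \<Gamma> c z u w)" for z w by (rule Gam_linear1)
    show "linear (\<lambda>w. \<Gamma> c z u w)" for z u by (rule Gam_linear2)
    fix z u w assume z: "z \<in> dom c"
    show "\<Gamma> c z u w = \<Gamma> c z w u" by (rule Gam_sym[OF c z])
    define v where "v = bundle_inv M c z"
    have v: "v \<in> A" "fst v \<in> cdom c" "bundle_map M c v = z"
      using z bundle_image_iff[OF mc] mc by (auto simp: v_def bundle_map_inv) (auto simp: bundle_inv_def)
    obtain E where E: "\<And>u. E u \<in> VF" "\<And>u. tcoord M c (fst v) (E u (fst v)) = u"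
      "\<And>u. FD (vrep M c (E u)) (cmap c (fst v)) = (\<lambda>_. 0)" "\<And>u. \<forall>\<^sub>F q in nhds (fst v). E u q = tvec M c q u"
      by (rule const_frame[OF mc v(2)]) (rule that)
    have Yp: "E (snd z) (fst v) = snd v"
      using tcoord_inject[OF mc v(2), of "E (snd z) (fst v)" "snd v"] E(2) v(3) by auto
    have "\<forall>\<^sub>F q in nhds (fst v). q \<in> cdom c \<and> E (snd z) q = tvec M c q (snd z) \<and> E w q = tvec M c q w"
      by (intro eventually_conj E(4) eventually_nhds_in_open mchart_open mc v)
    then obtain N where N: "open N" "fst v \<in> N" "N \<subseteq> cdom c"
      "\<And>q. q \<in> N \<Longrightarrow> E (snd z) q = tvec M c q (snd z) \<and> E w q = tvec M c q w"
      unfolding eventually_nhds by blast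
    define h where "h = (\<lambda>u. g u (E (snd z) (fst u)) (E w (fst u)))"
    define U where "U = dom c \<inter> fst -` (cmap c ` N)"
    have oU: "open U" unfolding U_def by (intro open_Int open_vimage_fst dom_open c mchart_open_image' mc N)
    have "fst z = cmap c (fst v)" using v(3) by auto
    then have zU: "z \<in> U" using z N(2) by (auto simp: U_def)
    have hU: "fnd c z' (snd z) w = h (bundle_inv M c z')" if z': "z' \<in> U" for z'
    proof -
      let ?v = "bundle_inv M c z'"
      obtain q where q: "q \<in> N" "fst z' = cmap c q" using z' by (auto simp: U_def)
      then have qc: "q \<in> cdom c" "fst ?v = q" using N(3) mc by (auto simp: bundle_inv_def subset_iff)
      have "?v \<in> A" "bundle_map M c ?v = z'"
        using z' bundle_image_iff[OF mc, of z' A] mc by (auto simp: U_def bundle_map_inv)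
      then show ?thesis
        using fundamental_tensor_chart[OF c, of ?v] qc N(4)[OF q(1)] mc by (simp add: h_def)
    qed
    have hs: "Cinf U (\<lambda>z. h (bundle_inv M c z))"
      by (rule Cinf_cong[OF Cinf_subset[OF m.fund_smooth oU] hU]) (auto simp: U_def)
    have 1: "nabla_fun M A nabla (E u) h v = FD (\<lambda>y. fnd c y (snd z) w) z (u, - \<Gamma> c z u (snd z))"
      using nabla_fun_chart[OF c v(1,2) E(1)[of u] hs] zU v(3) E(2)
        FD_cong[OF Cinf_differentiable[OF m.fund_smooth z] oU zU hU] by simp
    have n: "tcoord M c (fst v) (nabla v (E u) (E y)) = \<Gamma> c z u y" for y
      using nabla_chart[OF mc v(1,2) E(1) E(1), of u y] E(2,3) v(3) by simp
    have "nabla_tensor2 M A nabla (E u) g v (E (snd z)) (E w) = Q v (E u (fst v)) (snd v) (E w (fst v))"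
      using metric_eq v(1) E(1) unfolding nabla_metric_eq_def Yp[symmetric] by blast
    \<comment> \<open>Symmetry of \<open>Q\<close> moves the base vector from the second slot to the
      first, where \<open>Q\<close> vanishes.\<close>
    also have "\<dots> = 0" using Q_sym Q_vanish v(1) unfolding symmetric3_def by metis
    finally have "nabla_fun M A nabla (E u) h v
        = g v (nabla v (E u) (E (snd z))) (E w (fst v)) + g v (E (snd z) (fst v)) (nabla v (E u) (E w))"
      by (simp add: nabla_tensor2_def h_def)
    then show "FD (\<lambda>y. fnd c y (snd z) w) z (u, - \<Gamma> c z u (snd z)) =
      fnd c z (\<Gamma> c z u (snd z)) w + fnd c z (snd z) (\<Gamma> c z u w)"
      unfolding 1 fundamental_tensor_chart[OF c v(1,2)] v(3) n E(2) .
  qed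
qed

text \<open>The extensions chosen by \<open>vec_ext\<close> contribute derivatives that all have to
  disappear: second derivatives of \<open>Z\<close> by symmetry, first derivatives of
  \<open>X\<close> and \<open>Y\<close> against the bracket term, and first derivatives of
  \<open>Z\<close> inside \<open>\<Gamma>\<close> in pairs under the exchange of \<open>X\<close>
  and \<open>Y\<close>.\<close>

lemma curvature_chart:
  assumes c: "c \<in> M" and v: "v \<in> A" "fst v \<in> cdom c"
  shows "tcoord M c (fst v) (curvature M A nabla v x y w) =
    finsler_connection_model.curv (\<Gamma> c) (bundle_map M c v)
      (tcoord M c (fst v) x) (tcoord M c (fst v) y) (tcoord M c (fst v) w)"
proof -
  note mc = mchart_atlas[OF c]
  interpret m: finsler_connection_model "dom c" "Lhat c" "\<Gamma> c" by (rule model[OF c])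
  let ?p = "fst v" and ?x0 = "cmap c (fst v)" and ?tc = "tcoord M c (fst v)"
  define z where "z = bundle_map M c v"
  have zD: "z \<in> dom c" unfolding z_def by (rule bundle_map_mem[OF mc v])
  have z1: "fst z = ?x0" by (simp add: z_def)
  define X where "X = vec_ext M ?p x"
  define Y where "Y = vec_ext M ?p y"
  define Z where "Z = vec_ext M ?p w"
  have VF: "X \<in> VF" "Y \<in> VF" "Z \<in> VF" and p: "X ?p = x" "Y ?p = y" "Z ?p = w"
    by (simp_all add: X_def Y_def Z_def vec_ext)
  have dv: "(vrep M c B has_derivative FD (vrep M c B) ?x0) (at ?x0)" if "B \<in> VF" for B
    by (rule Cinf_has_derivative[OF vector_field_Cinf[OF that mc]]) (use v in auto)
  have fstd: "((\<lambda>z'. vrep M c B (fst z')) has_derivative (\<lambda>k. FD (vrep M c B) ?x0 (fst k))) (at z)" if "B \<in> VF" for B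
    using diff_chain_at[OF has_derivative_fst[OF has_derivative_ident], of "vrep M c B" _ z] dv[OF that] z1 by (simp add: o_def)
  have repat: "vrep M c B (fst z) = ?tc (B ?p)" for B using mc v z1 by simp
  have ar: "arep c (\<lambda>u. nabla u B Z) z' = FD (vrep M c Z) (fst z') (vrep M c B (fst z')) + \<Gamma> c z' (vrep M c B (fst z')) (vrep M c Z (fst z'))"
    if "z' \<in> dom c" "B \<in> VF" for z' B
  proof -
    let ?v = "bundle_inv M c z'"
    have "?v \<in> A" "bundle_map M c ?v = z'" "fst ?v \<in> cdom c" "cinv c (fst z') = fst ?v" "cmap c (fst ?v) = fst z'"
      using that bundle_image_iff[OF mc, of z' A] mc by (auto simp: bundle_map_inv) (auto simp: bundle_inv_def)
    then show ?thesis
      using nabla_chart[OF mc, of ?v B Z] that(2) VF(3) by (simp add: arep_def vrep_def)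
  qed
  have D: "FD (arep c (\<lambda>u. nabla u B Z)) z (a, b) =
      FD (\<lambda>x. FD (vrep M c Z) x (?tc (B ?p))) ?x0 a + FD (vrep M c Z) ?x0 (FD (vrep M c B) ?x0 a)
      + (FD (\<lambda>z. \<Gamma> c z (?tc (B ?p)) (?tc w)) z (a, b)
         + \<Gamma> c z (FD (vrep M c B) ?x0 a) (?tc w) + \<Gamma> c z (?tc (B ?p)) (FD (vrep M c Z) ?x0 a))"
    if B: "B \<in> VF" for B a b
  proof -
    have "((\<lambda>z'. FD (vrep M c Z) (fst z') (vrep M c B (fst z')) + \<Gamma> c z' (vrep M c B (fst z')) (vrep M c Z (fst z'))) has_derivative
      (\<lambda>k. (FD (\<lambda>x. FD (vrep M c Z) x (?tc (B ?p))) ?x0 (fst k) + FD (vrep M c Z) ?x0 (FD (vrep M c B) ?x0 (fst k)))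
      + (FD (\<lambda>z. \<Gamma> c z (?tc (B ?p)) (?tc w)) z k
         + \<Gamma> c z (FD (vrep M c B) ?x0 (fst k)) (?tc w) + \<Gamma> c z (?tc (B ?p)) (FD (vrep M c Z) ?x0 (fst k))))) (at z)"
      using has_derivative_add[OF
         has_derivative_FD_apply[OF vector_field_Cinf[OF VF(3) mc], of fst z fst UNIV "\<lambda>z'. vrep M c B (fst z')", OF _ _ fstd[OF B]]
         m.has_derivative_Gam[of "\<lambda>z. z" z "\<lambda>z. z" UNIV, OF _ _ fstd[OF B] fstd[OF VF(3)]]] zD v
      unfolding z1 by (simp add: z1 has_derivative_fst mc p(3))
    then have "(arep c (\<lambda>u. nabla u B Z) has_derivative
      (\<lambda>k. (FD (\<lambda>x. FD (vrep M c Z) x (?tc (B ?p))) ?x0 (fst k) + FD (vrep M c Z) ?x0 (FD (vrep M c B) ?x0 (fst k)))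
      + (FD (\<lambda>z. \<Gamma> c z (?tc (B ?p)) (?tc w)) z k
         + \<Gamma> c z (FD (vrep M c B) ?x0 (fst k)) (?tc w) + \<Gamma> c z (?tc (B ?p)) (FD (vrep M c Z) ?x0 (fst k))))) (at z)"
      by (rule has_derivative_transform_within_open[OF _ dom_open[OF c] zD]) (simp add: ar B)
    from FD_eqI[OF this] show ?thesis by simp
  qed
  have F: "?tc (nabla_field M A nabla B (\<lambda>u. nabla u C Z) v) =
      FD (arep c (\<lambda>u. nabla u C Z)) z (?tc (B ?p), - \<Gamma> c z (?tc (B ?p)) (snd z))
      + \<Gamma> c z (?tc (B ?p)) (FD (vrep M c Z) ?x0 (?tc (C ?p)) + \<Gamma> c z (?tc (C ?p)) (?tc w))"
    if "B \<in> VF" "C \<in> VF" for B C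
    using nabla_field_chart[OF c v that(1) conn_aniso_field[OF that(2) VF(3)]] ar[OF zD that(2)]
    unfolding z_def[symmetric] z1 using mc v(2) p(3) by simp
  have br: "?tc (nabla v (lie_bracket M X Y) Z) = FD (vrep M c Z) ?x0 (FD (vrep M c Y) ?x0 (?tc x) - FD (vrep M c X) ?x0 (?tc y))
      + \<Gamma> c z (FD (vrep M c Y) ?x0 (?tc x) - FD (vrep M c X) ?x0 (?tc y)) (?tc w)"
    using nabla_chart[OF mc v lie_bracket_vf[OF VF(1,2)] VF(3)] lie_bracket_chart[OF mc v(2) VF(1,2)] p by (simp add: z_def)
  have sym: "FD (\<lambda>y. FD (vrep M c Z) y a) ?x0 b = FD (\<lambda>y. FD (vrep M c Z) y b) ?x0 a" for a b
    by (rule FD_symmetric[OF vector_field_Cinf[OF VF(3) mc]]) (use v in auto)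
  have l: "linear (FD (vrep M c Z) ?x0)" using dv[OF VF(3)] by (rule has_derivative_linear)
  have "?tc (curvature M A nabla v x y w) = ?tc (nabla_field M A nabla X (\<lambda>u. nabla u Y Z) v)
      - ?tc (nabla_field M A nabla Y (\<lambda>u. nabla u X Z) v) - ?tc (nabla v (lie_bracket M X Y) Z)"
    by (simp add: curvature_def curvature_fields_def X_def Y_def Z_def linear_diff[OF linear_tcoord[OF mc v(2)]])
  also have "\<dots> = m.curv z (?tc x) (?tc y) (?tc w)"
    unfolding F[OF VF(1,2)] F[OF VF(2,1)] D[OF VF(1)] D[OF VF(2)] br p m.curv_def
    using sym[of "?tc x" "?tc y"]
    by (simp add: linear_add[OF Gam_linear2] linear_diff[OF Gam_linear1] linear_diff[OF l])
  finally show ?thesis by (simp add: z_def)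
qed

end

section \<open>Curves and variations in charts\<close>

lemma Icc_not_bot: "c < d \<Longrightarrow> t \<in> {c..d} \<Longrightarrow> at t within {c..d} \<noteq> bot" for t :: real
  by (simp add: trivial_limit_within)

lemma velocity_at_within: "at t within S = at t within S' \<Longrightarrow> velocity M S \<gamma> t = velocity M S' \<gamma> t"
  by (simp add: velocity_def)

lemma velocity_cong:
  assumes "\<forall>\<^sub>F \<tau> in nhds t. \<tau> \<in> S \<longrightarrow> \<gamma> \<tau> = \<beta> \<tau>" "t \<in> S"
  shows "velocity M S \<gamma> t = velocity M S \<beta> t"
proof -
  have "\<gamma> t = \<beta> t" using eventually_nhds_x_imp_x[OF assms(1)] assms(2) by simp
  moreover have "vector_derivative (cmap c \<circ> \<gamma>) (at t within S) = vector_derivative (cmap c \<circ> \<beta>) (at t within S)"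
    for c :: "('a, 'b) chart"
  proof (rule vector_derivative_cong_eq[OF _ refl refl assms(2)])
    show "\<forall>\<^sub>F \<tau> in nhds t. \<tau> \<in> S \<longrightarrow> (cmap c \<circ> \<gamma>) \<tau> = (cmap c \<circ> \<beta>) \<tau>"
      using assms(1) by eventually_elim simp
  qed
  ultimately show ?thesis by (simp add: velocity_def)
qed

context smooth_mfd
begin

lemma velocity_chart:
  assumes c: "mchart M c" "\<gamma> t \<in> cdom c" and nb: "at t within S \<noteq> bot" and t: "t \<in> S"
    and cont: "(\<gamma> \<longlongrightarrow> \<gamma> t) (at t within S)"
    and d: "((\<lambda>\<tau>. cmap c (\<gamma> \<tau>)) has_vector_derivative x) (at t within S)"
  shows "tcoord M c (\<gamma> t) (velocity M S \<gamma> t) = x"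
proof -
  let ?e = "chart_at M (\<gamma> t)"
  have e: "mchart M ?e" "\<gamma> t \<in> cdom ?e" using chart_at by auto
  have td: "tr c ?e differentiable at (cmap c (\<gamma> t))" by (rule tr_differentiable[OF c(1) e(1) c(2) e(2)])
  have "((\<lambda>\<tau>. tr c ?e (cmap c (\<gamma> \<tau>))) has_vector_derivative FD (tr c ?e) (cmap c (\<gamma> t)) x) (at t within S)"
    using diff_chain_within[OF d[unfolded has_vector_derivative_def] has_derivative_at_withinI[OF FD_has_derivative[OF td]]]
    by (simp add: o_def has_vector_derivative_def linear_cmul[OF linear_frechet_derivative[OF td]])
  moreover have "\<forall>\<^sub>F \<tau> in at t within S. \<gamma> \<tau> \<in> cdom c"
    using topological_tendstoD[OF cont mchart_open[OF c(1)] c(2)] .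
  then have "\<forall>\<^sub>F \<tau> in at t within S. tr c ?e (cmap c (\<gamma> \<tau>)) = (cmap ?e \<circ> \<gamma>) \<tau>"
    by eventually_elim (use c in auto)
  ultimately have "((cmap ?e \<circ> \<gamma>) has_vector_derivative FD (tr c ?e) (cmap c (\<gamma> t)) x) (at t within S)"
    by (rule has_vector_derivative_transform_eventually) (use c t in auto)
  then have "velocity M S \<gamma> t = tvec M c (\<gamma> t) x"
    unfolding velocity_def tvec_FD by (rule vector_derivative_within[OF nb])
  then show ?thesis using c by simp
qed

text \<open>The smooth extension provided by \<open>smooth_into\<close> agrees with the coordinates
  only at points mapped into the chart. Continuity shrinks the neighbourhood until this is the case
  for all its points in \<open>S\<close>.\<close>

lemma strip_local:
  assumes sm: "smooth_into M S \<Lambda>" and y: "y \<in> S" and e: "e \<in> M" "\<Lambda> y \<in> cdom e"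
  obtains U F where "y \<in> U" "Cinf U F" "\<And>y'. y' \<in> U \<inter> S \<Longrightarrow> \<Lambda> y' \<in> cdom e \<and> F y' = cmap e (\<Lambda> y')"
proof -
  have "smooth_on {x \<in> S. \<Lambda> x \<in> cdom e} (cmap e \<circ> \<Lambda>)" "continuous_on S \<Lambda>"
    using sm e by (auto simp: smooth_into_def)
  then obtain U F where U: "y \<in> U" "Cinf U F" "\<And>y'. y' \<in> U \<inter> {x \<in> S. \<Lambda> x \<in> cdom e} \<Longrightarrow> F y' = (cmap e \<circ> \<Lambda>) y'"
    using smooth_onE[of "{x \<in> S. \<Lambda> x \<in> cdom e}" "cmap e \<circ> \<Lambda>" y] y e by blast
  obtain N where N: "open N" "N \<inter> S = \<Lambda> -` cdom e \<inter> S"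
    using \<open>continuous_on S \<Lambda>\<close> mchart_open[OF mchart_atlas[OF e(1)]] unfolding continuous_on_open_invariant by blast
  show ?thesis
    by (rule that[of "U \<inter> N" F]) (use U N y e Cinf_subset[OF U(2) open_Int[OF Cinf_open[OF U(2)] N(1)]] in auto)
qed

end

context aniso_conn
begin

lemma christoffel_chart_at:
  assumes "fst v = p"
  shows "(\<Sum>i\<in>Basis. \<Sum>j\<in>Basis. ((x \<bullet> i) * (y \<bullet> j)) *\<^sub>R christoffel M nabla (chart_at M p) v i j) =
    \<Gamma> (chart_at M p) (bundle_map M (chart_at M p) v) x y"
  using assms chart_at(2)[of p] by (simp add: Gam_def)

lemma cov_deriv_chart_at:
  fixes \<gamma> :: "real \<Rightarrow> 'm"
  assumes v: "fst v = \<gamma> t" and nb: "at t within S \<noteq> bot"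
    and d: "((\<lambda>\<tau>. tcoord M (chart_at M (\<gamma> t)) (\<gamma> \<tau>) (X \<tau>)) has_vector_derivative x') (at t within S)"
  shows "cov_deriv_along M nabla S \<gamma> v X t =
    x' + \<Gamma> (chart_at M (\<gamma> t)) (bundle_map M (chart_at M (\<gamma> t)) v) (velocity M S \<gamma> t) (X t)"
  unfolding cov_deriv_along_def Let_def christoffel_chart_at[OF v] vector_derivative_within[OF nb d] ..

text \<open>The acceleration of a curve is a vector, although neither the second derivative of its coordinates
  nor the Christoffel term is.\<close>

lemma acceleration_chart:
  fixes \<beta> :: "real \<Rightarrow> 'm" and f :: "real \<Rightarrow> 'e"
  assumes e: "e \<in> M" and f: "Cinf J f" "s \<in> J" "\<And>\<sigma>. \<sigma> \<in> J \<Longrightarrow> \<beta> \<sigma> \<in> cdom e \<and> cmap e (\<beta> \<sigma>) = f \<sigma>"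
    and v: "v \<in> A" "fst v = \<beta> s" and cont: "\<And>\<sigma>. \<sigma> \<in> J \<Longrightarrow> isCont \<beta> \<sigma>"
  shows "tcoord M e (\<beta> s) (cov_deriv_along M nabla UNIV \<beta> v (velocity M UNIV \<beta>) s) =
    FD (\<lambda>\<sigma>. FD f \<sigma> 1) s 1 + \<Gamma> e (bundle_map M e v) (FD f s 1) (FD f s 1)"
proof -
  note me = mchart_atlas[OF e]
  let ?h = "chart_at M (\<beta> s)"
  have h: "?h \<in> M" "mchart M ?h" "\<beta> s \<in> cdom ?h" using chart_at by auto
  have se: "\<beta> s \<in> cdom e" "cmap e (\<beta> s) = f s" using f by auto
  let ?\<phi> = "tr e ?h"
  have \<phi>: "Cinf (cmap e ` (cdom e \<inter> cdom ?h)) ?\<phi>" by (rule tr_Cinf[OF me h(2)])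
  have fd: "(f has_vector_derivative FD f \<sigma> 1) (at \<sigma>)" if "\<sigma> \<in> J" for \<sigma>
    using Cinf_differentiable[OF f(1) that]
    by (simp add: frechet_derivative_eq_vector_derivative vector_derivative_works[symmetric])
  have vel: "tcoord M e (\<beta> \<sigma>) (velocity M UNIV \<beta> \<sigma>) = FD f \<sigma> 1" if \<sigma>: "\<sigma> \<in> J" for \<sigma>
  proof (rule velocity_chart[OF me])
    show "(\<beta> \<longlongrightarrow> \<beta> \<sigma>) (at \<sigma>)" using cont[OF \<sigma>] by (simp add: isCont_def)
    show "((\<lambda>\<tau>. cmap e (\<beta> \<tau>)) has_vector_derivative FD f \<sigma> 1) (at \<sigma>)"
      by (rule has_vector_derivative_transform_within_open[OF fd[OF \<sigma>] Cinf_open[OF f(1)] \<sigma>]) (use f(3) in auto)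
  qed (use f(3)[OF \<sigma>] in auto)
  define J' where "J' = J \<inter> f -` (cmap e ` (cdom e \<inter> cdom ?h))"
  have "open J'"
    unfolding J'_def by (rule continuous_open_preimage[OF Cinf_continuous_on[OF f(1)] Cinf_open[OF f(1)] Cinf_open[OF \<phi>]])
  have sJ': "s \<in> J'" using f(2) se h(3) by (auto simp: J'_def intro!: image_eqI[of _ _ "\<beta> s"])
  have inh: "\<beta> \<sigma> \<in> cdom ?h" if "\<sigma> \<in> J'" for \<sigma>
    using that f(3)[of \<sigma>] mchart_inject[OF me, of "\<beta> \<sigma>"] by (auto simp: J'_def)
  have df: "(f has_derivative FD f s) (at s)" "((\<lambda>\<sigma>. FD f \<sigma> 1) has_derivative FD (\<lambda>\<sigma>. FD f \<sigma> 1) s) (at s)"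
    using Cinf_has_derivative[OF f(1,2)] Cinf_has_derivative[OF Cinf_FD[OF f(1)] f(2)] by auto
  have fs: "f s \<in> cmap e ` (cdom e \<inter> cdom ?h)" using sJ' by (simp add: J'_def)
  have "((\<lambda>\<sigma>. FD ?\<phi> (f \<sigma>) (FD f \<sigma> 1)) has_derivative
      (\<lambda>u. FD (\<lambda>x. FD ?\<phi> x (FD f s 1)) (f s) (FD f s u) + FD ?\<phi> (f s) (FD (\<lambda>\<sigma>. FD f \<sigma> 1) s u))) (at s)"
    by (rule has_derivative_FD_apply[OF \<phi> fs df]) simp
  then have "((\<lambda>\<sigma>. tcoord M ?h (\<beta> \<sigma>) (velocity M UNIV \<beta> \<sigma>)) has_derivative
      (\<lambda>u. FD (\<lambda>x. FD ?\<phi> x (FD f s 1)) (f s) (FD f s u) + FD ?\<phi> (f s) (FD (\<lambda>\<sigma>. FD f \<sigma> 1) s u))) (at s)"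
  proof (rule has_derivative_transform_within_open[OF _ \<open>open J'\<close> sJ'])
    fix \<sigma> assume "\<sigma> \<in> J'"
    then show "FD ?\<phi> (f \<sigma>) (FD f \<sigma> 1) = tcoord M ?h (\<beta> \<sigma>) (velocity M UNIV \<beta> \<sigma>)"
      using tcoord_change[OF me h(2) _ inh, of \<sigma> "velocity M UNIV \<beta> \<sigma>"] vel f(3)[of \<sigma>] by (simp add: J'_def)
  qed
  then have dv: "((\<lambda>\<sigma>. tcoord M ?h (\<beta> \<sigma>) (velocity M UNIV \<beta> \<sigma>)) has_vector_derivative
      FD (\<lambda>x. FD ?\<phi> x (FD f s 1)) (f s) (FD f s 1) + FD ?\<phi> (f s) (FD (\<lambda>\<sigma>. FD f \<sigma> 1) s 1)) (at s)"
    by (rule has_derivative_imp_vector_derivative)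
  let ?W = "FD f s 1"
  have vh: "velocity M UNIV \<beta> s = FD ?\<phi> (f s) ?W"
    using tcoord_change[OF me h(2) se(1) h(3), of "velocity M UNIV \<beta> s"] vel[OF f(2)] se(2) by simp
  have "cov_deriv_along M nabla UNIV \<beta> v (velocity M UNIV \<beta>) s =
      FD (\<lambda>x. FD ?\<phi> x ?W) (f s) ?W + FD ?\<phi> (f s) (FD (\<lambda>\<sigma>. FD f \<sigma> 1) s 1)
      + \<Gamma> ?h (bundle_map M ?h v) (FD ?\<phi> (f s) ?W) (FD ?\<phi> (f s) ?W)"
    using cov_deriv_chart_at[OF v(2) _ dv] by (simp add: vh)
  \<comment> \<open>The Hessian of the transition map is precisely the inhomogeneous term of
    \<open>Gam_change\<close>, so it is absorbed.\<close>
  also have "\<dots> = FD ?\<phi> (f s) (FD (\<lambda>\<sigma>. FD f \<sigma> 1) s 1 + \<Gamma> e (bundle_map M e v) ?W ?W)"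
    using Gam_change[OF e h(1) v(1), of ?W ?W] v(2) se h(3) linear_add[OF Cinf_linear_FD[OF \<phi> fs]] by simp
  finally have "FD ?\<phi> (f s) (tcoord M e (\<beta> s) (cov_deriv_along M nabla UNIV \<beta> v (velocity M UNIV \<beta>) s)) =
     FD ?\<phi> (f s) (FD (\<lambda>\<sigma>. FD f \<sigma> 1) s 1 + \<Gamma> e (bundle_map M e v) ?W ?W)"
    using tcoord_change[OF me h(2) se(1) h(3)] se(2) by simp
  then have "FD (tr ?h e) (cmap ?h (\<beta> s)) (FD ?\<phi> (cmap e (\<beta> s)) (tcoord M e (\<beta> s) (cov_deriv_along M nabla UNIV \<beta> v (velocity M UNIV \<beta>) s))) =
     FD (tr ?h e) (cmap ?h (\<beta> s)) (FD ?\<phi> (cmap e (\<beta> s)) (FD (\<lambda>\<sigma>. FD f \<sigma> 1) s 1 + \<Gamma> e (bundle_map M e v) ?W ?W))"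
    using se by simp
  then show ?thesis
    unfolding FD_tr_compose[OF me h(2) me se(1) h(3) se(1)] FD_tr_self[OF me se(1)] .
qed

end

subsection \<open>Differentiation under the integral sign\<close>

text \<open>The variable \<open>s\<close> runs over an open interval, so its derivative is two-sided
  even when \<open>t\<close> is an endpoint of \<open>{c..d}\<close>, and any local smooth extension
  \<open>F\<close> computes it.\<close>

lemma strip_derivative:
  fixes f :: "real \<times> real \<Rightarrow> real"
  assumes "Cinf U F" "\<And>y. y \<in> U \<inter> {c..d} \<times> {-\<epsilon><..<\<epsilon>} \<Longrightarrow> F y = f y"
    "(t, s) \<in> U" "t \<in> {c..d}" "s \<in> {-\<epsilon><..<\<epsilon>}"
  shows "((\<lambda>s. f (t, s)) has_real_derivative FD F (t, s) (0, 1)) (at s)"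
proof -
  have "((\<lambda>\<sigma>. F (t, \<sigma>)) has_vector_derivative FD F (t, s) (0, 1)) (at s)"
    by (rule partial_derivative_2[OF Cinf_differentiable[OF assms(1,3)]])
  moreover have "open ((\<lambda>\<sigma>. (t, \<sigma>)) -` U \<inter> {-\<epsilon><..<\<epsilon>})"
    by (intro open_Int open_vimage Cinf_open[OF assms(1)] continuous_intros open_greaterThanLessThan)
  ultimately have "((\<lambda>\<sigma>. f (t, \<sigma>)) has_vector_derivative FD F (t, s) (0, 1)) (at s)"
    by (rule has_vector_derivative_transform_within_open) (use assms in auto)
  then show ?thesis by (simp add: has_real_derivative_iff_has_vector_derivative)
qed

text \<open>The \<open>s\<close>-derivative is again smooth on the strip, so the lemma can be
  applied twice, once for each derivative of the energy. Continuity on the strip justifies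
  differentiation under the integral sign.\<close>

lemma smooth_strip_derivative:
  fixes f :: "real \<times> real \<Rightarrow> real"
  assumes sm: "smooth_on ({c..d} \<times> {-\<epsilon><..<\<epsilon>}) f"
  defines "f1 \<equiv> \<lambda>y. deriv (\<lambda>s. f (fst y, s)) (snd y)"
  shows "smooth_on ({c..d} \<times> {-\<epsilon><..<\<epsilon>}) f1"
    and "\<And>t s. t \<in> {c..d} \<Longrightarrow> s \<in> {-\<epsilon><..<\<epsilon>} \<Longrightarrow> ((\<lambda>s. f (t, s)) has_real_derivative f1 (t, s)) (at s)"
    and "\<And>s. s \<in> {-\<epsilon><..<\<epsilon>} \<Longrightarrow>
      ((\<lambda>s. integral {c..d} (\<lambda>t. f (t, s))) has_real_derivative integral {c..d} (\<lambda>t. f1 (t, s))) (at s)"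
proof -
  let ?I = "{-\<epsilon><..<\<epsilon>}"
  show sm1: "smooth_on ({c..d} \<times> ?I) f1"
  proof (rule smooth_onI)
    fix y assume y: "y \<in> {c..d} \<times> ?I"
    obtain U F where U: "y \<in> U" "Cinf U F" "\<And>y. y \<in> U \<inter> {c..d} \<times> ?I \<Longrightarrow> F y = f y"
      using smooth_onE[OF sm y] by blast
    have "FD F y' (0, 1) = f1 y'" if y': "y' \<in> U \<inter> {c..d} \<times> ?I" for y'
    proof -
      obtain t s where ts: "y' = (t, s)" "(t, s) \<in> U" "t \<in> {c..d}" "s \<in> ?I" using y' by auto
      from DERIV_imp_deriv[OF strip_derivative[OF U(2,3) ts(2-4)]] show ?thesis by (simp add: f1_def ts(1))
    qed
    then show "\<exists>U F. y \<in> U \<and> Cinf U F \<and> (\<forall>y\<in>U \<inter> {c..d} \<times> ?I. F y = f1 y)"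
      using Cinf_FD[OF U(2)] U(1) by blast
  qed
  show d: "((\<lambda>s. f (t, s)) has_real_derivative f1 (t, s)) (at s)" if "t \<in> {c..d}" "s \<in> ?I" for t s
  proof -
    have "(t, s) \<in> {c..d} \<times> ?I" using that by simp
    then obtain U F where U: "(t, s) \<in> U" "Cinf U F" "\<And>y. y \<in> U \<inter> {c..d} \<times> ?I \<Longrightarrow> F y = f y"
      using smooth_onE[OF sm] by blast
    from strip_derivative[OF U(2,3,1) that] show ?thesis by (simp add: f1_def DERIV_imp_deriv)
  qed
  show "((\<lambda>s. integral {c..d} (\<lambda>t. f (t, s))) has_real_derivative integral {c..d} (\<lambda>t. f1 (t, s))) (at s)"
    if s: "s \<in> ?I" for s
  proof -
    have sw: "continuous_on (?I \<times> {c..d}) (\<lambda>(s, t). h (t, s))" if "smooth_on ({c..d} \<times> ?I) h" for h :: "real \<times> real \<Rightarrow> real"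
      unfolding case_prod_unfold
      by (rule continuous_on_compose2[OF smooth_on_continuous[OF that]]) (auto intro!: continuous_intros)
    have "((\<lambda>s. integral (cbox c d) (\<lambda>t. f (t, s))) has_real_derivative integral (cbox c d) (\<lambda>t. f1 (t, s))) (at s within ?I)"
    proof (rule leibniz_rule_field_derivative)
      show "((\<lambda>s. f (t, s)) has_real_derivative f1 (t, s)) (at s within ?I)" if "s \<in> ?I" "t \<in> cbox c d" for s t
        using d[of t s] that by (auto intro: has_field_derivative_at_within)
      show "(\<lambda>t. f (t, s)) integrable_on cbox c d" if "s \<in> ?I" for s
        by (rule integrable_continuous, rule continuous_on_compose2[OF smooth_on_continuous[OF sm]])
          (use that in \<open>auto intro!: continuous_intros\<close>)
      show "continuous_on (?I \<times> cbox c d) (\<lambda>(s, t). f1 (t, s))" using sw[OF sm1] by simp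
    qed (use s in auto)
    then show ?thesis using s at_within_open[of s ?I] by simp
  qed
qed

lemma smooth_strip_integrable:
  fixes f :: "real \<times> real \<Rightarrow> real"
  assumes "smooth_on ({c..d} \<times> {-\<epsilon><..<\<epsilon>}) f" "s \<in> {-\<epsilon><..<\<epsilon>}"
  shows "(\<lambda>t. f (t, s)) integrable_on {c..d}"
  by (rule integrable_continuous_real, rule continuous_on_compose2[OF smooth_on_continuous[OF assms(1)]])
    (use assms in \<open>auto intro!: continuous_intros\<close>)

section \<open>Smooth strips of a variation\<close>

text \<open>The part of a variation over one interval free of interior breaks. Velocities are taken
  within \<open>{c..d}\<close> and are therefore one-sided at its ends.\<close>

locale strip = pseudo_finsler_mfd M A nabla L Q
  for M :: "('m::t2_space, 'e::euclidean_space) chart set" and A nabla L Q +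
  fixes c d \<epsilon> :: real and \<Lambda> :: "real \<times> real \<Rightarrow> 'm"
  assumes cd: "c < d" and eps: "0 < \<epsilon>"
    and strip_smooth: "smooth_into M ({c..d} \<times> {-\<epsilon><..<\<epsilon>}) \<Lambda>"
    and strip_adm: "\<And>t s. t \<in> {c..d} \<Longrightarrow> s \<in> {-\<epsilon><..<\<epsilon>} \<Longrightarrow> velocity_lift M {c..d} (\<lambda>t. \<Lambda> (t, s)) t \<in> A"
begin

abbreviation "I \<equiv> {-\<epsilon><..<\<epsilon>}"
abbreviation "vel t s \<equiv> velocity M {c..d} (\<lambda>t. \<Lambda> (t, s)) t"
abbreviation "tvel t s \<equiv> velocity M UNIV (\<lambda>s. \<Lambda> (t, s)) s"

lemma strip_cont: "continuous_on ({c..d} \<times> I) \<Lambda>"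
  using strip_smooth by (simp add: smooth_into_def)

lemma strip_cont1: "t \<in> {c..d} \<Longrightarrow> s \<in> I \<Longrightarrow> ((\<lambda>t. \<Lambda> (t, s)) \<longlongrightarrow> \<Lambda> (t, s)) (at t within {c..d})"
proof -
  assume ts: "t \<in> {c..d}" "s \<in> I"
  have "continuous_on {c..d} (\<lambda>t. \<Lambda> (t, s))"
    by (rule continuous_on_compose2[OF strip_cont]) (use ts in \<open>auto intro!: continuous_intros\<close>)
  then show ?thesis using ts(1) unfolding continuous_on_def by blast
qed

lemma strip_cont2: "t \<in> {c..d} \<Longrightarrow> s \<in> I \<Longrightarrow> isCont (\<lambda>s. \<Lambda> (t, s)) s"
proof -
  assume ts: "t \<in> {c..d}" "s \<in> I"
  have "continuous_on I (\<lambda>s. \<Lambda> (t, s))"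
    by (rule continuous_on_compose2[OF strip_cont]) (use ts in \<open>auto intro!: continuous_intros\<close>)
  then show ?thesis using ts(2) by (simp add: continuous_on_eq_continuous_at)
qed

text \<open>\<open>F\<close> is a smooth extension of the coordinates of \<open>\<Lambda>\<close>
  and may live beyond the strip, where it has no geometric meaning. Its lift is still required to
  stay in the domain on all of \<open>U\<close>, so that the identities of the local model hold on
  an open set.\<close>

definition strip_chart :: "('m, 'e) chart \<Rightarrow> (real \<times> real) set \<Rightarrow> (real \<times> real \<Rightarrow> 'e) \<Rightarrow> bool" where
  "strip_chart e U F \<longleftrightarrow> Cinf U F \<and> (\<forall>y\<in>U. (F y, FD F y (1, 0)) \<in> dom e) \<and>
     (\<forall>t s. (t, s) \<in> U \<longrightarrow> t \<in> {c..d} \<longrightarrow> s \<in> I \<longrightarrow> \<Lambda> (t, s) \<in> cdom e \<and> cmap e (\<Lambda> (t, s)) = F (t, s)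
       \<and> tcoord M e (\<Lambda> (t, s)) (vel t s) = FD F (t, s) (1, 0) \<and> tcoord M e (\<Lambda> (t, s)) (tvel t s) = FD F (t, s) (0, 1))"

lemma strip_chartD:
  assumes "strip_chart e U F"
  shows "Cinf U F" "\<And>y. y \<in> U \<Longrightarrow> (F y, FD F y (1, 0)) \<in> dom e"
    "\<And>t s. (t, s) \<in> U \<Longrightarrow> t \<in> {c..d} \<Longrightarrow> s \<in> I \<Longrightarrow> \<Lambda> (t, s) \<in> cdom e \<and> cmap e (\<Lambda> (t, s)) = F (t, s)
      \<and> tcoord M e (\<Lambda> (t, s)) (vel t s) = FD F (t, s) (1, 0) \<and> tcoord M e (\<Lambda> (t, s)) (tvel t s) = FD F (t, s) (0, 1)"
  using assms by (auto simp: strip_chart_def)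

lemma strip_rep:
  assumes ts: "t0 \<in> {c..d}" "s0 \<in> I" and e: "e \<in> M" "\<Lambda> (t0, s0) \<in> cdom e"
  obtains U F where "(t0, s0) \<in> U" "strip_chart e U F"
proof -
  note me = mchart_atlas[OF e(1)]
  obtain U F where U: "(t0, s0) \<in> U" "Cinf U F"
    "\<And>y'. y' \<in> U \<inter> {c..d} \<times> I \<Longrightarrow> \<Lambda> y' \<in> cdom e \<and> F y' = cmap e (\<Lambda> y')"
    using strip_local[OF strip_smooth _ e] ts by (metis mem_Sigma_iff)
  note oU = Cinf_open[OF U(2)]
  have 1: "tcoord M e (\<Lambda> (t, s)) (vel t s) = FD F (t, s) (1, 0)" if "(t, s) \<in> U" "t \<in> {c..d}" "s \<in> I" for t s
  proof (rule velocity_chart[OF me _ Icc_not_bot[OF cd] _ strip_cont1])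
    have "((\<lambda>\<tau>. F (\<tau>, s)) has_vector_derivative FD F (t, s) (1, 0)) (at t within {c..d})"
      using partial_derivative_1[OF Cinf_differentiable[OF U(2) that(1)]] by (rule has_vector_derivative_at_within)
    moreover have "\<forall>\<^sub>F \<tau> in at t within {c..d}. F (\<tau>, s) = cmap e (\<Lambda> (\<tau>, s))"
      using eventually_slice_1[OF oU that(1)] by eventually_elim (use U(3) that in auto)
    ultimately show "((\<lambda>\<tau>. cmap e (\<Lambda> (\<tau>, s))) has_vector_derivative FD F (t, s) (1, 0)) (at t within {c..d})"
      by (rule has_vector_derivative_transform_eventually) (use U(3) that in auto)
  qed (use that U(3) in auto)
  have 2: "tcoord M e (\<Lambda> (t, s)) (tvel t s) = FD F (t, s) (0, 1)" if "(t, s) \<in> U" "t \<in> {c..d}" "s \<in> I" for t s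
  proof (rule velocity_chart[OF me])
    have "((\<lambda>\<tau>. F (t, \<tau>)) has_vector_derivative FD F (t, s) (0, 1)) (at s)"
      by (rule partial_derivative_2[OF Cinf_differentiable[OF U(2) that(1)]])
    moreover have "open ((\<lambda>\<sigma>. (t, \<sigma>)) -` U \<inter> I)"
      by (intro open_Int open_vimage oU continuous_intros open_greaterThanLessThan)
    ultimately show "((\<lambda>\<tau>. cmap e (\<Lambda> (t, \<tau>))) has_vector_derivative FD F (t, s) (0, 1)) (at s)"
      by (rule has_vector_derivative_transform_within_open) (use U(3) that in auto)
    show "((\<lambda>s. \<Lambda> (t, s)) \<longlongrightarrow> \<Lambda> (t, s)) (at s)" using strip_cont2 that by (simp add: isCont_def)
  qed (use that U(3) in auto)
  define N where "N = U \<inter> (\<lambda>y. (F y, FD F y (1, 0))) -` dom e"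
  have oN: "open N" unfolding N_def
    by (rule continuous_open_preimage[OF Cinf_continuous_on[OF Cinf_Pair[OF U(2) Cinf_FD[OF U(2)]]] oU dom_open[OF e(1)]])
  have "bundle_map M e (velocity_lift M {c..d} (\<lambda>t. \<Lambda> (t, s0)) t0) \<in> dom e"
    by (rule bundle_map_mem[OF me strip_adm[OF ts]]) (use e in \<open>simp add: velocity_lift_def\<close>)
  then have "(t0, s0) \<in> N" using U(1) U(3)[of "(t0, s0)"] 1[OF U(1) ts] ts
    by (simp add: N_def bundle_map_def velocity_lift_def)
  then show ?thesis
    by (rule that[of N F]) (use U(3) 1 2 Cinf_subset[OF U(2) oN] in \<open>auto simp: N_def strip_chart_def\<close>)
qed

section \<open>Energy density and first variation on a strip\<close>

definition edens :: "real \<times> real \<Rightarrow> real" where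
  "edens y = L (velocity_lift M {c..d} (\<lambda>t. \<Lambda> (t, snd y)) (fst y))"

lemma lift_rep:
  assumes "mchart M e" "\<Lambda> (t, s) \<in> cdom e" "cmap e (\<Lambda> (t, s)) = x" "tcoord M e (\<Lambda> (t, s)) (vel t s) = w"
  shows "bundle_map M e (velocity_lift M {c..d} (\<lambda>t. \<Lambda> (t, s)) t) = (x, w)"
    "L (velocity_lift M {c..d} (\<lambda>t. \<Lambda> (t, s)) t) = Lhat e (x, w)"
  using assms(1,2) unfolding assms(3,4)[symmetric] by (simp_all add: bundle_map_def bundle_inv_def velocity_lift_def)

lemma edens_smooth: "smooth_on ({c..d} \<times> I) edens"
proof (rule smooth_onI)
  fix y assume "y \<in> {c..d} \<times> I"
  then obtain t0 s0 where y: "y = (t0, s0)" "t0 \<in> {c..d}" "s0 \<in> I" by blast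
  let ?e = "chart_at M (\<Lambda> y)"
  obtain U F where UF: "y \<in> U" "strip_chart ?e U F"
    using strip_rep[OF y(2,3) chart_at(1)[of "\<Lambda> y"]] chart_at(2)[of "\<Lambda> y"] unfolding y(1) by blast
  note U = UF(1) strip_chartD[OF UF(2)]
  interpret m: finsler_model "dom ?e" "Lhat ?e" by (rule model0[OF chart_at(1)])
  have "Cinf U (\<lambda>y. Lhat ?e (F y, FD F y (1, 0)))"
    by (rule Cinf_compose[OF m.Lh_smooth Cinf_Pair[OF U(2) Cinf_FD[OF U(2)]] U(3)])
  moreover have "Lhat ?e (F y', FD F y' (1, 0)) = edens y'" if "y' \<in> U \<inter> {c..d} \<times> I" for y'
    using lift_rep(2)[of ?e "fst y'" "snd y'"] U(4)[of "fst y'" "snd y'"] that mem_Times_iff[of y' "{c..d}" I]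
    by (simp add: edens_def)
  ultimately show "\<exists>U F. y \<in> U \<and> Cinf U F \<and> (\<forall>y\<in>U \<inter> {c..d} \<times> I. F y = edens y)" using U(1) by blast
qed

definition edens1 :: "real \<times> real \<Rightarrow> real" where
  "edens1 y = deriv (\<lambda>s. edens (fst y, s)) (snd y)"

lemma edens1:
  shows "smooth_on ({c..d} \<times> I) edens1"
    and "\<And>t s. t \<in> {c..d} \<Longrightarrow> s \<in> I \<Longrightarrow> ((\<lambda>s. edens (t, s)) has_real_derivative edens1 (t, s)) (at s)"
    and "\<And>s. s \<in> I \<Longrightarrow>
      ((\<lambda>s. integral {c..d} (\<lambda>t. edens (t, s))) has_real_derivative integral {c..d} (\<lambda>t. edens1 (t, s))) (at s)"
  using smooth_strip_derivative[OF edens_smooth] by (simp_all add: edens1_def[abs_def])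

lemma edens1_rep:
  assumes e: "e \<in> M" and UF: "strip_chart e U F" and ts: "(t, s) \<in> U" "t \<in> {c..d}" "s \<in> I"
  shows "edens1 (t, s) = FD (\<lambda>y. Lhat e (F y, FD F y (1, 0))) (t, s) (0, 1)"
proof -
  interpret m: finsler_model "dom e" "Lhat e" by (rule model0[OF e])
  note U = strip_chartD[OF UF]
  have "Cinf U (\<lambda>y. Lhat e (F y, FD F y (1, 0)))"
    by (rule Cinf_compose[OF m.Lh_smooth Cinf_Pair[OF U(1) Cinf_FD[OF U(1)]] U(2)])
  then have "((\<lambda>s. edens (t, s)) has_real_derivative FD (\<lambda>y. Lhat e (F y, FD F y (1, 0))) (t, s) (0, 1)) (at s)"
    by (rule strip_derivative) (use ts U(3) lift_rep(2)[OF mchart_atlas[OF e]] in \<open>auto simp: edens_def\<close>)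
  then show ?thesis by (simp add: edens1_def DERIV_imp_deriv)
qed

abbreviation "T t \<equiv> velocity_lift M {c..d} (\<lambda>t. \<Lambda> (t, 0)) t"
abbreviation "W t \<equiv> tvel t 0"
abbreviation "accel t \<equiv> cov_deriv_along M nabla {c..d} (\<lambda>t. \<Lambda> (t, 0)) (T t) (\<lambda>t. vel t 0) t"

lemma zero_I: "0 \<in> I" using eps by simp

text \<open>The chart is the preferred one at \<open>\<Lambda> (t, 0)\<close>, which is the one that
  \<open>cov_deriv_along\<close> uses at \<open>t\<close>; the formulas are claimed at this
  \<open>t\<close> alone.\<close>

lemma accel_rep:
  assumes t: "t \<in> {c..d}" and UF: "(t, 0) \<in> U" "strip_chart (chart_at M (\<Lambda> (t, 0))) U F"
  defines "e \<equiv> chart_at M (\<Lambda> (t, 0))"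
  shows "accel t = FD (\<lambda>y. FD F y (1, 0)) (t, 0) (1, 0)
      + \<Gamma> e (F (t, 0), FD F (t, 0) (1, 0)) (FD F (t, 0) (1, 0)) (FD F (t, 0) (1, 0))"
    and "cov_deriv_along M nabla {c..d} (\<lambda>t. \<Lambda> (t, 0)) (T t) W t = FD (\<lambda>y. FD F y (0, 1)) (t, 0) (1, 0)
      + \<Gamma> e (F (t, 0), FD F (t, 0) (1, 0)) (FD F (t, 0) (1, 0)) (FD F (t, 0) (0, 1))"
proof -
  have me: "mchart M e" "\<Lambda> (t, 0) \<in> cdom e" by (simp_all add: e_def chart_at)
  note U' = strip_chartD[OF UF(2)]
  note U = UF(1) U'(1,3)
  have here: "vel t 0 = FD F (t, 0) (1, 0)" "W t = FD F (t, 0) (0, 1)"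
    "bundle_map M e (T t) = (F (t, 0), FD F (t, 0) (1, 0))"
    using U(3)[OF U(1) t zero_I] lift_rep(1)[OF me] by (simp_all add: e_def)
  have d: "((\<lambda>\<tau>. tcoord M e (\<Lambda> (\<tau>, 0)) (X \<tau>)) has_vector_derivative FD (\<lambda>y. FD F y h) (t, 0) (1, 0)) (at t within {c..d})"
    if "\<And>\<tau>. (\<tau>, 0) \<in> U \<Longrightarrow> \<tau> \<in> {c..d} \<Longrightarrow> tcoord M e (\<Lambda> (\<tau>, 0)) (X \<tau>) = FD F (\<tau>, 0) h" for X h
  proof -
    have "((\<lambda>\<tau>. FD F (\<tau>, 0) h) has_vector_derivative FD (\<lambda>y. FD F y h) (t, 0) (1, 0)) (at t within {c..d})"
      using partial_derivative_1[OF Cinf_differentiable[OF Cinf_FD[OF U(2)] U(1)]] by (rule has_vector_derivative_at_within)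
    moreover have "\<forall>\<^sub>F \<tau> in at t within {c..d}. FD F (\<tau>, 0) h = tcoord M e (\<Lambda> (\<tau>, 0)) (X \<tau>)"
      using eventually_slice_1[OF Cinf_open[OF U(2)] U(1)] by eventually_elim (use that in auto)
    ultimately show ?thesis
      by (rule has_vector_derivative_transform_eventually) (use that U t in auto)
  qed
  show "accel t = FD (\<lambda>y. FD F y (1, 0)) (t, 0) (1, 0)
      + \<Gamma> e (F (t, 0), FD F (t, 0) (1, 0)) (FD F (t, 0) (1, 0)) (FD F (t, 0) (1, 0))"
    using cov_deriv_chart_at[of "T t" "\<lambda>t. \<Lambda> (t, 0)" t "{c..d}" "\<lambda>t. vel t 0", OF _ Icc_not_bot[OF cd t] d[of "\<lambda>t. vel t 0" "(1, 0)", unfolded e_def]]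
      U(3) zero_I here by (simp add: velocity_lift_def e_def)
  show "cov_deriv_along M nabla {c..d} (\<lambda>t. \<Lambda> (t, 0)) (T t) W t = FD (\<lambda>y. FD F y (0, 1)) (t, 0) (1, 0)
      + \<Gamma> e (F (t, 0), FD F (t, 0) (1, 0)) (FD F (t, 0) (1, 0)) (FD F (t, 0) (0, 1))"
    using cov_deriv_chart_at[of "T t" "\<lambda>t. \<Lambda> (t, 0)" t "{c..d}" W, OF _ Icc_not_bot[OF cd t] d[of W "(0, 1)", unfolded e_def]]
      U(3) zero_I here by (simp add: velocity_lift_def e_def)
qed

lemma strip_metric:
  assumes e: "e \<in> M" and UF: "strip_chart e U F" and \<tau>: "(\<tau>, 0) \<in> U" "\<tau> \<in> {c..d}"
  shows "g (T \<tau>) x w =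
    fnd e (F (\<tau>, 0), FD F (\<tau>, 0) (1, 0)) (tcoord M e (\<Lambda> (\<tau>, 0)) x) (tcoord M e (\<Lambda> (\<tau>, 0)) w)"
  using fundamental_tensor_chart[OF e strip_adm[OF \<tau>(2) zero_I], of x w] strip_chartD(3)[OF UF \<tau> zero_I]
    lift_rep(1)[OF mchart_atlas[OF e], of \<tau> 0] by (simp add: velocity_lift_def)

text \<open>The differentiated function is chart free, so \<open>first_variation_identity\<close> in
  a chart around the single parameter \<open>t\<close> determines its derivative there.\<close>

lemma first_variation_pointwise:
  assumes t: "t \<in> {c..d}"
  shows "((\<lambda>t. g (T t) (vel t 0) (W t)) has_vector_derivative
    (1 / 2 * edens1 (t, 0) + g (T t) (W t) (accel t))) (at t within {c..d})"
proof -
  let ?e = "chart_at M (\<Lambda> (t, 0))"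
  have e: "?e \<in> M" "mchart M ?e" "\<Lambda> (t, 0) \<in> cdom ?e" by (simp_all add: chart_at)
  obtain U F where UF: "(t, 0) \<in> U" "strip_chart ?e U F"
    using strip_rep[OF t zero_I e(1,3)] by blast
  note U = UF(1) strip_chartD[OF UF(2)]
  interpret m: finsler_connection_model "dom ?e" "Lhat ?e" "\<Gamma> ?e" by (rule model[OF e(1)])
  let ?z = "\<lambda>y. (F y, FD F y (1, 0))"
  note gz = strip_metric[OF e(1) UF(2)]
  have "Cinf U (\<lambda>y. lg ?e (?z y) (FD F y (0, 1)))"
  proof -
    have "Cinf U (\<lambda>y. 1 / 2 * FD (Lhat ?e) (?z y) (0, FD F y (0, 1)))"
      by (intro Cinf_mult Cinf_const Cinf_open[OF U(2)] Cinf_FD_compose[OF m.Lh_smooth] Cinf_Pair U(2,3) Cinf_FD)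
    then show ?thesis by (simp add: m.leg_def)
  qed
  from partial_derivative_1[OF Cinf_differentiable[OF this U(1)]]
  have "((\<lambda>\<tau>. lg ?e (?z (\<tau>, 0)) (FD F (\<tau>, 0) (0, 1))) has_vector_derivative
      FD (\<lambda>y. lg ?e (?z y) (FD F y (0, 1))) (t, 0) (1, 0)) (at t within {c..d})"
    by (rule has_vector_derivative_at_within)
  moreover have "lg ?e (?z (\<tau>, 0)) (FD F (\<tau>, 0) (0, 1)) = g (T \<tau>) (vel \<tau> 0) (W \<tau>)"
    if "(\<tau>, 0) \<in> U" "\<tau> \<in> {c..d}" for \<tau>
    using gz[OF that] U(4)[OF that zero_I] m.fund_leg[OF U(3)[OF that(1)]] by simp
  then have "\<forall>\<^sub>F \<tau> in at t within {c..d}. lg ?e (?z (\<tau>, 0)) (FD F (\<tau>, 0) (0, 1)) = g (T \<tau>) (vel \<tau> 0) (W \<tau>)"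
    "lg ?e (?z (t, 0)) (FD F (t, 0) (0, 1)) = g (T t) (vel t 0) (W t)"
    using eventually_slice_1[OF Cinf_open[OF U(2)] U(1), of "{c..d}"] U(1) t by (auto elim: eventually_mono)
  ultimately have "((\<lambda>t. g (T t) (vel t 0) (W t)) has_vector_derivative
      FD (\<lambda>y. lg ?e (?z y) (FD F y (0, 1))) (t, 0) (1, 0)) (at t within {c..d})"
    using t by (rule has_vector_derivative_transform_eventually)
  moreover have "FD (\<lambda>y. lg ?e (?z y) (FD F y (0, 1))) (t, 0) (1, 0) = 1 / 2 * edens1 (t, 0) + g (T t) (W t) (accel t)"
    using m.first_variation_identity[OF U(2) refl refl refl U(3) U(1)] edens1_rep[OF e(1) UF(2,1) t zero_I]
      accel_rep(1)[OF t UF] gz[OF U(1) t, of "W t" "accel t"] U(4)[OF U(1) t zero_I] m.fund_sym[OF U(3)[OF U(1)]] by simp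
  ultimately show ?thesis by simp
qed

lemma strip_first_variation:
  shows "((\<lambda>s. 1 / 2 * integral {c..d} (\<lambda>t. edens (t, s))) has_real_derivative
      (- integral {c..d} (\<lambda>t. g (T t) (W t) (accel t)) + (g (T d) (vel d 0) (W d) - g (T c) (vel c 0) (W c)))) (at 0)"
    and "(\<lambda>t. g (T t) (W t) (accel t)) integrable_on {c..d}"
proof -
  have "((\<lambda>t. 1 / 2 * edens1 (t, 0) + g (T t) (W t) (accel t)) has_integral
      (g (T d) (vel d 0) (W d) - g (T c) (vel c 0) (W c))) {c..d}"
    by (rule fundamental_theorem_of_calculus[OF less_imp_le[OF cd] first_variation_pointwise])
  moreover have h: "((\<lambda>t. 1 / 2 * edens1 (t, 0)) has_integral (1 / 2 * integral {c..d} (\<lambda>t. edens1 (t, 0)))) {c..d}"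
    by (intro has_integral_mult_right integrable_integral smooth_strip_integrable[OF edens1(1) zero_I])
  \<comment> \<open>Integrability of the acceleration term is a by-product: it is the derivative
    just integrated minus half of the continuous function \<open>edens1\<close>.\<close>
  ultimately have i: "((\<lambda>t. g (T t) (W t) (accel t)) has_integral
      (g (T d) (vel d 0) (W d) - g (T c) (vel c 0) (W c)) - 1 / 2 * integral {c..d} (\<lambda>t. edens1 (t, 0))) {c..d}"
    by (drule_tac has_integral_diff[rotated]) auto
  then show "(\<lambda>t. g (T t) (W t) (accel t)) integrable_on {c..d}" by blast
  have "((\<lambda>s. 1 / 2 * integral {c..d} (\<lambda>t. edens (t, s))) has_real_derivative
      (1 / 2 * integral {c..d} (\<lambda>t. edens1 (t, 0)))) (at 0)"
    by (rule DERIV_cmult[OF edens1(3)[OF zero_I]])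
  then show "((\<lambda>s. 1 / 2 * integral {c..d} (\<lambda>t. edens (t, s))) has_real_derivative
      (- integral {c..d} (\<lambda>t. g (T t) (W t) (accel t)) + (g (T d) (vel d 0) (W d) - g (T c) (vel c 0) (W c)))) (at 0)"
    using integral_unique[OF i] by simp
qed

section \<open>The second variation\<close>

definition edens2 :: "real \<times> real \<Rightarrow> real" where
  "edens2 y = deriv (\<lambda>s. edens1 (fst y, s)) (snd y)"

lemma edens2:
  shows "smooth_on ({c..d} \<times> I) edens2"
    and "\<And>s. s \<in> I \<Longrightarrow>
      ((\<lambda>s. integral {c..d} (\<lambda>t. edens1 (t, s))) has_real_derivative integral {c..d} (\<lambda>t. edens2 (t, s))) (at s)"
  using smooth_strip_derivative[OF edens1(1)] by (simp_all add: edens2_def[abs_def])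

abbreviation "DW t \<equiv> cov_deriv_along M nabla {c..d} (\<lambda>t. \<Lambda> (t, 0)) (T t) W t"
abbreviation "DsW t \<equiv> cov_deriv_along M nabla UNIV (\<lambda>s. \<Lambda> (t, s)) (T t) (tvel t) 0"
abbreviation "curvW t \<equiv> curvature M A nabla (T t) (vel t 0) (W t) (W t)"

text \<open>The total \<open>t\<close>-derivative in \<open>second_variation_identity\<close>
  becomes the derivative of \<open>g (T t) (vel t 0) (DsW t)\<close>, and the left side there is
  half the second \<open>s\<close>-derivative of the energy density by
  \<open>energy_density_deriv\<close>. The geodesic equation is used at the given \<open>t\<close>
  only.\<close>

lemma second_variation_pointwise:
  assumes t: "t \<in> {c..d}" and geo: "accel t = 0"
  shows "((\<lambda>t. g (T t) (vel t 0) (DsW t)) has_vector_derivative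
    (1 / 2 * edens2 (t, 0) - (- g (T t) (curvW t) (vel t 0) + g (T t) (DW t) (DW t)))) (at t within {c..d})"
proof -
  let ?e = "chart_at M (\<Lambda> (t, 0))"
  have e: "?e \<in> M" "mchart M ?e" "\<Lambda> (t, 0) \<in> cdom ?e" by (simp_all add: chart_at)
  obtain U F where UF: "(t, 0) \<in> U" "strip_chart ?e U F"
    using strip_rep[OF t zero_I e(1,3)] by blast
  note U = UF(1) strip_chartD[OF UF(2)]
  interpret m: finsler_connection_model "dom ?e" "Lhat ?e" "\<Gamma> ?e" by (rule model[OF e(1)])
  let ?V = "\<lambda>y. FD F y (1, 0)" and ?W = "\<lambda>y. FD F y (0, 1)"
  let ?z = "\<lambda>y. (F y, ?V y)"
  note gz = strip_metric[OF e(1) UF(2)]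
  let ?Y = "\<lambda>y. FD ?V y (0, 1) + \<Gamma> ?e (?z y) (?W y) (?V y)" and ?Z = "\<lambda>y. FD ?W y (0, 1) + \<Gamma> ?e (?z y) (?W y) (?W y)"
  have zs: "Cinf U ?z" by (intro Cinf_Pair U(2) Cinf_FD)
  \<comment> \<open>To differentiate along \<open>t\<close>, the acceleration of the transversal
    curves is needed at all nearby \<open>\<tau>\<close>, where \<open>?e\<close> need not be the
    preferred chart. Hence the appeal to \<open>acceleration_chart\<close>, which is valid in any
    atlas chart.\<close>
  have Z: "tcoord M ?e (\<Lambda> (\<tau>, 0)) (DsW \<tau>) = ?Z (\<tau>, 0)" if \<tau>: "(\<tau>, 0) \<in> U" "\<tau> \<in> {c..d}" for \<tau>
  proof -
    define J where "J = (\<lambda>\<sigma>. (\<tau>, \<sigma>)) -` U \<inter> I"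
    have oJ: "open J" unfolding J_def
      by (intro open_Int open_vimage Cinf_open[OF U(2)] continuous_intros open_greaterThanLessThan)
    have fJ: "Cinf J (\<lambda>\<sigma>. F (\<tau>, \<sigma>))" by (rule Cinf_subset[OF Cinf_slice[OF U(2)] oJ]) (auto simp: J_def)
    have J0: "0 \<in> J" using \<tau> zero_I by (simp add: J_def)
    have f1: "FD (\<lambda>\<sigma>. F (\<tau>, \<sigma>)) \<sigma> 1 = ?W (\<tau>, \<sigma>)" if "\<sigma> \<in> J" for \<sigma>
      by (rule FD_slice[OF Cinf_differentiable[OF U(2)]]) (use that in \<open>simp add: J_def\<close>)
    have "FD (\<lambda>\<sigma>. FD (\<lambda>\<sigma>. F (\<tau>, \<sigma>)) \<sigma> 1) 0 = FD (\<lambda>\<sigma>. ?W (\<tau>, \<sigma>)) 0"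
      by (rule FD_cong[OF Cinf_differentiable[OF Cinf_FD[OF fJ] J0] oJ J0]) (rule f1)
    then have f2: "FD (\<lambda>\<sigma>. FD (\<lambda>\<sigma>. F (\<tau>, \<sigma>)) \<sigma> 1) 0 1 = FD ?W (\<tau>, 0) (0, 1)"
      using FD_slice[OF Cinf_differentiable[OF Cinf_FD[OF U(2)] \<tau>(1)]] by simp
    have "tcoord M ?e (\<Lambda> (\<tau>, 0)) (DsW \<tau>) =
        FD (\<lambda>\<sigma>. FD (\<lambda>\<sigma>. F (\<tau>, \<sigma>)) \<sigma> 1) 0 1
        + \<Gamma> ?e (bundle_map M ?e (T \<tau>)) (FD (\<lambda>\<sigma>. F (\<tau>, \<sigma>)) 0 1) (FD (\<lambda>\<sigma>. F (\<tau>, \<sigma>)) 0 1)"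
    proof (rule acceleration_chart[OF e(1) fJ J0 _ strip_adm[OF \<tau>(2) zero_I]])
      show "isCont (\<lambda>s. \<Lambda> (\<tau>, s)) \<sigma>" if "\<sigma> \<in> J" for \<sigma> using strip_cont2[OF \<tau>(2)] that by (simp add: J_def)
    qed (use U(4) \<tau>(2) in \<open>auto simp: J_def velocity_lift_def\<close>)
    then show ?thesis
      using f1[OF J0] f2 lift_rep(1)[OF e(2), of \<tau> 0] U(4)[OF \<tau> zero_I] by simp
  qed
  have "Cinf U (\<lambda>y. lg ?e (?z y) (?Z y))"
    by (intro m.leg_Cinf zs Cinf_add m.Gam_Cinf Cinf_FD U(2,3))
  from partial_derivative_1[OF Cinf_differentiable[OF this U(1)]]
  have "((\<lambda>\<tau>. lg ?e (?z (\<tau>, 0)) (?Z (\<tau>, 0))) has_vector_derivative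
      FD (\<lambda>y. lg ?e (?z y) (?Z y)) (t, 0) (1, 0)) (at t within {c..d})"
    by (rule has_vector_derivative_at_within)
  moreover have "lg ?e (?z (\<tau>, 0)) (?Z (\<tau>, 0)) = g (T \<tau>) (vel \<tau> 0) (DsW \<tau>)"
    if "(\<tau>, 0) \<in> U" "\<tau> \<in> {c..d}" for \<tau>
    using gz[OF that] U(4)[OF that zero_I] Z[OF that] m.fund_leg[OF U(3)[OF that(1)]] by simp
  then have "\<forall>\<^sub>F \<tau> in at t within {c..d}. lg ?e (?z (\<tau>, 0)) (?Z (\<tau>, 0)) = g (T \<tau>) (vel \<tau> 0) (DsW \<tau>)"
    "lg ?e (?z (t, 0)) (?Z (t, 0)) = g (T t) (vel t 0) (DsW t)"
    using eventually_slice_1[OF Cinf_open[OF U(2)] U(1), of "{c..d}"] U(1) t by (auto elim: eventually_mono)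
  ultimately have d1: "((\<lambda>t. g (T t) (vel t 0) (DsW t)) has_vector_derivative
      FD (\<lambda>y. lg ?e (?z y) (?Z y)) (t, 0) (1, 0)) (at t within {c..d})"
    using t by (rule has_vector_derivative_transform_eventually)
  have Ls: "Cinf U (\<lambda>y. FD (\<lambda>y. Lhat ?e (?z y)) y (0, 1))"
    by (rule Cinf_FD[OF Cinf_compose[OF m.Lh_smooth zs U(3)]])
  then have "((\<lambda>s. edens1 (t, s)) has_real_derivative FD (\<lambda>y. FD (\<lambda>y. Lhat ?e (?z y)) y (0, 1)) (t, 0) (0, 1)) (at 0)"
    by (rule strip_derivative) (use edens1_rep[OF e(1) UF(2)] U(1) t zero_I in auto)
  then have "edens2 (t, 0) = FD (\<lambda>y. FD (\<lambda>y. Lhat ?e (?z y)) y (0, 1)) (t, 0) (0, 1)"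
    by (simp add: edens2_def DERIV_imp_deriv)
  also have "\<dots> = FD (\<lambda>y. 2 * lg ?e (?z y) (?Y y)) (t, 0) (0, 1)"
    using FD_cong[OF Cinf_differentiable[OF Ls U(1)] Cinf_open[OF U(2)] U(1) m.energy_density_deriv[OF U(2) refl refl refl U(3)]]
    by simp
  also have "\<dots> = 2 * FD (\<lambda>y. lg ?e (?z y) (?Y y)) (t, 0) (0, 1)"
  proof -
    have "Cinf U (\<lambda>y. lg ?e (?z y) (?Y y))"
      by (intro m.leg_Cinf zs Cinf_add m.Gam_Cinf Cinf_FD U(2,3))
    from FD_eqI[OF has_derivative_mult_right[OF Cinf_has_derivative[OF this U(1)], of 2]] show ?thesis by simp
  qed
  finally have e2: "1 / 2 * edens2 (t, 0) = FD (\<lambda>y. lg ?e (?z y) (?Y y)) (t, 0) (0, 1)" by simp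
  have DWt: "DW t = FD ?W (t, 0) (1, 0) + \<Gamma> ?e (?z (t, 0)) (?V (t, 0)) (?W (t, 0))"
    by (rule accel_rep(2)[OF t UF])
  have "FD ?V (t, 0) (1, 0) + \<Gamma> ?e (?z (t, 0)) (?V (t, 0)) (?V (t, 0)) = 0"
    using accel_rep(1)[OF t UF] geo by simp
  note sv = m.second_variation_identity[OF U(2) refl refl refl U(3) U(1) this]
  have "tcoord M ?e (\<Lambda> (t, 0)) (curvW t) = m.curv (?z (t, 0)) (?V (t, 0)) (?W (t, 0)) (?W (t, 0))"
    using curvature_chart[OF e(1) strip_adm[OF t zero_I], of "vel t 0" "W t" "W t"] U(4)[OF U(1) t zero_I]
      lift_rep(1)[OF e(2), of t 0] by (simp add: velocity_lift_def)
  then have "g (T t) (curvW t) (vel t 0) = lg ?e (?z (t, 0)) (m.curv (?z (t, 0)) (?V (t, 0)) (?W (t, 0)) (?W (t, 0)))"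
    using gz[OF U(1) t] U(4)[OF U(1) t zero_I] m.fund_leg[OF U(3)[OF U(1)]]
    by (simp add: m.fund_sym[OF U(3)[OF U(1)], of "m.curv _ _ _ _"])
  moreover have "g (T t) (DW t) (DW t) = fnd ?e (?z (t, 0)) (DW t) (DW t)"
    using gz[OF U(1) t] by simp
  ultimately have "FD (\<lambda>y. lg ?e (?z y) (?Z y)) (t, 0) (1, 0) =
      1 / 2 * edens2 (t, 0) - (- g (T t) (curvW t) (vel t 0) + g (T t) (DW t) (DW t))"
    using sv unfolding e2 DWt by simp
  then show ?thesis using d1 by simp
qed

lemma strip_second_variation:
  assumes geo: "\<And>t. t \<in> {c..d} \<Longrightarrow> accel t = 0"
  shows "((\<lambda>s. 1 / 2 * integral {c..d} (\<lambda>t. edens1 (t, s))) has_real_derivative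
      (integral {c..d} (\<lambda>t. - g (T t) (curvW t) (vel t 0) + g (T t) (DW t) (DW t))
       + g (T d) (vel d 0) (DsW d) - g (T c) (vel c 0) (DsW c))) (at 0)"
proof -
  let ?i = "\<lambda>t. - g (T t) (curvW t) (vel t 0) + g (T t) (DW t) (DW t)"
  have "((\<lambda>t. 1 / 2 * edens2 (t, 0) - ?i t) has_integral
      (g (T d) (vel d 0) (DsW d) - g (T c) (vel c 0) (DsW c))) {c..d}"
    by (rule fundamental_theorem_of_calculus[OF less_imp_le[OF cd] second_variation_pointwise[OF _ geo]])
  moreover have "((\<lambda>t. 1 / 2 * edens2 (t, 0)) has_integral (1 / 2 * integral {c..d} (\<lambda>t. edens2 (t, 0)))) {c..d}"
    by (intro has_integral_mult_right integrable_integral smooth_strip_integrable[OF edens2(1) zero_I])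
  ultimately have "(?i has_integral 1 / 2 * integral {c..d} (\<lambda>t. edens2 (t, 0))
      - (g (T d) (vel d 0) (DsW d) - g (T c) (vel c 0) (DsW c))) {c..d}"
    by (drule_tac has_integral_diff) auto
  from integral_unique[OF this] DERIV_cmult[OF edens2(2)[OF zero_I], of "1 / 2"] show ?thesis by simp
qed

end

section \<open>Submanifolds\<close>

text \<open>Every vector orthogonal to \<open>S\<close> has inner product 0 with the curve near
  \<open>s\<close>, hence also with its derivative.\<close>

lemma derivative_in_subspace:
  fixes S :: "'e::euclidean_space set" and f :: "real \<Rightarrow> 'e"
  assumes S: "subspace S" and f: "(f has_vector_derivative y) (at s)" and J: "open J" "s \<in> J" "\<And>\<sigma>. \<sigma> \<in> J \<Longrightarrow> f \<sigma> \<in> S"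
  shows "y \<in> S"
proof -
  have "w \<bullet> y = 0" if w: "w \<in> S\<^sup>\<bottom>" for w
  proof -
    have "((\<lambda>\<sigma>. w \<bullet> f \<sigma>) has_vector_derivative w \<bullet> y) (at s)"
      by (rule bounded_linear.has_vector_derivative[OF bounded_linear_inner_right f])
    moreover have "((\<lambda>\<sigma>. 0::real) has_vector_derivative 0) (at s)" by simp
    then have "((\<lambda>\<sigma>. w \<bullet> f \<sigma>) has_vector_derivative 0) (at s)"
      by (rule has_vector_derivative_transform_within_open[OF _ J(1,2)])
        (use J(3) w in \<open>auto simp: orthogonal_comp_def orthogonal_def inner_commute\<close>)
    ultimately show ?thesis by (rule vector_derivative_unique_at)
  qed
  then have "y \<in> S\<^sup>\<bottom>\<^sup>\<bottom>" by (auto simp: orthogonal_comp_def orthogonal_def inner_commute)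
  then show ?thesis using orthogonal_comp_self[OF S] by simp
qed

lemma normal_part:
  fixes S :: "'e::euclidean_space set"
  assumes S: "subspace S" and \<beta>: "\<And>w. linear (\<lambda>u. \<beta> u w)" "\<And>u. linear (\<beta> u)" and nd: "nondegenerate_on \<beta> S"
  shows "z - normal_part \<beta> S z \<in> S" and "\<And>w. w \<in> S \<Longrightarrow> \<beta> (normal_part \<beta> S z) w = 0"
proof -
  obtain B where B: "B \<subseteq> S" "independent B" "S \<subseteq> span B" "finite B"
    by (meson basis_exists finiteI_independent)
  have SB: "span B = S" using B span_minimal[OF B(1) S] by auto
  define \<phi> where "\<phi> u = (\<Sum>b\<in>B. \<beta> u b *\<^sub>R b)" for u
  have lin: "linear \<phi>"
    unfolding \<phi>_def by (intro linear_compose_sum ballI linearI)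
      (simp_all add: linear_add[OF \<beta>(1)] linear_cmul[OF \<beta>(1)] scaleR_add_left)
  have \<phi>S: "\<phi> u \<in> S" for u unfolding \<phi>_def using B(1) by (intro subspace_sum[OF S] subspace_scale[OF S]) auto
  have \<phi>0: "\<beta> u w = 0" if u: "\<phi> u = 0" and w: "w \<in> S" for u w
  proof -
    have "\<beta> u b = 0" if "b \<in> B" for b
      using u that B(2,4) unfolding \<phi>_def by (metis independent_explicit_finite_subsets order_refl)
    then have "span B \<subseteq> {w. \<beta> u w = 0}"
      by (intro span_minimal) (auto simp: subspace_def linear_0[OF \<beta>(2)] linear_add[OF \<beta>(2)] linear_cmul[OF \<beta>(2)])
    then show ?thesis using w SB by auto
  qed
  have "inj_on \<phi> S"
  proof (rule inj_onI)
    fix x y assume xy: "x \<in> S" "y \<in> S" "\<phi> x = \<phi> y"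
    then have "\<phi> (x - y) = 0" by (simp add: linear_diff[OF lin])
    then have "\<forall>w\<in>S. \<beta> (x - y) w = 0" using \<phi>0 by blast
    then have "x - y = 0" using nd subspace_diff[OF S xy(1,2)] unfolding nondegenerate_on_def by blast
    then show "x = y" by simp
  qed
  then have "dim (\<phi> ` S) = dim S" using S by (intro dim_image_eq lin) (metis span_eq_iff)
  then have "\<phi> ` S = S"
    using \<phi>S by (intro subspace_dim_equal linear_subspace_image lin S) auto
  then have "\<phi> z \<in> \<phi> ` S" using \<phi>S by simp
  then obtain s where s: "s \<in> S" "\<phi> s = \<phi> z" by force
  define P where "P n \<longleftrightarrow> (\<forall>w\<in>S. \<beta> n w = 0) \<and> z - n \<in> S" for n
  have "\<phi> (z - s) = 0" using s by (simp add: linear_diff[OF lin])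
  then have "P (z - s)" using \<phi>0 s by (auto simp: P_def)
  moreover have "n = z - s" if "P n" for n
  proof -
    have "n - (z - s) \<in> S" using that s subspace_diff[OF S, of s "z - n"] by (auto simp: P_def algebra_simps)
    moreover have "\<forall>w\<in>S. \<beta> (n - (z - s)) w = 0"
      using that \<open>P (z - s)\<close> by (auto simp: P_def linear_diff[OF \<beta>(1)])
    ultimately have "n - (z - s) = 0" using nd unfolding nondegenerate_on_def by blast
    then show ?thesis by simp
  qed
  ultimately have "P (normal_part \<beta> S z)"
    unfolding normal_part_def P_def[symmetric] by (rule theI)
  then show "z - normal_part \<beta> S z \<in> S" and "\<And>w. w \<in> S \<Longrightarrow> \<beta> (normal_part \<beta> S z) w = 0"
    by (auto simp: P_def)
qed

context smooth_mfd
begin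

section \<open>Slice charts and tangent spaces of submanifolds\<close>

definition slice_chart :: "'m set \<Rightarrow> ('m, 'e) chart \<Rightarrow> 'e set \<Rightarrow> bool" where
  "slice_chart P d S \<longleftrightarrow> mchart M d \<and> subspace S \<and> cmap d ` (P \<inter> cdom d) = cmap d ` cdom d \<inter> S"

lemma slice_chartE:
  assumes "submanifold M P" "p \<in> P"
  obtains d S where "slice_chart P d S" "p \<in> cdom d"
proof -
  obtain k where "\<forall>p\<in>P. \<exists>d S. is_chart d \<and> (\<forall>c\<in>M. compatible c d) \<and> p \<in> cdom d \<and>
      subspace S \<and> dim S = k \<and> cmap d ` (P \<inter> cdom d) = cmap d ` cdom d \<inter> S"
    using assms(1) unfolding submanifold_def by blast
  from bspec[OF this assms(2)] show ?thesis using that unfolding slice_chart_def mchart_def by blast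
qed

lemma smooth_curve_chart:
  fixes \<alpha> :: "real \<Rightarrow> 'm"
  assumes \<alpha>: "smooth_into M {-\<delta><..<\<delta>} \<alpha>" and s: "s \<in> {-\<delta><..<\<delta>}" and d: "mchart M d" "\<alpha> s \<in> cdom d"
  obtains J where "s \<in> J" "Cinf J (\<lambda>\<sigma>. cmap d (\<alpha> \<sigma>))" "J \<subseteq> {-\<delta><..<\<delta>}" "\<And>\<sigma>. \<sigma> \<in> J \<Longrightarrow> \<alpha> \<sigma> \<in> cdom d"
proof -
  let ?e = "chart_at M (\<alpha> s)" and ?J = "{-\<delta><..<\<delta>}"
  have e: "?e \<in> M" "mchart M ?e" "\<alpha> s \<in> cdom ?e" by (simp_all add: chart_at)
  have cont: "continuous_on ?J \<alpha>" and sm: "smooth_on {x \<in> ?J. \<alpha> x \<in> cdom ?e} (cmap ?e \<circ> \<alpha>)"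
    using \<alpha> e by (auto simp: smooth_into_def)
  have o: "open {x \<in> ?J. \<alpha> x \<in> N}" if "open N" for N
  proof -
    have "{x \<in> ?J. \<alpha> x \<in> N} = ?J \<inter> \<alpha> -` N" by auto
    then show ?thesis using continuous_open_preimage[OF cont open_greaterThanLessThan that] by simp
  qed
  have sm: "Cinf {x \<in> ?J. \<alpha> x \<in> cdom ?e} (\<lambda>x. cmap ?e (\<alpha> x))"
    using smooth_on_Cinf[OF o[OF mchart_open[OF e(2)]] sm] by (simp add: o_def)
  define J where "J = {x \<in> ?J. \<alpha> x \<in> cdom ?e \<inter> cdom d}"
  have oJ: "open J" unfolding J_def by (intro o open_Int mchart_open e d)
  have "Cinf J (\<lambda>\<sigma>. tr ?e d (cmap ?e (\<alpha> \<sigma>)))"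
    by (rule Cinf_compose[OF tr_Cinf[OF e(2) d(1)] Cinf_subset[OF sm oJ]]) (auto simp: J_def)
  then have "Cinf J (\<lambda>\<sigma>. cmap d (\<alpha> \<sigma>))"
    by (rule Cinf_cong) (use e in \<open>auto simp: J_def\<close>)
  then show ?thesis using s e d by (intro that[of J]) (auto simp: J_def)
qed

lemma smooth_curve_velocity:
  assumes \<alpha>: "smooth_into M {-\<delta><..<\<delta>} \<alpha>" and s: "s \<in> {-\<delta><..<\<delta>}" and d: "mchart M d" "\<alpha> s \<in> cdom d"
  shows "((\<lambda>\<sigma>. cmap d (\<alpha> \<sigma>)) has_vector_derivative tcoord M d (\<alpha> s) (velocity M UNIV \<alpha> s)) (at s)"
proof -
  obtain J where J: "s \<in> J" "Cinf J (\<lambda>\<sigma>. cmap d (\<alpha> \<sigma>))" "J \<subseteq> {-\<delta><..<\<delta>}" "\<And>\<sigma>. \<sigma> \<in> J \<Longrightarrow> \<alpha> \<sigma> \<in> cdom d"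
    by (rule smooth_curve_chart[OF assms]) (rule that)
  note f = Cinf_real_derivative[OF J(2,1)]
  have "isCont \<alpha> s" using \<alpha> s by (simp add: smooth_into_def continuous_on_eq_continuous_at)
  then have "tcoord M d (\<alpha> s) (velocity M UNIV \<alpha> s) = FD (\<lambda>\<sigma>. cmap d (\<alpha> \<sigma>)) s 1"
    by (intro velocity_chart[OF d _ _ _ f]) (auto simp: isCont_def)
  then show ?thesis using f by simp
qed

lemma slice_mem:
  assumes "slice_chart P d S" "q \<in> cdom d"
  shows "q \<in> P \<longleftrightarrow> cmap d q \<in> S"
proof -
  have "q \<in> P \<longleftrightarrow> cmap d q \<in> cmap d ` (P \<inter> cdom d)"
    using assms mchart_inject[of d q] by (auto simp: slice_chart_def)
  then show ?thesis using assms by (auto simp: slice_chart_def)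
qed

text \<open>A slice chart straightens \<open>P\<close>, so curves in \<open>P\<close> have velocity
  coordinates in \<open>S\<close>. Conversely, a vector with coordinates in \<open>S\<close> is the
  velocity of a straight coordinate line through \<open>p\<close>, which stays in \<open>P\<close>
  for small parameters.\<close>

lemma tangent_space_slice:
  assumes d: "slice_chart P d S" and p: "p \<in> P" "p \<in> cdom d"
  shows "tangent_space M P p = {x. tcoord M d p x \<in> S}"
proof (intro equalityI subsetI)
  have md: "mchart M d" and S: "subspace S" using d by (auto simp: slice_chart_def)
  fix x assume "x \<in> tangent_space M P p"
  then obtain \<alpha> \<delta> where \<alpha>: "x = velocity M UNIV \<alpha> 0" "\<delta> > 0" "smooth_into M {-\<delta><..<\<delta>} \<alpha>" "\<alpha> ` {-\<delta><..<\<delta>} \<subseteq> P" "\<alpha> 0 = p"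
    unfolding tangent_space_def by blast
  then have 0: "0 \<in> {-\<delta><..<\<delta>}" by simp
  have d0: "\<alpha> 0 \<in> cdom d" using \<alpha> p by simp
  obtain J where J: "0 \<in> J" "Cinf J (\<lambda>\<sigma>. cmap d (\<alpha> \<sigma>))" "J \<subseteq> {-\<delta><..<\<delta>}" "\<And>\<sigma>. \<sigma> \<in> J \<Longrightarrow> \<alpha> \<sigma> \<in> cdom d"
    by (rule smooth_curve_chart[OF \<alpha>(3) 0 md d0]) (rule that)
  have "tcoord M d (\<alpha> 0) (velocity M UNIV \<alpha> 0) \<in> S"
    by (rule derivative_in_subspace[OF S smooth_curve_velocity[OF \<alpha>(3) 0 md d0] Cinf_open[OF J(2)] J(1)])
      (use J(3,4) \<alpha>(4) slice_mem[OF d] in blast)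
  then show "x \<in> {x. tcoord M d p x \<in> S}" using \<alpha> by simp
next
  have md: "mchart M d" and S: "subspace S" using d by (auto simp: slice_chart_def)
  fix x assume "x \<in> {x. tcoord M d p x \<in> S}"
  then have y: "tcoord M d p x \<in> S" by simp
  define y where "y = tcoord M d p x"
  define \<alpha> where "\<alpha> s = cinv d (cmap d p + s *\<^sub>R y)" for s
  have od: "open (cmap d ` cdom d)" by (rule mchart_open_image'[OF md mchart_open[OF md] order_refl])
  define N where "N = (\<lambda>s. cmap d p + s *\<^sub>R y) -` (cmap d ` cdom d)"
  have "open N" unfolding N_def by (intro open_vimage od continuous_intros)
  moreover have "0 \<in> N" using p by (simp add: N_def)
  ultimately obtain \<delta> where \<delta>: "\<delta> > 0" "ball 0 \<delta> \<subseteq> N" by (meson openE)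
  have in_d: "\<alpha> s \<in> cdom d" "cmap d (\<alpha> s) = cmap d p + s *\<^sub>R y" if "s \<in> {-\<delta><..<\<delta>}" for s
  proof -
    have "s \<in> N" using that \<delta>(2) by (auto simp: subset_iff dist_real_def)
    then obtain q where "cmap d p + s *\<^sub>R y = cmap d q" "q \<in> cdom d" by (auto simp: N_def)
    then show "\<alpha> s \<in> cdom d" "cmap d (\<alpha> s) = cmap d p + s *\<^sub>R y" using md by (simp_all add: \<alpha>_def)
  qed
  have cont: "continuous_on {-\<delta><..<\<delta>} \<alpha>"
  proof (rule continuous_at_imp_continuous_on, rule ballI)
    fix s assume s: "s \<in> {-\<delta><..<\<delta>}"
    have 1: "isCont (\<lambda>s. cmap d p + s *\<^sub>R y) s" by (intro continuous_intros)
    have 2: "isCont (cinv d) (cmap d p + s *\<^sub>R y)"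
      using is_chart_inv_continuous[OF mchart_is_chart[OF md] in_d(1)[OF s]] in_d(2)[OF s] by simp
    show "isCont \<alpha> s" unfolding \<alpha>_def[abs_def] by (rule isCont_o2[OF 1 2])
  qed
  have "smooth_into M {-\<delta><..<\<delta>} \<alpha>"
    unfolding smooth_into_def
  proof (intro conjI cont ballI)
    fix c assume c: "c \<in> M"
    note mc = mchart_atlas[OF c]
    let ?J = "{s \<in> {-\<delta><..<\<delta>}. \<alpha> s \<in> cdom c}"
    have o: "open ?J"
    proof -
      have "?J = {-\<delta><..<\<delta>} \<inter> \<alpha> -` cdom c" by auto
      then show ?thesis using continuous_open_preimage[OF cont open_greaterThanLessThan mchart_open[OF mc]] by simp
    qed
    have a: "Cinf ?J (\<lambda>s. cmap d p + s *\<^sub>R y)" by (intro Cinf_add Cinf_const Cinf_scaleR Cinf_ident o)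
    have "Cinf ?J (\<lambda>s. tr d c (cmap d p + s *\<^sub>R y))"
    proof (rule Cinf_compose[OF tr_Cinf[OF md mc] a])
      fix s assume "s \<in> ?J"
      then show "cmap d p + s *\<^sub>R y \<in> cmap d ` (cdom d \<inter> cdom c)"
        using in_d[of s] by (intro image_eqI[of _ _ "\<alpha> s"]) auto
    qed
    then show "smooth_on ?J (cmap c \<circ> \<alpha>)" by (intro Cinf_smooth_on) (simp add: \<alpha>_def o_def)
  qed
  moreover have "\<alpha> ` {-\<delta><..<\<delta>} \<subseteq> P"
  proof
    fix q assume "q \<in> \<alpha> ` {-\<delta><..<\<delta>}"
    then obtain s where s: "q = \<alpha> s" "s \<in> {-\<delta><..<\<delta>}" by blast
    have "cmap d p \<in> S" using slice_mem[OF d p(2)] p(1) by simp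
    then have "cmap d q \<in> S"
      unfolding s(1) in_d(2)[OF s(2)] using y S by (intro subspace_add subspace_scale) (auto simp: y_def)
    then show "q \<in> P" using slice_mem[OF d in_d(1)[OF s(2)]] s by simp
  qed
  moreover have \<alpha>0: "\<alpha> 0 = p" using md p by (simp add: \<alpha>_def)
  moreover have "velocity M UNIV \<alpha> 0 = x"
  proof -
    have "((\<lambda>s. cmap d p + s *\<^sub>R y) has_vector_derivative y) (at 0)" by (auto intro!: derivative_eq_intros)
    then have "((\<lambda>s. cmap d (\<alpha> s)) has_vector_derivative y) (at 0)"
      by (rule has_vector_derivative_transform_within_open[where S="{-\<delta><..<\<delta>}"]) (use \<delta> in_d in auto)
    moreover have "isCont \<alpha> 0" using cont \<delta>(1) by (simp add: continuous_on_eq_continuous_at)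
    ultimately have "tcoord M d (\<alpha> 0) (velocity M UNIV \<alpha> 0) = y"
      using p \<alpha>0 by (intro velocity_chart[OF md]) (auto simp: isCont_def)
    then show ?thesis using tcoord_inject[OF md p(2)] \<alpha>0 by (simp add: y_def)
  qed
  ultimately show "x \<in> tangent_space M P p" unfolding tangent_space_def using \<delta>(1) by blast
qed

lemma tangent_space_subspace:
  assumes "submanifold M P" "p \<in> P"
  shows "subspace (tangent_space M P p)"
proof -
  obtain d S where d: "slice_chart P d S" "p \<in> cdom d" by (rule slice_chartE[OF assms])
  have md: "mchart M d" and S: "subspace S" using d by (auto simp: slice_chart_def)
  have "tangent_space M P p = tcoord M d p -` S"
    using tangent_space_slice[OF d(1) assms(2) d(2)] by (simp add: vimage_def)
  then show ?thesis using linear_subspace_vimage[OF linear_tcoord[OF md d(2)] S] by simp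
qed

text \<open>A field with constant components along the slice is cut off by a bump function. Outside
  the slice chart it is zero and so still tangent to \<open>P\<close>.\<close>

lemma tangent_ext:
  assumes P: "submanifold M P" and p: "p \<in> P" and x: "x \<in> tangent_space M P p"
  shows "tangent_ext M P p x \<in> vector_fields M" "tangent_ext M P p x p = x"
    "\<And>q. q \<in> P \<Longrightarrow> tangent_ext M P p x q \<in> tangent_space M P q"
proof -
  obtain d S where d: "slice_chart P d S" "p \<in> cdom d" by (rule slice_chartE[OF P p])
  have md: "mchart M d" and S: "subspace S" using d by (auto simp: slice_chart_def)
  define y where "y = tcoord M d p x"
  have y: "y \<in> S" using x tangent_space_slice[OF d(1) p d(2)] by (simp add: y_def)
  obtain f K O' where f: "smooth_fun M f" "closed K" "K \<subseteq> cdom d" "\<And>q. q \<notin> K \<Longrightarrow> f q = 0"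
    "open O'" "p \<in> O'" "\<And>q. q \<in> O' \<Longrightarrow> f q = 1"
    using bump_manifold[OF mchart_open[OF md] d(2)] by metis
  define X where "X q = f q *\<^sub>R tvec M d q y" for q
  have "X \<in> vector_fields M"
    unfolding X_def by (rule vf_cutoff[OF mchart_open[OF md] coord_field_smooth[OF md] f(1-4)])
  moreover have "X p = x" using f md d(2) by (simp add: X_def y_def)
  moreover have "X q \<in> tangent_space M P q" if q: "q \<in> P" for q
  proof (cases "q \<in> cdom d")
    case True
    then have "tcoord M d q (X q) = f q *\<^sub>R y" using linear_cmul[OF linear_tcoord[OF md True]] md by (simp add: X_def)
    then show ?thesis using tangent_space_slice[OF d(1) q True] y subspace_scale[OF S] by simp
  next
    case False
    then have "X q = 0" using f(3,4) by (force simp: X_def)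
    then show ?thesis using subspace_0[OF tangent_space_subspace[OF P q]] by simp
  qed
  ultimately have "X \<in> vector_fields M \<and> X p = x \<and> (\<forall>q\<in>P. X q \<in> tangent_space M P q)" by blast
  then have "tangent_ext M P p x \<in> vector_fields M \<and> tangent_ext M P p x p = x
      \<and> (\<forall>q\<in>P. tangent_ext M P p x q \<in> tangent_space M P q)"
    unfolding tangent_ext_def
    by (rule someI[where P="\<lambda>X. X \<in> vector_fields M \<and> X p = x \<and> (\<forall>q\<in>P. X q \<in> tangent_space M P q)"])
  then show "tangent_ext M P p x \<in> vector_fields M" "tangent_ext M P p x p = x"
    "\<And>q. q \<in> P \<Longrightarrow> tangent_ext M P p x q \<in> tangent_space M P q" by auto
qed

text \<open>Differentiating \<open>X(\<beta>)\<close> and \<open>\<beta>'\<close>, both tangent to \<open>P\<close>, produces the same second-order term in the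
  transition map, so that the difference of the coordinate derivatives is tangent to \<open>P\<close>.\<close>

lemma acceleration_tangent:
  fixes \<beta> :: "real \<Rightarrow> 'm"
  assumes P: "submanifold M P" and \<beta>: "smooth_into M {-\<delta><..<\<delta>} \<beta>" "\<delta> > 0" "\<And>s. s \<in> {-\<delta><..<\<delta>} \<Longrightarrow> \<beta> s \<in> P"
    and e: "mchart M e" "\<beta> 0 \<in> cdom e" and X: "X \<in> vector_fields M" "X (\<beta> 0) = velocity M UNIV \<beta> 0"
      "\<And>q. q \<in> P \<Longrightarrow> X q \<in> tangent_space M P q"
  defines "f \<equiv> \<lambda>\<sigma>. cmap e (\<beta> \<sigma>)"
  shows "tvec M e (\<beta> 0) (FD (\<lambda>\<sigma>. FD f \<sigma> 1) 0 1 - FD (vrep M e X) (f 0) (FD f 0 1)) \<in> tangent_space M P (\<beta> 0)"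
proof -
  have 0: "0 \<in> {-\<delta><..<\<delta>}" using \<beta>(2) by simp
  note p = \<beta>(3)[OF 0]
  obtain d S where d: "slice_chart P d S" "\<beta> 0 \<in> cdom d" by (rule slice_chartE[OF P p])
  have md: "mchart M d" and S: "subspace S" using d by (auto simp: slice_chart_def)
  obtain J1 where J1: "0 \<in> J1" "Cinf J1 f" "J1 \<subseteq> {-\<delta><..<\<delta>}" "\<And>\<sigma>. \<sigma> \<in> J1 \<Longrightarrow> \<beta> \<sigma> \<in> cdom e"
    unfolding f_def by (rule smooth_curve_chart[OF \<beta>(1) 0 e]) (rule that[unfolded f_def])
  obtain J2 where J2: "0 \<in> J2" "Cinf J2 (\<lambda>\<sigma>. cmap d (\<beta> \<sigma>))" "J2 \<subseteq> {-\<delta><..<\<delta>}" "\<And>\<sigma>. \<sigma> \<in> J2 \<Longrightarrow> \<beta> \<sigma> \<in> cdom d"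
    by (rule smooth_curve_chart[OF \<beta>(1) 0 md d(2)]) (rule that)
  define J where "J = J1 \<inter> J2"
  have J: "open J" "0 \<in> J" "\<And>\<sigma>. \<sigma> \<in> J \<Longrightarrow> \<beta> \<sigma> \<in> cdom e \<and> \<beta> \<sigma> \<in> cdom d \<and> \<sigma> \<in> {-\<delta><..<\<delta>}"
    using J1 J2 Cinf_open[OF J1(2)] Cinf_open[OF J2(2)] by (auto simp: J_def)
  have fJ: "Cinf J f" by (rule Cinf_subset[OF J1(2) J(1)]) (auto simp: J_def)
  let ?\<phi> = "tr e d" and ?W = "FD f 0 1"
  have \<phi>: "Cinf (cmap e ` (cdom e \<inter> cdom d)) ?\<phi>" by (rule tr_Cinf[OF e(1) md])
  have f0: "f 0 \<in> cmap e ` (cdom e \<inter> cdom d)" using J(2,3) by (auto simp: f_def)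
  have vel: "tcoord M e (\<beta> \<sigma>) (velocity M UNIV \<beta> \<sigma>) = FD f \<sigma> 1" if "\<sigma> \<in> J" for \<sigma>
    using smooth_curve_velocity[OF \<beta>(1) _ e(1), of \<sigma>] J(3)[OF that] Cinf_real_derivative[OF fJ that]
      vector_derivative_unique_at unfolding f_def by blast
  have df: "(f has_derivative FD f 0) (at 0)" and ddf: "((\<lambda>\<sigma>. FD f \<sigma> 1) has_derivative FD (\<lambda>\<sigma>. FD f \<sigma> 1) 0) (at 0)"
    using Cinf_has_derivative[OF fJ J(2)] Cinf_has_derivative[OF Cinf_FD[OF fJ] J(2)] by auto
  have X0: "vrep M e X (f 0) = ?W" using vel[OF J(2)] X(2) e by (simp add: f_def)
  have "(vrep M e X has_derivative FD (vrep M e X) (f 0)) (at (f 0))"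
    by (rule Cinf_has_derivative[OF vector_field_Cinf[OF X(1) e(1)]]) (use e in \<open>simp add: f_def\<close>)
  from diff_chain_at[OF df this]
  have dX: "((\<lambda>\<sigma>. vrep M e X (f \<sigma>)) has_derivative (\<lambda>u. FD (vrep M e X) (f 0) (FD f 0 u))) (at 0)" by (simp add: o_def)
  have 1: "((\<lambda>\<sigma>. FD ?\<phi> (f \<sigma>) (vrep M e X (f \<sigma>))) has_vector_derivative
      FD (\<lambda>x. FD ?\<phi> x ?W) (f 0) ?W + FD ?\<phi> (f 0) (FD (vrep M e X) (f 0) ?W)) (at 0)"
    using has_derivative_imp_vector_derivative[OF has_derivative_FD_apply[OF \<phi> f0 df dX UNIV_I]] by (simp add: X0)
  have 2: "((\<lambda>\<sigma>. FD ?\<phi> (f \<sigma>) (FD f \<sigma> 1)) has_vector_derivative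
      FD (\<lambda>x. FD ?\<phi> x ?W) (f 0) ?W + FD ?\<phi> (f 0) (FD (\<lambda>\<sigma>. FD f \<sigma> 1) 0 1)) (at 0)"
    using has_derivative_imp_vector_derivative[OF has_derivative_FD_apply[OF \<phi> f0 df ddf UNIV_I]] .
  have s1: "FD (\<lambda>x. FD ?\<phi> x ?W) (f 0) ?W + FD ?\<phi> (f 0) (FD (vrep M e X) (f 0) ?W) \<in> S"
  proof (rule derivative_in_subspace[OF S 1 J(1,2)])
    fix \<sigma> assume \<sigma>: "\<sigma> \<in> J"
    have "FD ?\<phi> (f \<sigma>) (vrep M e X (f \<sigma>)) = tcoord M d (\<beta> \<sigma>) (X (\<beta> \<sigma>))"
      using tcoord_change[OF e(1) md, of "\<beta> \<sigma>"] J(3)[OF \<sigma>] e(1) by (simp add: f_def)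
    then show "FD ?\<phi> (f \<sigma>) (vrep M e X (f \<sigma>)) \<in> S"
      using X(3)[OF \<beta>(3)] tangent_space_slice[OF d(1) \<beta>(3)] J(3)[OF \<sigma>] by auto
  qed
  have s2: "FD (\<lambda>x. FD ?\<phi> x ?W) (f 0) ?W + FD ?\<phi> (f 0) (FD (\<lambda>\<sigma>. FD f \<sigma> 1) 0 1) \<in> S"
  proof (rule derivative_in_subspace[OF S 2 J(1,2)])
    fix \<sigma> assume \<sigma>: "\<sigma> \<in> J"
    have "FD ?\<phi> (f \<sigma>) (FD f \<sigma> 1) = tcoord M d (\<beta> \<sigma>) (velocity M UNIV \<beta> \<sigma>)"
      using tcoord_change[OF e(1) md, of "\<beta> \<sigma>" "velocity M UNIV \<beta> \<sigma>"] J(3)[OF \<sigma>] vel[OF \<sigma>] by (simp add: f_def)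
    moreover have "tcoord M d (\<beta> \<sigma>) (velocity M UNIV \<beta> \<sigma>) \<in> S"
      by (rule derivative_in_subspace[OF S smooth_curve_velocity[OF \<beta>(1) _ md] J(1) \<sigma>])
        (use J(3) \<sigma> slice_mem[OF d(1)] \<beta>(3) in blast)+
    ultimately show "FD ?\<phi> (f \<sigma>) (FD f \<sigma> 1) \<in> S" by simp
  qed
  have "FD ?\<phi> (f 0) (FD (\<lambda>\<sigma>. FD f \<sigma> 1) 0 1 - FD (vrep M e X) (f 0) ?W) \<in> S"
    using subspace_diff[OF S s2 s1] linear_diff[OF Cinf_linear_FD[OF \<phi> f0]] by simp
  then have "tcoord M d (\<beta> 0) (tvec M e (\<beta> 0) (FD (\<lambda>\<sigma>. FD f \<sigma> 1) 0 1 - FD (vrep M e X) (f 0) ?W)) \<in> S"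
    using tcoord_change[OF e(1) md e(2) d(2)] e by (simp add: f_def)
  then show ?thesis using tangent_space_slice[OF d(1) p d(2)] by simp
qed

end

section \<open>Gluing the strips\<close>

lemma at_within_Ici: "at t within {t..} = at_right t" for t :: real
proof -
  have "{t..} - {t} = {t<..} - {t}" by auto
  then show ?thesis by (simp add: at_within_def)
qed

lemma at_within_Iic: "at t within {..t} = at_left t" for t :: real
proof -
  have "{..t} - {t} = {..<t} - {t}" by auto
  then show ?thesis by (simp add: at_within_def)
qed

lemma velocity_subset:
  assumes d: "((cmap (chart_at M (\<beta> t)) \<circ> \<beta>) has_vector_derivative x) (at t within S)"
    and S: "S' \<subseteq> S" "at t within S' \<noteq> bot" "at t within S \<noteq> bot"
  shows "velocity M S' \<beta> t = velocity M S \<beta> t"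
  unfolding velocity_def vector_derivative_within[OF S(3) d]
  by (rule vector_derivative_within[OF S(2) has_vector_derivative_within_subset[OF d S(1)]])

lemma cov_deriv_cong:
  assumes S: "at t within S = at t within S'" and ev: "\<forall>\<^sub>F \<tau> in nhds t. \<tau> \<in> S' \<longrightarrow> \<gamma> \<tau> = \<beta> \<tau> \<and> X \<tau> = Y \<tau>" and t: "t \<in> S'"
  shows "cov_deriv_along M nabla S \<gamma> v X t = cov_deriv_along M nabla S' \<beta> v Y t"
proof -
  have "\<gamma> t = \<beta> t" "X t = Y t" using eventually_nhds_x_imp_x[OF ev] t by auto
  moreover have "vector_derivative (\<lambda>\<tau>. tcoord M c (\<gamma> \<tau>) (X \<tau>)) (at t within S') =
      vector_derivative (\<lambda>\<tau>. tcoord M c (\<beta> \<tau>) (Y \<tau>)) (at t within S')" for c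
  proof (rule vector_derivative_cong_eq[OF _ refl refl t])
    show "\<forall>\<^sub>F \<tau> in nhds t. \<tau> \<in> S' \<longrightarrow> tcoord M c (\<gamma> \<tau>) (X \<tau>) = tcoord M c (\<beta> \<tau>) (Y \<tau>)"
      using ev by eventually_elim simp
  qed
  moreover have "velocity M S \<gamma> t = velocity M S' \<beta> t"
    using velocity_at_within[OF S, of M \<gamma>] velocity_cong[OF _ t, of \<gamma> \<beta> M] ev by (simp add: eventually_mono)
  ultimately show ?thesis unfolding cov_deriv_along_def Let_def S by simp
qed

context pseudo_finsler_mfd
begin

lemma g_sym: "v \<in> A \<Longrightarrow> g v x y = g v y x"
  using fundamental_tensor_chart[OF chart_at(1), of v "fst v"] chart_at(2)[of "fst v"]
    finsler_model.fund_sym[OF model0[OF chart_at(1)] bundle_map_mem[OF mchart_chart_at]] by simp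

lemma g_linear2: "v \<in> A \<Longrightarrow> linear (g v u)"
proof -
  assume v: "v \<in> A"
  let ?c = "chart_at M (fst v)"
  have c: "?c \<in> M" "fst v \<in> cdom ?c" by (simp_all add: chart_at)
  have "g v u w = fnd ?c (bundle_map M ?c v) u w" for u w
    using fundamental_tensor_chart[OF c(1) v c(2)] by simp
  then show ?thesis
    using finsler_model.fund_linear2[OF model0[OF c(1)] bundle_map_mem[OF mchart_chart_at v c(2)], of u] by presburger
qed

lemma g_linear1: "v \<in> A \<Longrightarrow> linear (\<lambda>u. g v u w)"
  using g_linear2[of v w] g_sym[of v _ w] by simp

text \<open>Admissibility speaks of right and left velocities, a strip of velocities within
  \<open>{c..d}\<close>. The right velocity identifies the latter for \<open>t < d\<close>, the left
  one at \<open>t = d\<close>.\<close>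

lemma admissible_variation_strip:
  assumes var: "admissible_variation M A a b B \<epsilon> \<gamma> \<Lambda>"
    and cd: "a \<le> c" "c < d" "d \<le> b" "{c<..<d} \<inter> B = {}"
  shows "strip M A nabla L Q c d \<epsilon> \<Lambda>"
proof (intro strip.intro strip_axioms.intro pseudo_finsler_mfd_axioms)
  show "c < d" "0 < \<epsilon>" using cd var by (auto simp: admissible_variation_def)
  show sm: "smooth_into M ({c..d} \<times> {-\<epsilon><..<\<epsilon>}) \<Lambda>" using var cd unfolding admissible_variation_def by blast
  fix t s assume t: "t \<in> {c..d}" and s: "s \<in> {-\<epsilon><..<\<epsilon>}"
  define \<beta> where "\<beta> = (\<lambda>\<tau>. \<Lambda> (\<tau>, s))"
  let ?e = "chart_at M (\<beta> t)"
  have adm: "admissible_curve M A a b B \<beta>" using var s unfolding admissible_variation_def \<beta>_def by blast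
  have "(t, s) \<in> {c..d} \<times> {-\<epsilon><..<\<epsilon>}" using t s by simp
  moreover have "\<Lambda> (t, s) \<in> cdom ?e" by (simp add: \<beta>_def chart_at)
  ultimately obtain U F where U: "(t, s) \<in> U" "Cinf U F"
    "\<And>y'. y' \<in> U \<inter> {c..d} \<times> {-\<epsilon><..<\<epsilon>} \<Longrightarrow> \<Lambda> y' \<in> cdom ?e \<and> F y' = cmap ?e (\<Lambda> y')"
    using strip_local[OF sm _ chart_at(1)] by blast
  have "((\<lambda>\<tau>. F (\<tau>, s)) has_vector_derivative FD F (t, s) (1, 0)) (at t within {c..d})"
    using partial_derivative_1[OF Cinf_differentiable[OF U(2,1)]] by (rule has_vector_derivative_at_within)
  moreover have "\<forall>\<^sub>F \<tau> in at t within {c..d}. F (\<tau>, s) = (cmap ?e \<circ> \<beta>) \<tau>"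
    using eventually_slice_1[OF Cinf_open[OF U(2)] U(1)] by eventually_elim (use U(3) s in \<open>auto simp: \<beta>_def\<close>)
  ultimately have d: "((cmap ?e \<circ> \<beta>) has_vector_derivative FD F (t, s) (1, 0)) (at t within {c..d})"
    by (rule has_vector_derivative_transform_eventually) (use U(1,3) t s in \<open>auto simp: \<beta>_def\<close>)
  note nb = Icc_not_bot[OF cd(2) t]
  have "velocity_lift M {c..d} \<beta> t \<in> A"
  proof (cases "t < d")
    case True
    then have f: "at t within {t..} = at t within {t..d}" by (simp add: at_within_Ici at_within_Icc_at_right)
    have "velocity M {t..} \<beta> t = velocity M {c..d} \<beta> t"
      unfolding velocity_at_within[OF f]
      by (rule velocity_subset[OF d]) (use t True nb in \<open>auto simp: Icc_not_bot\<close>)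
    moreover have "velocity_lift M {t..} \<beta> t \<in> A" using adm t True cd unfolding admissible_curve_def by auto
    ultimately show ?thesis by (simp add: velocity_lift_def)
  next
    case False
    then have td: "t = d" using t by simp
    then have f: "at t within {..t} = at t within {c..d}" using cd by (simp add: at_within_Iic at_within_Icc_at_left)
    have "velocity_lift M {..t} \<beta> t \<in> A" using adm td cd unfolding admissible_curve_def by auto
    then show ?thesis by (simp add: velocity_lift_def velocity_at_within[OF f])
  qed
  then show "velocity_lift M {c..d} (\<lambda>t. \<Lambda> (t, s)) t \<in> A" by (simp add: \<beta>_def)
qed

section \<open>The first variation with breaks\<close>

context
  fixes a b \<epsilon> :: real and B :: "real set" and \<gamma> :: "real \<Rightarrow> 'm" and \<Lambda> :: "real \<times> real \<Rightarrow> 'm"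
  assumes ab: "a < b" and var: "admissible_variation M A a b B \<epsilon> \<gamma> \<Lambda>"
begin

abbreviation "lift \<equiv> velocity_lift M {a..b} \<gamma>"
abbreviation "Wf \<equiv> variation_field M \<Lambda>"
abbreviation "integrand \<equiv> \<lambda>t. g (lift t) (Wf t) (cov_deriv_along M nabla {a..b} \<gamma> (lift t) (velocity M {a..b} \<gamma>) t)"
abbreviation "den \<equiv> \<lambda>s t. L (velocity_lift M {a..b} (\<lambda>t. \<Lambda> (t, s)) t)"
abbreviation "lm \<equiv> \<lambda>t. legendre L (velocity_lift M {..t} \<gamma> t) (Wf t)"
abbreviation "lp \<equiv> \<lambda>t. legendre L (velocity_lift M {t..} \<gamma> t) (Wf t)"

lemma gamma_eq: "t \<in> {a..b} \<Longrightarrow> \<gamma> t = \<Lambda> (t, 0)"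
  using var by (simp add: admissible_variation_def)

lemma eps_pos: "0 < \<epsilon>"
  using var by (simp add: admissible_variation_def)

lemma velocity_gamma:
  assumes "S \<subseteq> {a..b}" "t \<in> S"
  shows "velocity M S \<gamma> t = velocity M S (\<lambda>t. \<Lambda> (t, 0)) t"
  by (rule velocity_cong) (use assms gamma_eq in \<open>auto intro!: always_eventually\<close>)

text \<open>Velocities within \<open>{a..b}\<close> and within \<open>{c..d}\<close> are compared in
  the interior of \<open>{c..d}\<close> only; the two endpoints are negligible for the integrals.
  The boundary terms use the one-sided velocities, which are those of the piece.\<close>

lemma first_variation_piece:
  assumes cd: "a \<le> c" "c < d" "d \<le> b" "{c<..<d} \<inter> B = {}"
  shows "\<And>s. s \<in> {-\<epsilon><..<\<epsilon>} \<Longrightarrow> den s integrable_on {c..d}" and "integrand integrable_on {c..d}"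
    and "((\<lambda>s. 1 / 2 * integral {c..d} (den s)) has_real_derivative (- integral {c..d} integrand + (lm d - lp c))) (at 0)"
proof -
  interpret st: strip M A nabla L Q c d \<epsilon> \<Lambda> by (rule admissible_variation_strip[OF var cd])
  have sub: "{c..d} \<subseteq> {a..b}" using cd by auto
  have f: "at t within {a..b} = at t within {c..d}" if "t \<in> {c<..<d}" for t
    using that cd by (simp add: at_within_Icc_at)
  have vel: "velocity M {a..b} \<gamma> t = st.vel t 0" if "t \<in> {c<..<d}" for t
    unfolding velocity_at_within[OF f[OF that]] by (rule velocity_gamma[OF sub]) (use that in auto)
  have lift: "lift t = st.T t" if "t \<in> {c<..<d}" for t
    using vel[OF that] gamma_eq[of t] that cd by (simp add: velocity_lift_def)
  have den: "den s t = st.edens (t, s)" if "t \<in> {c<..<d}" for s t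
    by (simp add: st.edens_def velocity_lift_def velocity_at_within[OF f[OF that]])
  have acc: "cov_deriv_along M nabla {a..b} \<gamma> v (velocity M {a..b} \<gamma>) t
      = cov_deriv_along M nabla {c..d} (\<lambda>t. \<Lambda> (t, 0)) v (\<lambda>t. st.vel t 0) t" if t: "t \<in> {c<..<d}" for v t
  proof (rule cov_deriv_cong[OF f[OF t]])
    have "\<forall>\<^sub>F \<tau> in nhds t. \<tau> \<in> {c<..<d}" using t by (intro eventually_nhds_in_open) auto
    then show "\<forall>\<^sub>F \<tau> in nhds t. \<tau> \<in> {c..d} \<longrightarrow> \<gamma> \<tau> = \<Lambda> (\<tau>, 0) \<and> velocity M {a..b} \<gamma> \<tau> = st.vel \<tau> 0"
      by eventually_elim (use vel gamma_eq cd in auto)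
  qed (use t in auto)
  have integrand: "integrand t = g (st.T t) (st.W t) (st.accel t)" if "t \<in> {c<..<d}" for t
    using lift[OF that] acc[OF that] by (simp add: variation_field_def)
  have neg: "negligible {c, d}" by simp
  have iden: "integral {c..d} (den s) = integral {c..d} (\<lambda>t. st.edens (t, s))" for s
    by (rule integral_spike[OF neg]) (use den in auto)
  have iint: "integral {c..d} integrand = integral {c..d} (\<lambda>t. g (st.T t) (st.W t) (st.accel t))"
    by (rule integral_spike[OF neg]) (use integrand in auto)
  show "den s integrable_on {c..d}" if "s \<in> {-\<epsilon><..<\<epsilon>}" for s
    by (rule integrable_spike[OF smooth_strip_integrable[OF st.edens_smooth that] neg]) (use den in auto)
  show "integrand integrable_on {c..d}"
    by (rule integrable_spike[OF st.strip_first_variation(2) neg]) (use integrand in auto)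
  have "velocity_lift M {..d} \<gamma> d = st.T d" "velocity_lift M {c..} \<gamma> c = st.T c"
    using velocity_at_within[of d "{..d}" "{c..d}" M \<gamma>] velocity_at_within[of c "{c..}" "{c..d}" M \<gamma>]
      velocity_gamma[OF sub, of d] velocity_gamma[OF sub, of c] gamma_eq[of c] gamma_eq[of d] cd
    by (auto simp: velocity_lift_def at_within_Ici at_within_Iic at_within_Icc_at_left at_within_Icc_at_right)
  then have "lm d = g (st.T d) (st.vel d 0) (st.W d)" "lp c = g (st.T c) (st.vel c 0) (st.W c)"
    by (auto simp: legendre_def variation_field_def) (auto simp: velocity_lift_def)
  then show "((\<lambda>s. 1 / 2 * integral {c..d} (den s)) has_real_derivative (- integral {c..d} integrand + (lm d - lp c))) (at 0)"
    using st.strip_first_variation(1) unfolding iden iint by simp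
qed

text \<open>The last break \<open>m\<close> is split off; the right end \<open>d\<close> is variable
  so that the induction hypothesis applies up to \<open>m\<close>. The boundary terms
  \<open>lm m\<close> from the left part and \<open>- lp m\<close> from the right part make up the
  jump at \<open>m\<close>.\<close>

lemma first_variation_breaks:
  assumes "finite B'"
  shows "\<And>d. a < d \<Longrightarrow> d \<le> b \<Longrightarrow> {a<..<d} \<inter> B = B' \<Longrightarrow>
    (\<forall>s\<in>{-\<epsilon><..<\<epsilon>}. den s integrable_on {a..d}) \<and> integrand integrable_on {a..d} \<and>
    ((\<lambda>s. 1 / 2 * integral {a..d} (den s)) has_real_derivative
      (- integral {a..d} integrand + (lm d - lp a) + (\<Sum>t\<in>B'. lm t - lp t))) (at 0)"
  using assms
proof (induction B' rule: finite_linorder_max_induct)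
  case empty
  then show ?case using first_variation_piece[of a d] by simp
next
  case (insert m B')
  have m: "a < m" "m < d" "m \<in> B" using insert.prems(3) by auto
  have B': "{a<..<m} \<inter> B = B'"
  proof (intro equalityI subsetI)
    fix x assume "x \<in> {a<..<m} \<inter> B"
    then have "x \<in> insert m B'" "x \<noteq> m" using insert.prems(3) m by auto
    then show "x \<in> B'" by simp
  next
    fix x assume "x \<in> B'"
    then show "x \<in> {a<..<m} \<inter> B" using insert.prems(3) insert.hyps(2) by auto
  qed
  have nb: "{m<..<d} \<inter> B = {}"
  proof (rule ccontr)
    assume "\<not> ?thesis"
    then obtain x where x: "x \<in> {m<..<d}" "x \<in> B" by blast
    then have "x \<in> insert m B'" using insert.prems(3) m by auto
    then show False using x insert.hyps(2) by auto
  qed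
  note IH = insert.IH[OF m(1) less_imp_le[OF less_le_trans[OF m(2) insert.prems(2)]] B']
  note piece = first_variation_piece[OF less_imp_le[OF m(1)] m(2) insert.prems(2) nb]
  have ord: "a \<le> m" "m \<le> d" using m by auto
  have den: "den s integrable_on {a..d}" if "s \<in> {-\<epsilon><..<\<epsilon>}" for s
    by (rule Henstock_Kurzweil_Integration.integrable_combine[OF ord]) (use IH piece(1) that in blast)+
  have int: "integrand integrable_on {a..d}"
    by (rule Henstock_Kurzweil_Integration.integrable_combine[OF ord]) (use IH piece(2) in blast)+
  have "((\<lambda>s. 1 / 2 * integral {a..m} (den s) + 1 / 2 * integral {m..d} (den s)) has_real_derivative
      (- integral {a..m} integrand + (lm m - lp a) + (\<Sum>t\<in>B'. lm t - lp t)) + (- integral {m..d} integrand + (lm d - lp m))) (at 0)"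
    using IH piece(3) by (intro DERIV_add) auto
  then have "((\<lambda>s. 1 / 2 * integral {a..d} (den s)) has_real_derivative
      (- integral {a..m} integrand + (lm m - lp a) + (\<Sum>t\<in>B'. lm t - lp t)) + (- integral {m..d} integrand + (lm d - lp m))) (at 0)"
  proof (rule has_field_derivative_transform_within_open[where S="{-\<epsilon><..<\<epsilon>}"])
    fix s assume "s \<in> {-\<epsilon><..<\<epsilon>}"
    then show "1 / 2 * integral {a..m} (den s) + 1 / 2 * integral {m..d} (den s) = 1 / 2 * integral {a..d} (den s)"
      using Henstock_Kurzweil_Integration.integral_combine[OF ord den] by simp
  qed (use eps_pos in auto)
  moreover have "m \<notin> B'" using insert.hyps(2) by auto
  moreover have "integral {a..d} integrand = integral {a..m} integrand + integral {m..d} integrand"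
    using Henstock_Kurzweil_Integration.integral_combine[OF ord int] by simp
  ultimately show ?case using den int insert.hyps(1) by (simp add: algebra_simps)
qed

lemma lift_mem: "lift a \<in> A" "lift b \<in> A"
proof -
  have fa: "at a within {a..} = at a within {a..b}" and fb: "at b within {..b} = at b within {a..b}"
    using ab by (simp_all add: at_within_Ici at_within_Iic at_within_Icc_at_left at_within_Icc_at_right)
  have "admissible_curve M A a b B (\<lambda>t. \<Lambda> (t, 0))" using var eps_pos unfolding admissible_variation_def by auto
  then have "velocity_lift M {a..} (\<lambda>t. \<Lambda> (t, 0)) a \<in> A" "velocity_lift M {..b} (\<lambda>t. \<Lambda> (t, 0)) b \<in> A"
    using ab unfolding admissible_curve_def by auto
  then show "lift a \<in> A" "lift b \<in> A"
    using ab by (simp_all add: velocity_lift_def velocity_at_within[OF fa] velocity_at_within[OF fb]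
        velocity_gamma[OF order_refl] gamma_eq)
qed

lemma first_variation:
  assumes B: "finite B" "B \<subseteq> {a<..<b}"
  shows "((\<lambda>s. energy M L a b (\<lambda>t. \<Lambda> (t, s))) has_real_derivative
    (- integral {a..b} integrand
     + (g (lift b) (Wf b) (velocity M {a..b} \<gamma> b) - g (lift a) (Wf a) (velocity M {a..b} \<gamma> a))
     + (\<Sum>t\<in>B. lm t - lp t))) (at 0)"
proof -
  have "{a<..<b} \<inter> B = B" using B(2) by auto
  note d = first_variation_breaks[OF B(1) ab order_refl this]
  have fa: "at a within {a..} = at a within {a..b}" and fb: "at b within {..b} = at b within {a..b}"
    using ab by (simp_all add: at_within_Ici at_within_Iic at_within_Icc_at_left at_within_Icc_at_right)
  have "lm b = g (lift b) (Wf b) (velocity M {a..b} \<gamma> b)" "lp a = g (lift a) (Wf a) (velocity M {a..b} \<gamma> a)"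
    using g_sym[OF lift_mem(1)] g_sym[OF lift_mem(2)]
    by (simp_all add: legendre_def velocity_lift_def velocity_at_within[OF fa] velocity_at_within[OF fb])
  then show ?thesis using d by (simp add: energy_def)
qed

end

end

context strip
begin

section \<open>Boundary terms and the second variation formula\<close>

lemma transversal_smooth: "t \<in> {c..d} \<Longrightarrow> smooth_into M I (\<lambda>s. \<Lambda> (t, s))"
  unfolding smooth_into_def
proof (intro conjI ballI)
  assume t: "t \<in> {c..d}"
  show "continuous_on I (\<lambda>s. \<Lambda> (t, s))"
    using strip_cont2[OF t] by (simp add: continuous_at_imp_continuous_on)
  fix e assume e: "e \<in> M"
  show "smooth_on {s \<in> I. \<Lambda> (t, s) \<in> cdom e} (cmap e \<circ> (\<lambda>s. \<Lambda> (t, s)))"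
  proof (rule smooth_onI)
    fix s assume s: "s \<in> {s \<in> I. \<Lambda> (t, s) \<in> cdom e}"
    then have "(t, s) \<in> {c..d} \<times> I" "\<Lambda> (t, s) \<in> cdom e" using t by auto
    then obtain U F where U: "(t, s) \<in> U" "Cinf U F" "\<And>y'. y' \<in> U \<inter> {c..d} \<times> I \<Longrightarrow> \<Lambda> y' \<in> cdom e \<and> F y' = cmap e (\<Lambda> y')"
      using strip_local[OF strip_smooth _ e] by blast
    show "\<exists>U F. s \<in> U \<and> Cinf U F \<and> (\<forall>y\<in>U \<inter> {s \<in> I. \<Lambda> (t, s) \<in> cdom e}. F y = (cmap e \<circ> (\<lambda>s. \<Lambda> (t, s))) y)"
      by (intro exI[of _ "(\<lambda>\<sigma>. (t, \<sigma>)) -` U"] exI[of _ "\<lambda>\<sigma>. F (t, \<sigma>)"])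
        (use U t Cinf_slice[OF U(2), of t] in auto)
  qed
qed

text \<open>\<open>DsW t\<close> and \<open>nabla (T t) X X\<close> differ by a vector tangent to
  \<open>P\<close>, and so do the latter and its normal part; the velocity is orthogonal to both
  differences. Non-degeneracy on the tangent space makes the normal part well defined.\<close>

lemma boundary_term:
  assumes t: "t \<in> {c..d}" and P: "submanifold M P" "\<And>s. s \<in> I \<Longrightarrow> \<Lambda> (t, s) \<in> P"
    and orth: "orthogonal_to M g P (T t)" and nd: "nondegenerate_on (g (T t)) (tangent_space M P (\<Lambda> (t, 0)))"
  shows "g (T t) (vel t 0) (DsW t) = g (T t) (second_fundamental_form M nabla g P (T t) (W t) (W t)) (vel t 0)"
proof -
  let ?p = "\<Lambda> (t, 0)" and ?\<beta> = "\<lambda>s. \<Lambda> (t, s)" and ?e = "chart_at M (\<Lambda> (t, 0))" and ?TP = "tangent_space M P (\<Lambda> (t, 0))"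
  note sm = transversal_smooth[OF t] and TA = strip_adm[OF t zero_I]
  have e: "?e \<in> M" "mchart M ?e" "?p \<in> cdom ?e" by (simp_all add: chart_at)
  have p: "?p \<in> P" by (rule P(2)[OF zero_I])
  have W: "W t \<in> ?TP"
    unfolding tangent_space_def using sm eps P(2) by (intro CollectI exI[of _ ?\<beta>]) auto
  define X where "X = tangent_ext M P ?p (W t)"
  have X: "X \<in> vector_fields M" "X ?p = W t" "\<And>q. q \<in> P \<Longrightarrow> X q \<in> tangent_space M P q"
    unfolding X_def by (rule tangent_ext[OF P(1) p W])+
  define f where "f = (\<lambda>s. cmap ?e (\<Lambda> (t, s)))"
  obtain J where J: "0 \<in> J" "Cinf J f" "J \<subseteq> I" "\<And>\<sigma>. \<sigma> \<in> J \<Longrightarrow> \<Lambda> (t, \<sigma>) \<in> cdom ?e"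
    unfolding f_def by (rule smooth_curve_chart[OF sm zero_I e(2,3)]) (rule that[unfolded f_def])
  have f1: "W t = FD f 0 1"
    using smooth_curve_velocity[OF sm zero_I e(2,3)] Cinf_real_derivative[OF J(2,1)] vector_derivative_unique_at
    unfolding f_def by (metis tcoord_chart_at)
  have "isCont ?\<beta> \<sigma>" if "\<sigma> \<in> J" for \<sigma> using strip_cont2[OF t] J(3) that by blast
  then have "tcoord M ?e (?\<beta> 0) (DsW t) =
      FD (\<lambda>\<sigma>. FD f \<sigma> 1) 0 1 + \<Gamma> ?e (bundle_map M ?e (T t)) (FD f 0 1) (FD f 0 1)"
    by (intro acceleration_chart[OF e(1) J(2,1) _ TA]) (use J(4) in \<open>auto simp: f_def velocity_lift_def\<close>)
  then have acc: "DsW t = FD (\<lambda>\<sigma>. FD f \<sigma> 1) 0 1 + \<Gamma> ?e (bundle_map M ?e (T t)) (FD f 0 1) (FD f 0 1)"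
    by simp
  let ?n = "nabla (T t) X X"
  have nab: "?n = FD (vrep M ?e X) (f 0) (FD f 0 1) + \<Gamma> ?e (bundle_map M ?e (T t)) (FD f 0 1) (FD f 0 1)"
    using nabla_chart[OF e(2) TA _ X(1) X(1)] e(3) X(2) f1 by (simp add: velocity_lift_def f_def)
  have "tvec M ?e ?p (FD (\<lambda>\<sigma>. FD f \<sigma> 1) 0 1 - FD (vrep M ?e X) (f 0) (FD f 0 1)) \<in> ?TP"
    unfolding f_def by (rule acceleration_tangent[OF P(1) sm eps P(2) e(2,3) X])
  moreover have "tvec M ?e ?p x = x" for x using tvec_tcoord[OF e(2,3), of x] by simp
  ultimately have 1: "DsW t - ?n \<in> ?TP" by (simp add: acc nab)
  note sub = tangent_space_subspace[OF P(1) p]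
  let ?N = "normal_part (g (T t)) ?TP ?n"
  have "?n - ?N \<in> ?TP" by (rule normal_part(1)[OF sub g_linear1[OF TA] g_linear2[OF TA] nd])
  then have "DsW t - ?N \<in> ?TP" using subspace_add[OF sub 1] by fastforce
  then have "g (T t) (vel t 0) (DsW t - ?N) = 0"
    using orth by (simp add: orthogonal_to_def velocity_lift_def)
  then have "g (T t) (vel t 0) (DsW t) = g (T t) (vel t 0) ?N"
    using linear_diff[OF g_linear2[OF TA]] by simp
  also have "\<dots> = g (T t) ?N (vel t 0)" by (rule g_sym[OF TA])
  finally show ?thesis by (simp add: second_fundamental_form_def X_def velocity_lift_def)
qed

lemma second_variation:
  fixes \<gamma> :: "real \<Rightarrow> 'm"
  assumes eq: "\<And>t. t \<in> {c..d} \<Longrightarrow> \<gamma> t = \<Lambda> (t, 0)" and geo: "geodesic M A nabla c d \<gamma>"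
    and P: "submanifold M P" "\<And>s. s \<in> I \<Longrightarrow> \<Lambda> (c, s) \<in> P" and P': "submanifold M P'" "\<And>s. s \<in> I \<Longrightarrow> \<Lambda> (d, s) \<in> P'"
    and orth: "orthogonal_to M g P (velocity_lift M {c..d} \<gamma> c)" "orthogonal_to M g P' (velocity_lift M {c..d} \<gamma> d)"
    and nd: "nondegenerate_on (g (velocity_lift M {c..d} \<gamma> c)) (tangent_space M P (\<gamma> c))"
      "nondegenerate_on (g (velocity_lift M {c..d} \<gamma> d)) (tangent_space M P' (\<gamma> d))"
  defines "E \<equiv> \<lambda>s. energy M L c d (\<lambda>t. \<Lambda> (t, s))" and "Tg \<equiv> velocity_lift M {c..d} \<gamma>" and "\<gamma>' \<equiv> velocity M {c..d} \<gamma>"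
    and "Wv \<equiv> variation_field M \<Lambda>"
  shows "\<forall>\<^sub>F s in nhds 0. E differentiable (at s)"
    and "(deriv E has_real_derivative
      (integral {c..d} (\<lambda>t. - g (Tg t) (curvature M A nabla (Tg t) (\<gamma>' t) (Wv t) (Wv t)) (\<gamma>' t)
          + g (Tg t) (cov_deriv_along M nabla {c..d} \<gamma> (Tg t) Wv t) (cov_deriv_along M nabla {c..d} \<gamma> (Tg t) Wv t))
        + g (Tg d) (second_fundamental_form M nabla g P' (Tg d) (Wv d) (Wv d)) (\<gamma>' d)
        - g (Tg c) (second_fundamental_form M nabla g P (Tg c) (Wv c) (Wv c)) (\<gamma>' c))) (at 0)"
proof -
  have ends: "c \<in> {c..d}" "d \<in> {c..d}" using cd by auto
  have Wv: "Wv = W" by (simp add: Wv_def variation_field_def fun_eq_iff)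
  have vel: "\<gamma>' t = vel t 0" if "t \<in> {c..d}" for t
    unfolding \<gamma>'_def by (rule velocity_cong) (use eq that in \<open>auto intro!: always_eventually\<close>)
  have Tg: "Tg t = T t" if "t \<in> {c..d}" for t
    using vel[OF that] eq[OF that] by (simp add: Tg_def \<gamma>'_def velocity_lift_def)
  have cov: "cov_deriv_along M nabla {c..d} \<gamma> v X t = cov_deriv_along M nabla {c..d} (\<lambda>t. \<Lambda> (t, 0)) v Y t"
    if "t \<in> {c..d}" "\<And>\<tau>. \<tau> \<in> {c..d} \<Longrightarrow> X \<tau> = Y \<tau>" for v X Y t
    by (rule cov_deriv_cong) (use that eq in \<open>auto intro!: always_eventually\<close>)
  have accel: "accel t = 0" if "t \<in> {c..d}" for t
  proof -
    have "cov_deriv_along M nabla {c..d} \<gamma> (Tg t) \<gamma>' t = 0"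
      using geo that unfolding geodesic_def Tg_def \<gamma>'_def by blast
    moreover have "cov_deriv_along M nabla {c..d} \<gamma> (T t) \<gamma>' t = accel t" by (rule cov[OF that vel])
    ultimately show ?thesis using Tg[OF that] by simp
  qed
  have Ed: "(E has_real_derivative 1 / 2 * integral {c..d} (\<lambda>t. edens1 (t, s))) (at s)" if "s \<in> I" for s
    using DERIV_cmult[OF edens1(3)[OF that], of "1 / 2"] by (simp add: E_def energy_def edens_def)
  have "\<forall>\<^sub>F s in nhds 0. s \<in> I" using zero_I by (intro eventually_nhds_in_open) auto
  then show "\<forall>\<^sub>F s in nhds 0. E differentiable (at s)"
    by eventually_elim (use Ed real_differentiable_def in blast)
  \<comment> \<open>The first derivative of \<open>E\<close> is known on all of \<open>I\<close> and
    not only at 0, so \<open>deriv E\<close> may be replaced near 0 by half the integral of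
    \<open>edens1\<close> before differentiating again.\<close>
  have "(deriv E has_real_derivative
      (integral {c..d} (\<lambda>t. - g (T t) (curvW t) (vel t 0) + g (T t) (DW t) (DW t))
       + g (T d) (vel d 0) (DsW d) - g (T c) (vel c 0) (DsW c))) (at 0)"
    by (rule has_field_derivative_transform_within_open[OF strip_second_variation[OF accel] _ zero_I])
      (auto simp: DERIV_imp_deriv[OF Ed])
  moreover have "integral {c..d} (\<lambda>t. - g (Tg t) (curvature M A nabla (Tg t) (\<gamma>' t) (Wv t) (Wv t)) (\<gamma>' t)
          + g (Tg t) (cov_deriv_along M nabla {c..d} \<gamma> (Tg t) Wv t) (cov_deriv_along M nabla {c..d} \<gamma> (Tg t) Wv t))
      = integral {c..d} (\<lambda>t. - g (T t) (curvW t) (vel t 0) + g (T t) (DW t) (DW t))"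
    by (rule Henstock_Kurzweil_Integration.integral_cong) (use cov[of _ W W] in \<open>simp add: vel Tg Wv\<close>)
  moreover have "g (Tg d) (second_fundamental_form M nabla g P' (Tg d) (Wv d) (Wv d)) (\<gamma>' d) = g (T d) (vel d 0) (DsW d)"
    using boundary_term[OF ends(2) P'] orth(2) nd(2) Tg[OF ends(2)] vel[OF ends(2)] eq[OF ends(2)] by (simp add: Tg_def Wv)
  moreover have "g (Tg c) (second_fundamental_form M nabla g P (Tg c) (Wv c) (Wv c)) (\<gamma>' c) = g (T c) (vel c 0) (DsW c)"
    using boundary_term[OF ends(1) P] orth(1) nd(1) Tg[OF ends(1)] vel[OF ends(1)] eq[OF ends(1)] by (simp add: Tg_def Wv)
  ultimately show "(deriv E has_real_derivative
      (integral {c..d} (\<lambda>t. - g (Tg t) (curvature M A nabla (Tg t) (\<gamma>' t) (Wv t) (Wv t)) (\<gamma>' t)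
          + g (Tg t) (cov_deriv_along M nabla {c..d} \<gamma> (Tg t) Wv t) (cov_deriv_along M nabla {c..d} \<gamma> (Tg t) Wv t))
        + g (Tg d) (second_fundamental_form M nabla g P' (Tg d) (Wv d) (Wv d)) (\<gamma>' d)
        - g (Tg c) (second_fundamental_form M nabla g P (Tg c) (Wv c) (Wv c)) (\<gamma>' c))) (at 0)"
    by simp
qed

end

theorem proposition3p8:
  fixes M :: "('m::{t2_space, second_countable_topology}, 'e::euclidean_space) chart set"
    and A :: "('m \<times> 'e) set"
    and L :: "'m \<times> 'e \<Rightarrow> real"
    and g :: "'m \<times> 'e \<Rightarrow> 'e \<Rightarrow> 'e \<Rightarrow> real"
    and Q :: "'m \<times> 'e \<Rightarrow> 'e \<Rightarrow> 'e \<Rightarrow> 'e \<Rightarrow> real"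
    and nabla :: "('m, 'e) aniso_map"
  assumes "smooth_manifold M"
    and "conic_domain M A"
    and "pseudo_finsler M A L"
    and g: "g = fundamental_tensor L"
    and "aniso_tensor3 M A Q"
    and "symmetric3 A Q"
    and "\<forall>v\<in>A. \<forall>u w. Q v (snd v) u w = 0"
    and "aniso_connection M A nabla"
    and "torsion_free M A nabla"
    and "nabla_metric_eq M A nabla g Q"
  shows
    "(\<forall>a b B \<epsilon> \<gamma> \<Lambda>.
        break_set a b B \<and> admissible_variation M A a b B \<epsilon> \<gamma> \<Lambda> \<longrightarrow>
        (let W = variation_field M \<Lambda>;
             \<gamma>' = velocity M {a..b} \<gamma>;
             T = velocity_lift M {a..b} \<gamma>
         in ((\<lambda>s. energy M L a b (\<lambda>t. \<Lambda> (t, s))) has_real_derivative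
               (- integral {a..b} (\<lambda>t. g (T t) (W t) (cov_deriv_along M nabla {a..b} \<gamma> (T t) \<gamma>' t))
                + (g (T b) (W b) (\<gamma>' b) - g (T a) (W a) (\<gamma>' a))
                + (\<Sum>t\<in>B. legendre L (velocity_lift M {..t} \<gamma> t) (W t)
                          - legendre L (velocity_lift M {t..} \<gamma> t) (W t)))) (at 0))) \<and>
     (\<forall>a b \<epsilon> \<gamma> \<Lambda> P P'.
        a < b \<and> geodesic M A nabla a b \<gamma> \<and>
        submanifold M P \<and> submanifold M P' \<and> \<gamma> a \<in> P \<and> \<gamma> b \<in> P' \<and>
        orthogonal_to M g P (velocity_lift M {a..b} \<gamma> a) \<and>
        orthogonal_to M g P' (velocity_lift M {a..b} \<gamma> b) \<and>
        nondegenerate_on (g (velocity_lift M {a..b} \<gamma> a)) (tangent_space M P (\<gamma> a)) \<and>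
        nondegenerate_on (g (velocity_lift M {a..b} \<gamma> b)) (tangent_space M P' (\<gamma> b)) \<and>
        admissible_variation M A a b {} \<epsilon> \<gamma> \<Lambda> \<and>
        (\<forall>s\<in>{-\<epsilon><..<\<epsilon>}. \<Lambda> (a, s) \<in> P \<and> \<Lambda> (b, s) \<in> P') \<longrightarrow>
        (let W = variation_field M \<Lambda>;
             \<gamma>' = velocity M {a..b} \<gamma>;
             T = velocity_lift M {a..b} \<gamma>;
             DW = (\<lambda>t. cov_deriv_along M nabla {a..b} \<gamma> (T t) W t);
             E = (\<lambda>s. energy M L a b (\<lambda>t. \<Lambda> (t, s)))
         in (\<forall>\<^sub>F s in nhds 0. E differentiable (at s)) \<and>
            (deriv E has_real_derivative
               (integral {a..b} (\<lambda>t. - g (T t) (curvature M A nabla (T t) (\<gamma>' t) (W t) (W t)) (\<gamma>' t)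
                                     + g (T t) (DW t) (DW t))
                + g (T b) (second_fundamental_form M nabla g P' (T b) (W b) (W b)) (\<gamma>' b)
                - g (T a) (second_fundamental_form M nabla g P (T a) (W a) (W a)) (\<gamma>' a))) (at 0)))"
proof -
  interpret pseudo_finsler_mfd M A nabla L Q
    by unfold_locales (use assms in auto)
  show ?thesis
    unfolding g Let_def
  proof (intro conjI allI impI)
    fix a b B \<epsilon> \<gamma> \<Lambda>
    assume "break_set a b B \<and> admissible_variation M A a b B \<epsilon> \<gamma> \<Lambda>"
    then show "((\<lambda>s. energy M L a b (\<lambda>t. \<Lambda> (t, s))) has_real_derivative
       (- integral {a..b} (\<lambda>t. fundamental_tensor L (velocity_lift M {a..b} \<gamma> t) (variation_field M \<Lambda> t)
            (cov_deriv_along M nabla {a..b} \<gamma> (velocity_lift M {a..b} \<gamma> t) (velocity M {a..b} \<gamma>) t))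
        + (fundamental_tensor L (velocity_lift M {a..b} \<gamma> b) (variation_field M \<Lambda> b) (velocity M {a..b} \<gamma> b)
           - fundamental_tensor L (velocity_lift M {a..b} \<gamma> a) (variation_field M \<Lambda> a) (velocity M {a..b} \<gamma> a))
        + (\<Sum>t\<in>B. legendre L (velocity_lift M {..t} \<gamma> t) (variation_field M \<Lambda> t)
                  - legendre L (velocity_lift M {t..} \<gamma> t) (variation_field M \<Lambda> t)))) (at 0)"
      by (intro first_variation) (auto simp: break_set_def)
  next
    fix a b \<epsilon> \<gamma> \<Lambda> P P'
    assume *: "a < b \<and> geodesic M A nabla a b \<gamma> \<and>
        submanifold M P \<and> submanifold M P' \<and> \<gamma> a \<in> P \<and> \<gamma> b \<in> P' \<and>
        orthogonal_to M (fundamental_tensor L) P (velocity_lift M {a..b} \<gamma> a) \<and>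
        orthogonal_to M (fundamental_tensor L) P' (velocity_lift M {a..b} \<gamma> b) \<and>
        nondegenerate_on (fundamental_tensor L (velocity_lift M {a..b} \<gamma> a)) (tangent_space M P (\<gamma> a)) \<and>
        nondegenerate_on (fundamental_tensor L (velocity_lift M {a..b} \<gamma> b)) (tangent_space M P' (\<gamma> b)) \<and>
        admissible_variation M A a b {} \<epsilon> \<gamma> \<Lambda> \<and>
        (\<forall>s\<in>{-\<epsilon><..<\<epsilon>}. \<Lambda> (a, s) \<in> P \<and> \<Lambda> (b, s) \<in> P')"
    then have var: "admissible_variation M A a b {} \<epsilon> \<gamma> \<Lambda>" and ab: "a < b" by auto
    interpret st: strip M A nabla L Q a b \<epsilon> \<Lambda>
      by (rule admissible_variation_strip[OF var]) (use ab in auto)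
    have eq: "\<gamma> t = \<Lambda> (t, 0)" if "t \<in> {a..b}" for t using var that by (simp add: admissible_variation_def)
    note sv = st.second_variation[OF eq, of P P']
    show "\<forall>\<^sub>F s in nhds 0. (\<lambda>s. energy M L a b (\<lambda>t. \<Lambda> (t, s))) differentiable (at s)"
      by (rule sv(1)) (use * in auto)
    show "(deriv (\<lambda>s. energy M L a b (\<lambda>t. \<Lambda> (t, s))) has_real_derivative
       (integral {a..b} (\<lambda>t. - fundamental_tensor L (velocity_lift M {a..b} \<gamma> t)
             (curvature M A nabla (velocity_lift M {a..b} \<gamma> t) (velocity M {a..b} \<gamma> t) (variation_field M \<Lambda> t) (variation_field M \<Lambda> t))
             (velocity M {a..b} \<gamma> t)
           + fundamental_tensor L (velocity_lift M {a..b} \<gamma> t)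
             (cov_deriv_along M nabla {a..b} \<gamma> (velocity_lift M {a..b} \<gamma> t) (variation_field M \<Lambda>) t)
             (cov_deriv_along M nabla {a..b} \<gamma> (velocity_lift M {a..b} \<gamma> t) (variation_field M \<Lambda>) t))
        + fundamental_tensor L (velocity_lift M {a..b} \<gamma> b)
            (second_fundamental_form M nabla (fundamental_tensor L) P' (velocity_lift M {a..b} \<gamma> b) (variation_field M \<Lambda> b) (variation_field M \<Lambda> b))
            (velocity M {a..b} \<gamma> b)
        - fundamental_tensor L (velocity_lift M {a..b} \<gamma> a)
            (second_fundamental_form M nabla (fundamental_tensor L) P (velocity_lift M {a..b} \<gamma> a) (variation_field M \<Lambda> a) (variation_field M \<Lambda> a))
            (velocity M {a..b} \<gamma> a))) (at 0)"
      by (rule sv(2)) (use * in auto)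
  qed
qed

end
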